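(* Let $\mathcal{A}$ be a Banach algebra and $\Psi$ a $C_w$-automorphism group acting on it. For $0<r<2$ the norm $\|a\|_{\mathcal{P}_r(\mathcal{A})}$ of the Bessel potential space $\mathcal{P}_r(\mathcal{A})$ is equivalent to $$\|a\|_{\mathcal{A}}+\sup_{\epsilon>0}\Bigl\|\int_{|t|_2\ge\epsilon}|t|_2^{-r}\Delta_t(a)\,\frac{dt}{|t|_2^d}\Bigr\|_{\mathcal{A}}.$$ This norm is further equivalent to $$\|a\|_{\mathcal{A}}+\sup_{\epsilon>0}\Bigl\|\int_{\epsilon\le|t|_2\le1}\frac{\Delta_t(a)}{|t|_2^{r}}\,\frac{dt}{|t|_2^d}\Bigr\|_{\mathcal{A}}.$$
   Context: Banach algebras are complex and unital. $|t|_2$ is the Euclidean norm on $\mathbb{R}^d$, and $\Delta_t=\psi_t-\mathrm{id}$. A $d$-parameter automorphism group acting on $\mathcal{A}$ is a family $\Psi=\{\psi_t\}_{t\in\mathbb{R}^d}$ of Banach algebra automorphisms of $\mathcal{A}$ with $\psi_s\psi_t=\psi_{s+t}$ (consisting of $*$-automorphisms if $\mathcal{A}$ is a $*$-algebra), always assumed uniformly bounded: $M_\Psi=\sup_t\|\psi_t\|_{\mathcal{A}\to\mathcal{A}}<\infty$. $C_w$-groups: for $a\in\mathcal{A}$, $a'\in\mathcal{A}'$ (dual space) put $G_{a',a}(t)=\langle a',\psi_t(a)\rangle$, and let $\mathcal{A}'_\Psi=\{a'\in\mathcal{A}': G_{a',a}\text{ is continuous for all }a\in\mathcal{A}\}$.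 $\Psi$ is a $C_w$-group if (i) $\mathcal{A}'_\Psi$ is norm fundamental, i.e. $\|a\|_{\mathcal{A}}=\sup\{|\langle a',a\rangle|:a'\in\mathcal{A}'_\Psi,\|a'\|_{\mathcal{A}'}\le1\}$ for all $a\in\mathcal{A}$, and (ii) the convex hull of every $\sigma(\mathcal{A},\mathcal{A}'_\Psi)$-compact set has $\sigma(\mathcal{A},\mathcal{A}'_\Psi)$-compact closure. Then for every finite Borel measure $\mu$ on $\mathbb{R}^d$ and $a\in\mathcal{A}$ there is an element $\mu*a=\int\psi_{-t}(a)\,d\mu(t)\in\mathcal{A}$ determined by $\langle a',\mu*a\rangle=\int\langle a',\psi_{-t}(a)\rangle\,d\mu(t)$ for all $a'\in\mathcal{A}'_\Psi$; for $f\in L^1(\mathbb{R}^d)$, $f*a$ means $(f\,dt)*a$. The $\mathcal{A}$-valued integrals in the claim are understood in this weak sense. Bessel potential spaces: the Bessel kernel $\mathcal{G}_r\in L^1(\mathbb{R}^d)$, $r>0$, has Fourier transform $\int\mathcal{G}_r(x)e^{-2\pi i\omega\cdot x}dx=(1+|2\pi\omega|_2^2)^{-r/2}$. The Bessel potential space is $\mathcal{P}_r(\mathcal{A})=\{\mathcal{G}_r*y:y\in\mathcal{A}\}$ with norm $\|\mathcal{G}_r*y\|_{\mathcal{P}_r(\mathcal{A})}=\|y\|_{\mathcal{A}}$ (well defined, since $y\mapsto\mathcal{G}_r*y$ is injective on $\mathcal{A}$). *)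

theory Defs
  imports "HOL-Analysis.Analysis"
begin

section \<open>Complex unital Banach algebras\<close>

text \<open>The distribution only has real normed algebras, so the complex scalar multiplication is
  added here. Neither \<open>norm 1 = 1\<close> nor \<open>1 \<noteq> 0\<close> is required.\<close>

class complex_banach_algebra = real_normed_algebra + monoid_mult + banach +
  fixes scaleC :: "complex \<Rightarrow> 'a \<Rightarrow> 'a"
  assumes scaleC_add_right: "scaleC c (x + y) = scaleC c x + scaleC c y"
    and scaleC_add_left: "scaleC (c + c') x = scaleC c x + scaleC c' x"
    and scaleC_scaleC: "scaleC c (scaleC c' x) = scaleC (c * c') x"
    and scaleC_of_real: "scaleC (of_real s) x = s *\<^sub>R x"
    and mult_scaleC_left: "scaleC c x * y = scaleC c (x * y)"
    and mult_scaleC_right: "x * scaleC c y = scaleC c (x * y)"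
    and norm_scaleC: "norm (scaleC c x) = cmod c * norm x"

definition banach_algebra_automorphism :: "('a::complex_banach_algebra \<Rightarrow> 'a) \<Rightarrow> bool" where
  "banach_algebra_automorphism \<phi> \<longleftrightarrow>
     bij \<phi> \<and> bounded_linear \<phi> \<and> (\<forall>c x. \<phi> (scaleC c x) = scaleC c (\<phi> x)) \<and>
     (\<forall>x y. \<phi> (x * y) = \<phi> x * \<phi> y) \<and> \<phi> 1 = 1"

text \<open>The topological dual; its norm is \<^const>\<open>onorm\<close>.\<close>

definition dual_space :: "('a::complex_banach_algebra \<Rightarrow> complex) set" where
  "dual_space = {a'. bounded_linear a' \<and> (\<forall>c x. a' (scaleC c x) = c * a' x)}"

section \<open>Automorphism groups\<close>

definition automorphism_group ::
  "(real^'d \<Rightarrow> 'a::complex_banach_algebra \<Rightarrow> 'a) \<Rightarrow> bool" where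
  "automorphism_group \<psi> \<longleftrightarrow>
     (\<forall>t. banach_algebra_automorphism (\<psi> t)) \<and>
     (\<forall>s t. \<psi> s \<circ> \<psi> t = \<psi> (s + t)) \<and>
     bdd_above (range (\<lambda>t. onorm (\<psi> t)))"

definition dual_Psi ::
  "(real^'d \<Rightarrow> 'a::complex_banach_algebra \<Rightarrow> 'a) \<Rightarrow> ('a \<Rightarrow> complex) set" where
  "dual_Psi \<psi> = {a' \<in> dual_space. \<forall>a. continuous_on UNIV (\<lambda>t. a' (\<psi> t a))}"

definition norm_fundamental :: "('a::complex_banach_algebra \<Rightarrow> complex) set \<Rightarrow> bool" where
  "norm_fundamental D \<longleftrightarrow>
     (\<forall>a. norm a = (SUP a'\<in>{a' \<in> D. onorm a' \<le> 1}. cmod (a' a)))"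

text \<open>The topology \<open>\<sigma>(A, D)\<close>: the coarsest one making all functionals in \<open>D\<close> continuous.\<close>

definition sigma_topology :: "('a \<Rightarrow> complex) set \<Rightarrow> 'a topology" where
  "sigma_topology D = topology_generated_by {a' -` U | a' U. a' \<in> D \<and> open U}"

definition Cw_group :: "(real^'d \<Rightarrow> 'a::complex_banach_algebra \<Rightarrow> 'a) \<Rightarrow> bool" where
  "Cw_group \<psi> \<longleftrightarrow>
     automorphism_group \<psi> \<and>
     norm_fundamental (dual_Psi \<psi>) \<and>
     (\<forall>K. compactin (sigma_topology (dual_Psi \<psi>)) K \<longrightarrow>
        compactin (sigma_topology (dual_Psi \<psi>))
          (sigma_topology (dual_Psi \<psi>) closure_of (convex hull K)))"

section \<open>Weak integrals\<close>

definition has_weak_integral ::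
  "(real^'d \<Rightarrow> 'a::complex_banach_algebra \<Rightarrow> 'a) \<Rightarrow> (real^'d) set \<Rightarrow> (real^'d \<Rightarrow> 'a) \<Rightarrow> 'a \<Rightarrow> bool" where
  "has_weak_integral \<psi> S F x \<longleftrightarrow>
     (\<forall>a'\<in>dual_Psi \<psi>. set_integrable lborel S (\<lambda>t. a' (F t)) \<and>
        a' x = (LINT t:S|lborel. a' (F t)))"

text \<open>If \<open>dual_Psi \<psi>\<close> is norm fundamental, it separates points, so there is at most one
  weak integral.\<close>

definition weak_integral ::
  "(real^'d \<Rightarrow> 'a::complex_banach_algebra \<Rightarrow> 'a) \<Rightarrow> (real^'d) set \<Rightarrow> (real^'d \<Rightarrow> 'a) \<Rightarrow> 'a" where
  "weak_integral \<psi> S F = (THE x. has_weak_integral \<psi> S F x)"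

definition conv ::
  "(real^'d \<Rightarrow> 'a::complex_banach_algebra \<Rightarrow> 'a) \<Rightarrow> (real^'d \<Rightarrow> complex) \<Rightarrow> 'a \<Rightarrow> 'a" where
  "conv \<psi> f a = weak_integral \<psi> UNIV (\<lambda>t. scaleC (f t) (\<psi> (- t) a))"

section \<open>Bessel potential spaces\<close>

definition is_bessel_kernel :: "real \<Rightarrow> (real^'d \<Rightarrow> complex) \<Rightarrow> bool" where
  "is_bessel_kernel r G \<longleftrightarrow>
     integrable lborel G \<and>
     (\<forall>\<omega>. (LINT x|lborel. G x * exp (- 2 * of_real pi * \<i> * of_real (\<omega> \<bullet> x))) =
          of_real ((1 + (norm ((2 * pi) *\<^sub>R \<omega>))\<^sup>2) powr (- r / 2)))"

text \<open>The Fourier transform determines the kernel up to a null set, which is irrelevant for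
  \<^const>\<open>conv\<close>.\<close>

definition bessel_kernel :: "real \<Rightarrow> real^'d \<Rightarrow> complex" where
  "bessel_kernel r = (SOME G. is_bessel_kernel r G)"

definition bessel_space ::
  "(real^'d \<Rightarrow> 'a::complex_banach_algebra \<Rightarrow> 'a) \<Rightarrow> real \<Rightarrow> 'a set" where
  "bessel_space \<psi> r = range (conv \<psi> (bessel_kernel r))"

text \<open>Only meaningful on \<^const>\<open>bessel_space\<close>, where the \<open>y\<close> exists.\<close>

definition bessel_norm ::
  "(real^'d \<Rightarrow> 'a::complex_banach_algebra \<Rightarrow> 'a) \<Rightarrow> real \<Rightarrow> 'a \<Rightarrow> real" where
  "bessel_norm \<psi> r a = norm (THE y. conv \<psi> (bessel_kernel r) y = a)"

text \<open>Values in \<^typ>\<open>ennreal\<close> let a norm be given by a supremum whose finiteness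
  is not known beforehand: equivalence to a finite \<open>N\<close> forces \<open>N'\<close> to be finite on \<open>V\<close>.\<close>

definition equivalent_norms_on ::
  "'a set \<Rightarrow> ('a \<Rightarrow> ennreal) \<Rightarrow> ('a \<Rightarrow> ennreal) \<Rightarrow> bool" where
  "equivalent_norms_on V N N' \<longleftrightarrow>
     (\<exists>c C::real. 0 < c \<and> 0 < C \<and>
        (\<forall>a\<in>V. ennreal c * N a \<le> N' a \<and> N' a \<le> ennreal C * N a))"

end

theory Submission
  imports Defs "HOL-Probability.Characteristic_Functions"
begin

text \<open>
  Testing against functionals \<open>a'\<close> in \<open>dual_Psi \<psi>\<close> turns everything into a statement about the bounded
  continuous functions \<open>u t = a' (\<psi> t y)\<close> and \<open>v t = a' (\<psi> t a)\<close>, where \<open>a = G\<^sub>r * y\<close>.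
  With \<open>\<alpha> = r / 2\<close>, the Bessel kernel is a Gamma mean of Gaussians, so \<open>v\<close> is the fractional integral
  of order \<open>\<alpha>\<close> of the semigroup \<open>exp (-s) H\<^sub>s u\<close>, where \<open>H\<^sub>s\<close> is the heat semigroup. Its truncated Marchaud
  derivatives are bounded by \<open>|u|\<close> and converge to a multiple of \<open>u\<close>; replacing \<open>exp (-s)\<close> by \<open>1\<close> in them
  costs a multiple of \<open>|v|\<close> and yields
  \<open>T\<^sub>\<delta> = \<integral>\<^sub>\<delta>\<^bsup>\<infinity>\<^esup> s\<^bsup>-1-\<alpha>\<^esup> (H\<^sub>s v - v) ds\<close>, the integral of \<open>v t - v 0\<close> against a smooth radial truncation
  of \<open>|t|\<^bsup>-r-d\<^esup>\<close>. That smooth truncation is an average of the sharp ones, which bounds \<open>u\<close> by \<open>v\<close> and the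
  hypersingular integrals. Conversely, each sharp truncation differs from a smooth one by a kernel
  that is harmless because the second differences of \<open>v\<close> are \<open>O(|t|\<^sup>r)\<close> for \<open>r < 2\<close>.
\<close>

section \<open>Gaussians\<close>

text \<open>Both scalar estimates are proved at the single point t = 0, with constants that depend
  on the functional only through a bound \<open>B\<close> of u and a bound \<open>C\<close> of v. As
  \<open>dual_Psi \<psi>\<close> is norm fundamental, letting the functional range over those of
  norm at most 1 returns them to the algebra. The two directions are not symmetric. In the upper
  estimate every error may be paid by u. In the lower one u must not occur on the right, so the
  correction for exp (-s) is charged to v, and smooth truncations are passed to sharp ones by
  averaging, without an error term. The heat semigroup replaces Fourier analysis of the
  hypersingular kernel: its semigroup law moves the problem to the half-line in s, where fractional
  integrals are inverted explicitly, and known masses of Gaussian mixtures replace polar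
  coordinates. \<open>conv\<close> and the weak integrals are definite descriptions, hence
  meaningful only once the integrals exist; this is where the compactness condition on convex hulls
  enters. Injectivity of y -> G_r * y is a consequence of the lower estimate.\<close>

lemmas lint_diff = Bochner_Integration.integral_diff
  and lint_add = Bochner_Integration.integral_add
  and lint_cong = Bochner_Integration.integral_cong
  and integrable_dominated = Bochner_Integration.integrable_bound
  and integrable_plus = Bochner_Integration.integrable_add
  and integrable_minus = Bochner_Integration.integrable_diff

section \<open>Lebesgue integrals under scaling and in product form\<close>

lemma lborel_scale_integral:
  fixes f :: "'e::euclidean_space \<Rightarrow> 'b::{banach, second_countable_topology}"
  assumes c: "c \<noteq> 0"
  shows "integrable lborel (\<lambda>x. f (t + c *\<^sub>R x)) \<longleftrightarrow> integrable lborel f"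
    and "(LBINT x. f x) = \<bar>c\<bar> ^ DIM('e) *\<^sub>R (LBINT x. f (t + c *\<^sub>R x))"
proof -
  have *: "integrable lborel (\<lambda>x. g (u + b *\<^sub>R x))" if g: "integrable lborel g" and b: "b \<noteq> 0"
    for b u and g :: "'e \<Rightarrow> 'b"
  proof -
    have [measurable]: "g \<in> borel_measurable borel" using g by auto
    have "integrable (density (distr lborel borel (\<lambda>x::'e. u + b *\<^sub>R x)) (\<lambda>_. \<bar>b\<bar> ^ DIM('e))) g"
      using g lborel_affine[OF b, of u] by simp
    hence "integrable (distr lborel borel (\<lambda>x::'e. u + b *\<^sub>R x)) (\<lambda>x. \<bar>b\<bar> ^ DIM('e) *\<^sub>R g x)"
      by (subst (asm) integrable_density) auto
    hence "integrable lborel (\<lambda>x. \<bar>b\<bar> ^ DIM('e) *\<^sub>R g (u + b *\<^sub>R x))"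
      by (subst (asm) integrable_distr_eq) auto
    hence "integrable lborel (\<lambda>x. inverse (\<bar>b\<bar> ^ DIM('e)) *\<^sub>R (\<bar>b\<bar> ^ DIM('e) *\<^sub>R g (u + b *\<^sub>R x)))"
      by (rule integrable_bounded_linear[OF bounded_linear_scaleR_right])
    thus ?thesis using b by simp
  qed
  have inv: "(\<lambda>x. f (t + c *\<^sub>R (- (inverse c *\<^sub>R t) + inverse c *\<^sub>R x))) = f"
    using c by (simp add: scaleR_add_right scaleR_diff_right)
  show int: "integrable lborel (\<lambda>x. f (t + c *\<^sub>R x)) \<longleftrightarrow> integrable lborel f"
    using *[of f c t] *[of "\<lambda>x. f (t + c *\<^sub>R x)" "inverse c" "- (inverse c *\<^sub>R t)"] inv c by auto
  show "(LBINT x. f x) = \<bar>c\<bar> ^ DIM('e) *\<^sub>R (LBINT x. f (t + c *\<^sub>R x))"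
  proof (cases "integrable lborel f")
    case True
    hence [measurable]: "f \<in> borel_measurable borel" by auto
    have "(LBINT x. f x) =
        (LINT x|density (distr lborel borel (\<lambda>x::'e. t + c *\<^sub>R x)) (\<lambda>_. \<bar>c\<bar> ^ DIM('e)). f x)"
      using lborel_affine[OF c, of t] by simp
    also have "\<dots> = (LBINT x. \<bar>c\<bar> ^ DIM('e) *\<^sub>R f (t + c *\<^sub>R x))"
      by (subst integral_density) (auto simp: integral_distr)
    finally show ?thesis by simp
  next
    \<comment> \<open>\<open>f\<close> and its rescaling fail to be integrable together, and then
      both integrals are 0 by convention.\<close>
    case False
    thus ?thesis using int by (simp add: not_integrable_integral_eq)
  qed
qed

lemma lborel_affine_integral:
  fixes f :: "'e::euclidean_space \<Rightarrow> 'b::{banach, second_countable_topology}"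
  assumes "c = 1 \<or> c = -1"
  shows "integrable lborel (\<lambda>x. f (t + c *\<^sub>R x)) \<longleftrightarrow> integrable lborel f"
    and "(LBINT x. f (t + c *\<^sub>R x)) = (LBINT x. f x)"
  using lborel_scale_integral[of c f t] assms by auto

text \<open>\<open>lborel\<close> is the image of the product measure on coordinates under the map
  that sums g b times b over the basis, and along this map the integrand factors.\<close>

lemma lborel_product_integral:
  fixes f :: "'e::euclidean_space \<Rightarrow> real \<Rightarrow> 'b::{real_normed_field, banach, second_countable_topology}"
  assumes int: "\<And>b. b \<in> Basis \<Longrightarrow> integrable lborel (f b)"
  shows "integrable lborel (\<lambda>x::'e. \<Prod>b\<in>Basis. f b (x \<bullet> b))"
    and "(LBINT x. (\<Prod>b\<in>Basis. f b (x \<bullet> b))) = (\<Prod>b\<in>Basis. (LBINT x. f b x))"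
proof -
  interpret product_sigma_finite "\<lambda>_::'e. lborel :: real measure" ..
  have [measurable]: "\<And>b. b \<in> Basis \<Longrightarrow> f b \<in> borel_measurable borel"
    using borel_measurable_integrable[OF int] by simp
  have m[measurable]: "(\<lambda>x::'e. \<Prod>b\<in>Basis. f b (x \<bullet> b)) \<in> borel_measurable borel"
    by measurable
  have c: "(\<Prod>b\<in>Basis. f b ((\<Sum>c\<in>Basis. g c *\<^sub>R c) \<bullet> b)) = (\<Prod>b\<in>Basis. f b (g b))" for g
    by (intro prod.cong refl) (simp add: inner_sum_left inner_Basis if_distrib cong: if_cong)
  let ?P = "\<Pi>\<^sub>M b\<in>(Basis::'e set). (lborel :: real measure)"
  have g: "(\<lambda>g. \<Sum>b\<in>Basis. g b *\<^sub>R b) \<in> ?P \<rightarrow>\<^sub>M (borel :: 'e measure)"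
    by measurable
  have p: "integrable ?P (\<lambda>g. \<Prod>b\<in>Basis. f b (g b))"
    by (rule product_integrable_prod[OF finite_Basis int])
  show "integrable lborel (\<lambda>x::'e. \<Prod>b\<in>Basis. f b (x \<bullet> b))"
    unfolding lborel_eq[where 'a = 'e] integrable_distr_eq[OF g m] c by (rule p)
  show "(LBINT x. (\<Prod>b\<in>Basis. f b (x \<bullet> b))) = (\<Prod>b\<in>Basis. (LBINT x. f b x))"
    unfolding lborel_eq[where 'a = 'e] integral_distr[OF g m] c
    by (rule product_integral_prod[OF finite_Basis int])
qed

section \<open>The heat kernel, its Fourier transform and its semigroup law\<close>

text \<open>Kernel of the semigroup generated by the full Laplacian, so each coordinate has variance
  2 s. The value 0 for s \<le> 0 lets integrals in s run over the whole line.\<close>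

definition heat :: "real \<Rightarrow> 'e::euclidean_space \<Rightarrow> real" where
  "heat s x = (if s > 0 then (4 * pi * s) powr (- (DIM('e) / 2)) * exp (- (norm x)\<^sup>2 / (4 * s)) else 0)"

lemma heat_nonneg [simp]: "0 \<le> heat s x"
  by (simp add: heat_def)

lemma heat_minus [simp]: "heat s (- x) = heat s x"
  by (simp add: heat_def)

lemma heat_measurable [measurable]:
  assumes [measurable]: "f \<in> borel_measurable M" "g \<in> borel_measurable M"
  shows "(\<lambda>x. heat (f x) (g x)) \<in> borel_measurable M"
  unfolding heat_def by measurable

text \<open>Rescaling by the standard deviation sqrt (2 s) turns the characteristic function exp
  (-x^2 / 2) of the standard normal law into exp (-s x^2).\<close>

lemma normal_fourier_transform:
  assumes "s > 0"
  shows "integrable lborel (\<lambda>x. of_real (normal_density 0 (sqrt (2 * s)) x) * iexp (\<xi> * x))"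
    and "(CLBINT x. of_real (normal_density 0 (sqrt (2 * s)) x) * iexp (\<xi> * x))
          = of_real (exp (- s * \<xi>\<^sup>2))"
proof -
  have m: "(\<lambda>x. of_real (normal_density 0 (sqrt (2 * s)) x) * iexp (\<xi> * x)) \<in> borel_measurable lborel"
    by (simp, measurable)
  show "integrable lborel (\<lambda>x. of_real (normal_density 0 (sqrt (2 * s)) x) * iexp (\<xi> * x))"
    by (rule integrable_dominated[OF _ m, of "normal_density 0 (sqrt (2 * s))"])
      (use assms in \<open>simp_all add: norm_mult\<close>)
  let ?c = "sqrt (2 * s)"
  have c: "?c > 0" using assms by simp
  have "of_real (exp (- s * \<xi>\<^sup>2)) = of_real (exp (- (?c * \<xi>)\<^sup>2 / 2))"
    using assms by (simp add: power_mult_distrib)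
  also have "\<dots> = char std_normal_distribution (?c * \<xi>)"
    by (simp add: char_std_normal_distribution)
  also have "\<dots> = (CLBINT x. std_normal_density x *\<^sub>R iexp (?c * \<xi> * x))"
    unfolding char_def by (subst integral_density) auto
  also have "\<dots> = (CLBINT x. \<bar>?c\<bar> *\<^sub>R (of_real (normal_density 0 ?c (0 + ?c * x)) * iexp (\<xi> * (0 + ?c * x))))"
  proof (intro lint_cong refl)
    fix x :: real
    have "std_normal_density x = \<bar>?c\<bar> * normal_density 0 ?c (0 + ?c * x)"
      using assms c by (simp add: normal_density_def real_sqrt_mult power_mult_distrib divide_simps)
    thus "std_normal_density x *\<^sub>R iexp (?c * \<xi> * x) =
        \<bar>?c\<bar> *\<^sub>R (of_real (normal_density 0 ?c (0 + ?c * x)) * iexp (\<xi> * (0 + ?c * x)))"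
      by (simp add: scaleR_conv_of_real mult_ac)
  qed
  also have "\<dots> = (CLBINT x. of_real (normal_density 0 ?c x) * iexp (\<xi> * x))"
    using c by (subst (2) lborel_integral_real_affine[where c = ?c and t = 0]) auto
  finally show "(CLBINT x. of_real (normal_density 0 (sqrt (2 * s)) x) * iexp (\<xi> * x))
          = of_real (exp (- s * \<xi>\<^sup>2))" ..
qed

lemma heat_eq_prod:
  fixes x :: "'e::euclidean_space"
  assumes "s > 0"
  shows "heat s x = (\<Prod>b\<in>Basis. normal_density 0 (sqrt (2 * s)) (x \<bullet> b))"
proof -
  have n: "normal_density 0 (sqrt (2 * s)) y = 1 / sqrt (4 * pi * s) * exp (- y\<^sup>2 / (4 * s))" for y
    using assms by (simp add: normal_density_def mult_ac)
  have "(\<Prod>b\<in>Basis. normal_density 0 (sqrt (2 * s)) (x \<bullet> b))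
      = (1 / sqrt (4 * pi * s)) ^ DIM('e) * exp (\<Sum>b\<in>Basis. - (x \<bullet> b)\<^sup>2 / (4 * s))"
    unfolding n prod.distrib prod_constant exp_sum[OF finite_Basis] ..
  also have "(\<Sum>b\<in>Basis. - (x \<bullet> b)\<^sup>2 / (4 * s)) = - (norm x)\<^sup>2 / (4 * s)"
    unfolding power2_norm_eq_inner
    by (subst euclidean_inner) (simp add: sum_divide_distrib power2_eq_square sum_negf)
  also have "1 / sqrt (4 * pi * s) = (4 * pi * s) powr (- (1 / 2))"
    using assms by (simp add: powr_half_sqrt powr_minus_divide)
  also have "\<dots> ^ DIM('e) = (4 * pi * s) powr (- (DIM('e) / 2))"
    using assms by (simp add: powr_power)
  finally show ?thesis using assms by (simp add: heat_def)
qed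

lemma heat_fourier_transform:
  fixes \<xi> :: "'e::euclidean_space"
  assumes "s > 0"
  shows "integrable lborel (\<lambda>x. of_real (heat s x) * iexp (\<xi> \<bullet> x))"
    and "(CLBINT x. of_real (heat s x) * iexp (\<xi> \<bullet> x)) = of_real (exp (- s * (norm \<xi>)\<^sup>2))"
proof -
  have eq: "of_real (heat s x) * iexp (\<xi> \<bullet> x) =
     (\<Prod>b\<in>Basis. of_real (normal_density 0 (sqrt (2 * s)) (x \<bullet> b)) * iexp ((\<xi> \<bullet> b) * (x \<bullet> b)))" for x :: 'e
  proof -
    have "\<xi> \<bullet> x = (\<Sum>b\<in>Basis. (\<xi> \<bullet> b) * (x \<bullet> b))"
      by (rule euclidean_inner)
    thus ?thesis
      by (simp add: heat_eq_prod[OF assms] prod.distrib sum_distrib_left flip: exp_sum)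
  qed
  show "integrable lborel (\<lambda>x. of_real (heat s x) * iexp (\<xi> \<bullet> x))"
    unfolding eq by (intro lborel_product_integral normal_fourier_transform assms)
  have "(CLBINT x. of_real (heat s x) * iexp (\<xi> \<bullet> x)) =
      (\<Prod>b\<in>Basis. of_real (exp (- s * (\<xi> \<bullet> b)\<^sup>2)))"
    unfolding eq by (subst lborel_product_integral)
       (auto intro!: prod.cong simp only: normal_fourier_transform assms)
  also have "\<dots> = of_real (exp (\<Sum>b\<in>Basis. - s * (\<xi> \<bullet> b)\<^sup>2))"
    by (simp only: exp_sum finite_Basis of_real_prod)
  also have "(\<Sum>b\<in>Basis. - s * (\<xi> \<bullet> b)\<^sup>2) = - s * (norm \<xi>)\<^sup>2"
    unfolding power2_norm_eq_inner
    by (subst euclidean_inner) (simp add: sum_distrib_left power2_eq_square sum_negf)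
  finally show "(CLBINT x. of_real (heat s x) * iexp (\<xi> \<bullet> x)) = of_real (exp (- s * (norm \<xi>)\<^sup>2))" .
qed

lemma integrable_heat [simp, intro]: "integrable lborel (heat s :: 'e::euclidean_space \<Rightarrow> real)"
proof (cases "s > 0")
  case True
  have "integrable lborel (\<lambda>x::'e. Re (of_real (heat s x) * iexp (0 \<bullet> x)))"
    using heat_fourier_transform(1)[OF True, of "0::'e"] by (rule integrable_Re)
  thus ?thesis by simp
next
  case False
  hence "heat s = (\<lambda>_::'e. 0)" by (auto simp: heat_def)
  thus ?thesis by simp
qed

lemma integral_heat:
  assumes "s > 0"
  shows "(LBINT x. heat s (x::'e::euclidean_space)) = 1"
proof -
  have "(CLBINT x. of_real (heat s (x::'e))) = (1::complex)"
    using heat_fourier_transform(2)[OF assms, of "0::'e"] by simp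
  thus ?thesis
    by (metis integral_complex_of_real of_real_eq_1_iff)
qed

text \<open>Completing the square in y. The last factor is a translated heat kernel in y at time s t
  / (s + t), so integrating over y gives the semigroup law.\<close>

lemma heat_mult_heat:
  fixes x y :: "'e::euclidean_space"
  assumes "s > 0" "t > 0"
  shows "heat s (x - y) * heat t y = heat (s + t) x * heat (s * t / (s + t)) (y - (t / (s + t)) *\<^sub>R x)"
proof -
  have st: "s + t > 0" using assms by simp
  \<comment> \<open>With the three inner products as scalars the comparison of exponents becomes a
    rational identity.\<close>
  define a b c where "a = x \<bullet> x" and "b = x \<bullet> y" and "c = y \<bullet> y"
  have n: "(norm (x - y))\<^sup>2 = a - 2 * b + c" "(norm x)\<^sup>2 = a" "(norm y)\<^sup>2 = c"
    "(norm (y - k *\<^sub>R x))\<^sup>2 = c - 2 * k * b + k\<^sup>2 * a" for k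
    unfolding power2_norm_eq_inner a_def b_def c_def
    by (simp_all add: inner_diff_left inner_diff_right inner_commute[of y x] power2_eq_square algebra_simps)
  have a: "(norm (x - y))\<^sup>2 / (4 * s) + (norm y)\<^sup>2 / (4 * t) =
     (norm x)\<^sup>2 / (4 * (s + t)) + (norm (y - (t / (s + t)) *\<^sub>R x))\<^sup>2 / (4 * (s * t / (s + t)))"
  proof -
    have "c - 2 * (t / (s + t)) * b + (t / (s + t))\<^sup>2 * a
        = (c * (s + t)\<^sup>2 - 2 * t * b * (s + t) + t\<^sup>2 * a) / (s + t)\<^sup>2"
      using st by (simp add: divide_simps) (simp add: algebra_simps power2_eq_square)
    also have "\<dots> / (4 * (s * t / (s + t)))
        = (c * (s + t)\<^sup>2 - 2 * t * b * (s + t) + t\<^sup>2 * a) / (4 * s * t * (s + t))"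
      using st assms by (simp add: divide_simps power2_eq_square)
    finally have *: "(c - 2 * (t / (s + t)) * b + (t / (s + t))\<^sup>2 * a) / (4 * (s * t / (s + t)))
        = (c * (s + t)\<^sup>2 - 2 * t * b * (s + t) + t\<^sup>2 * a) / (4 * s * t * (s + t))" .
    show ?thesis unfolding n * using assms st
      by (simp add: divide_simps) (simp add: algebra_simps power2_eq_square)
  qed
  have "(4 * pi * s) * (4 * pi * t) = (4 * pi * (s + t)) * (4 * pi * (s * t / (s + t)))"
    using st by simp
  hence b: "(4 * pi * s) powr p * (4 * pi * t) powr p =
     (4 * pi * (s + t)) powr p * (4 * pi * (s * t / (s + t))) powr p" for p
    using assms by (simp only: powr_mult[symmetric])
  have "heat s (x - y) * heat t y = ((4 * pi * s) powr (- (DIM('e) / 2)) * (4 * pi * t) powr (- (DIM('e) / 2)))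
      * exp (- ((norm (x - y))\<^sup>2 / (4 * s) + (norm y)\<^sup>2 / (4 * t)))"
    unfolding minus_add_distrib exp_add by (use assms in \<open>simp add: heat_def exp_add mult_ac\<close>)
  also have "\<dots> = heat (s + t) x * heat (s * t / (s + t)) (y - (t / (s + t)) *\<^sub>R x)"
    unfolding a b minus_add_distrib exp_add by (use assms st in \<open>simp add: heat_def mult_ac\<close>)
  finally show ?thesis .
qed

lemma heat_translate:
  shows "integrable lborel (\<lambda>w::'e::euclidean_space. heat s (w + t))"
    and "integrable lborel (\<lambda>w::'e. heat s (w - t))"
    and "s > 0 \<Longrightarrow> (LBINT w. heat s (w + t :: 'e)) = 1"
    and "s > 0 \<Longrightarrow> (LBINT w. heat s (w - t :: 'e)) = 1"
  using lborel_affine_integral[of 1 "heat s" t] lborel_affine_integral[of 1 "heat s" "- t"]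
    integral_heat[of s, where 'e = 'e]
  by (auto simp: add.commute)

lemma heat_semigroup:
  fixes x :: "'e::euclidean_space"
  assumes "s > 0" "t > 0"
  shows "integrable lborel (\<lambda>y. heat s (x - y) * heat t y)"
    and "(LBINT y. heat s (x - y) * heat t y) = heat (s + t) x"
  unfolding heat_mult_heat[OF assms] using assms by (auto simp: heat_translate)

text \<open>With \<open>q = |t|\<^sup>2 / 4s\<close>, the inequality \<open>cosh \<ge> 1\<close> makes
  \<open>heat s (w - t) + heat s (w + t) - 2 exp (-q) heat s w\<close> nonnegative, so its \<open>L\<^sup>1\<close> norm is its
  integral.\<close>

lemma heat_second_difference:
  fixes t :: "'e::euclidean_space"
  assumes "s > 0"
  shows "(LBINT w. \<bar>heat s (w - t) + heat s (w + t) - 2 * heat s w\<bar>) \<le> min 4 ((norm t)\<^sup>2 / s)"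
proof -
  define q where "q = (norm t)\<^sup>2 / (4 * s)"
  have q: "q \<ge> 0" using assms by (simp add: q_def)
  have e: "heat s (w - t) + heat s (w + t) \<ge> 2 * exp (- q) * heat s w" for w :: 'e
  proof -
    define p where "p = (w \<bullet> t) / (2 * s)"
    have h: "heat s (w - t) = exp p * (exp (- q) * heat s w)" "heat s (w + t) = exp (- p) * (exp (- q) * heat s w)"
    proof -
      have "- (norm (w - t))\<^sup>2 / (4 * s) = p + (- q + - (norm w)\<^sup>2 / (4 * s))"
        "- (norm (w + t))\<^sup>2 / (4 * s) = - p + (- q + - (norm w)\<^sup>2 / (4 * s))"
        using assms unfolding power2_norm_eq_inner p_def q_def
        by (simp_all add: inner_diff_left inner_diff_right inner_add_left inner_add_right inner_commute[of t w] field_simps)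
      thus "heat s (w - t) = exp p * (exp (- q) * heat s w)" "heat s (w + t) = exp (- p) * (exp (- q) * heat s w)"
        using assms by (simp_all only: heat_def exp_add if_True mult_ac)
    qed
    have "exp p + exp (- p) \<ge> 2"
      using cosh_real_ge_1[of p] by (simp add: cosh_def)
    hence "(exp p + exp (- p)) * (exp (- q) * heat s w) \<ge> 2 * (exp (- q) * heat s w)"
      by (intro mult_right_mono) auto
    thus ?thesis unfolding h by (simp add: algebra_simps)
  qed
  \<comment> \<open>Triangle inequality through 2 exp (-q) \<open>heat s w\<close>: the nonnegative
    difference contributes itself, and the remaining 2 (1 - exp (-q)) \<open>heat s w\<close> makes
    the coefficient 2 - 4 exp (-q).\<close>
  have "(LBINT w. \<bar>heat s (w - t) + heat s (w + t) - 2 * heat s w\<bar>)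
      \<le> (LBINT w. heat s (w - t) + heat s (w + t) + (2 - 4 * exp (- q)) * heat s w)"
  proof (rule integral_mono)
    fix w :: 'e
    have "exp (- q) * heat s w \<le> 1 * heat s w" using q by (intro mult_right_mono) auto
    thus "\<bar>heat s (w - t) + heat s (w + t) - 2 * heat s w\<bar>
       \<le> heat s (w - t) + heat s (w + t) + (2 - 4 * exp (- q)) * heat s w"
      using e[of w] by (simp add: algebra_simps abs_le_iff)
  qed (intro integrable_abs integrable_plus integrable_minus
      integrable_mult_right heat_translate integrable_heat)+
  also have "\<dots> = 4 * (1 - exp (- q))"
    using assms by (simp add: heat_translate integral_heat)
  also have "\<dots> \<le> min 4 (4 * q)"
    using exp_ge_add_one_self[of "- q"] by simp
  also have "4 * q = (norm t)\<^sup>2 / s" by (simp add: q_def)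
  finally show ?thesis .
qed

section \<open>Heat means and the Bessel kernel\<close>

text \<open>An integrable weight times sections of L1 norm at most \<open>K\<close> is integrable on
  the product. The conditions on sections concern points with \<open>f x \<noteq> 0\<close>: the
  weights in s used later live on positive s, and the estimates of the kernels are made
  there.\<close>

lemma integrable_kernel:
  fixes f :: "'x::euclidean_space \<Rightarrow> complex" and k :: "'x \<Rightarrow> 'y::euclidean_space \<Rightarrow> complex"
  assumes f: "integrable lborel f"
    and k[measurable]: "case_prod k \<in> borel_measurable (lborel \<Otimes>\<^sub>M lborel)"
    and int: "\<And>x. f x \<noteq> 0 \<Longrightarrow> integrable lborel (k x)"
    and bd: "\<And>x. f x \<noteq> 0 \<Longrightarrow> (LBINT y. cmod (k x y)) \<le> K"
  shows "integrable (lborel \<Otimes>\<^sub>M lborel) (\<lambda>(x, y). f x * k x y)"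
proof (rule lborel_pair.Fubini_integrable)
  have [measurable]: "f \<in> borel_measurable lborel" using f by auto
  show "(\<lambda>(x, y). f x * k x y) \<in> borel_measurable (lborel \<Otimes>\<^sub>M lborel)"
    by measurable
  show "AE x in lborel. integrable lborel (\<lambda>y. case (x, y) of (x, y) \<Rightarrow> f x * k x y)"
  proof (rule AE_I2)
    fix x show "integrable lborel (\<lambda>y. case (x, y) of (x, y) \<Rightarrow> f x * k x y)"
      using int[of x] by (cases "f x = 0") auto
  qed
  show "integrable lborel (\<lambda>x. LBINT y. norm (case (x, y) of (x, y) \<Rightarrow> f x * k x y))"
  proof (rule integrable_dominated[of _ "\<lambda>x. of_real K * f x"])
    show "integrable lborel (\<lambda>x. of_real K * f x)" using f by simp
    show "(\<lambda>x. LBINT y. norm (case (x, y) of (x, y) \<Rightarrow> f x * k x y)) \<in> borel_measurable lborel"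
      by measurable
    show "AE x in lborel. norm (LBINT y. norm (case (x, y) of (x, y) \<Rightarrow> f x * k x y))
        \<le> norm (of_real K * f x)"
    proof (rule AE_I2)
      fix x
      have nn: "0 \<le> (LBINT y. cmod (k x y))" by simp
      show "norm (LBINT y. norm (case (x, y) of (x, y) \<Rightarrow> f x * k x y)) \<le> norm (of_real K * f x)"
      proof (cases "f x = 0")
        case False
        have "norm (LBINT y. norm (case (x, y) of (x, y) \<Rightarrow> f x * k x y))
            = cmod (f x) * (LBINT y. cmod (k x y))"
          by (simp add: norm_mult)
        also have "\<dots> \<le> cmod (f x) * \<bar>K\<bar>"
          using bd[OF False] nn by (intro mult_left_mono) auto
        finally show ?thesis by (simp add: norm_mult mult_ac)
      qed simp
    qed
  qed
qed

lemma Fubini_kernel: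
  fixes f :: "'x::euclidean_space \<Rightarrow> complex" and k :: "'x \<Rightarrow> 'y::euclidean_space \<Rightarrow> complex"
  assumes f: "integrable lborel f"
    and k[measurable]: "case_prod k \<in> borel_measurable (lborel \<Otimes>\<^sub>M lborel)"
    and int: "\<And>x. f x \<noteq> 0 \<Longrightarrow> integrable lborel (k x)"
    and bd: "\<And>x. f x \<noteq> 0 \<Longrightarrow> (LBINT y. cmod (k x y)) \<le> K"
  shows "(LBINT x. f x * (LBINT y. k x y)) = (LBINT y. (LBINT x. f x * k x y))"
    and "integrable lborel (\<lambda>y. LBINT x. f x * k x y)"
    and "integrable lborel (\<lambda>x. f x * (LBINT y. k x y))"
proof -
  note i = integrable_kernel[OF assms]
  show "(LBINT x. f x * (LBINT y. k x y)) = (LBINT y. (LBINT x. f x * k x y))"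
    using lborel_pair.Fubini_integral[OF i] by simp
  show "integrable lborel (\<lambda>y. LBINT x. f x * k x y)"
    using lborel_pair.integrable_snd[OF i] by simp
  show "integrable lborel (\<lambda>x. f x * (LBINT y. k x y))"
    using lborel_pair.integrable_fst'[OF i] by simp
qed

lemma integrable_mult_bounded:
  fixes f h :: "'x::euclidean_space \<Rightarrow> complex"
  assumes f: "integrable lborel f" and h[measurable]: "h \<in> borel_measurable borel" and bd: "\<And>x. cmod (h x) \<le> B"
  shows "integrable lborel (\<lambda>x. f x * h x)"
    and "(LBINT x. cmod (f x * h x)) \<le> B * (LBINT x. cmod (f x))"
    and "cmod (LBINT x. f x * h x) \<le> B * (LBINT x. cmod (f x))"
proof -
  have [measurable]: "f \<in> borel_measurable borel" using f by auto
  have B: "0 \<le> B" using bd[of undefined] norm_ge_zero order_trans by blast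
  have le: "cmod (f x * h x) \<le> B * cmod (f x)" for x
    using mult_left_mono[OF bd[of x], of "cmod (f x)"] by (simp add: norm_mult mult.commute)
  show i: "integrable lborel (\<lambda>x. f x * h x)"
  proof (rule integrable_dominated[of _ "\<lambda>x. of_real B * f x"])
    show "AE x in lborel. norm (f x * h x) \<le> norm (of_real B * f x)"
      using le B by (auto simp: norm_mult)
  qed (use f in auto)
  have "(LBINT x. cmod (f x * h x)) \<le> (LBINT x. B * cmod (f x))"
    using le i f by (intro integral_mono) auto
  thus l: "(LBINT x. cmod (f x * h x)) \<le> B * (LBINT x. cmod (f x))" by simp
  show "cmod (LBINT x. f x * h x) \<le> B * (LBINT x. cmod (f x))"
    using l integral_norm_bound[of lborel "\<lambda>x. f x * h x"] by linarith
qed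

section \<open>The Gamma law\<close>

definition gamma_density :: "real \<Rightarrow> real \<Rightarrow> real" where
  "gamma_density \<alpha> s = (if s > 0 then s powr (\<alpha> - 1) * exp (- s) / Gamma \<alpha> else 0)"

lemma gamma_density_measurable [measurable]: "gamma_density \<alpha> \<in> borel_measurable borel"
  unfolding gamma_density_def by measurable

lemma gamma_density_nonneg: "\<alpha> > 0 \<Longrightarrow> 0 \<le> gamma_density \<alpha> s"
  by (simp add: gamma_density_def Gamma_real_pos less_imp_le)

lemma gamma_density_integral:
  assumes a: "\<alpha> > 0"
  shows "integrable lborel (gamma_density \<alpha>)" "(LBINT s. gamma_density \<alpha> s) = 1"
proof -
  have "((\<lambda>t. t powr (\<alpha> - 1) / exp t) has_integral Gamma \<alpha>) {0..}"
    by (rule Gamma_integral_real[OF a])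
  from has_integral_mult_right[OF this, of "1 / Gamma \<alpha>"]
  have "((\<lambda>t. t powr (\<alpha> - 1) * exp (- t) / Gamma \<alpha>) has_integral 1) {0..}"
    using Gamma_real_pos[OF a] by (simp add: exp_minus field_simps)
  hence "(gamma_density \<alpha> has_integral 1) {0..}"
    by (rule has_integral_eq[rotated]) (auto simp: gamma_density_def)
  hence "(gamma_density \<alpha> has_integral 1) UNIV"
    by (rule has_integral_on_superset) (auto simp: gamma_density_def)
  hence "integral\<^sup>N lborel (\<lambda>x. ennreal (indicator UNIV x * gamma_density \<alpha> x)) = 1"
    by (subst nn_integral_has_integral_lebesgue) (auto simp: gamma_density_nonneg[OF a])
  hence n: "(\<integral>\<^sup>+ x. ennreal (gamma_density \<alpha> x) \<partial>lborel) = ennreal 1" by simp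
  show "integrable lborel (gamma_density \<alpha>)"
    by (rule integrableI_nn_integral_finite[OF _ _ n]) (auto simp: gamma_density_nonneg[OF a])
  show "(LBINT s. gamma_density \<alpha> s) = 1"
    using n by (subst integral_eq_nn_integral) (auto simp: gamma_density_nonneg[OF a])
qed

text \<open>Substituting (1 + c) s for s absorbs the exponential into the rate of the Gamma law.
  With c = |2 pi \<omega>|^2 the right side is the symbol of the Bessel kernel of order 2
  \<alpha>.\<close>

lemma gamma_density_laplace:
  assumes a: "\<alpha> > 0" and c: "c \<ge> 0"
  shows "(LBINT s. gamma_density \<alpha> s * exp (- s * c)) = (1 + c) powr (- \<alpha>)"
proof -
  have "gamma_density \<alpha> s * exp (- s * c) = (1 + c) powr (1 - \<alpha>) * gamma_density \<alpha> (0 + (1 + c) * s)" for s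
  proof (cases "s > 0")
    case True
    hence "(1 + c) powr (1 - \<alpha>) * ((1 + c) * s) powr (\<alpha> - 1) = s powr (\<alpha> - 1)"
      using c by (simp add: powr_mult powr_diff)
    moreover have "0 < s + c * s" using True c by (intro add_pos_nonneg) auto
    ultimately show ?thesis using True c
      by (simp add: gamma_density_def field_simps flip: exp_add)
  qed (use c in \<open>auto simp: gamma_density_def zero_less_mult_iff\<close>)
  hence "(LBINT s. gamma_density \<alpha> s * exp (- s * c)) =
      (1 + c) powr (1 - \<alpha>) * (LBINT s. gamma_density \<alpha> (0 + (1 + c) * s))"
    by (simp only: integral_mult_right_zero)
  also have "(1 + c) powr (1 - \<alpha>) = (1 + c) powr (- \<alpha>) * \<bar>1 + c\<bar>"
    using c by (simp add: powr_diff powr_minus field_simps)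
  also have "\<dots> * (LBINT s. gamma_density \<alpha> (0 + (1 + c) * s)) = (1 + c) powr (- \<alpha>) *
       (\<bar>1 + c\<bar> *\<^sub>R (LBINT s. gamma_density \<alpha> (0 + (1 + c) * s)))" by simp
  also have "(\<bar>1 + c\<bar> *\<^sub>R (LBINT s. gamma_density \<alpha> (0 + (1 + c) * s))) = 1"
    using c by (subst lborel_integral_real_affine[symmetric]) (simp_all add: gamma_density_integral[OF a])
  finally show ?thesis by simp
qed

section \<open>Heat means of bounded continuous functions\<close>

text \<open>The interface to orbit functions t -> a' (\<psi> t a). The bound is a parameter rather
  than a supremum, so one value can serve all functionals of norm at most 1.\<close>

locale bounded_continuous =
  fixes u :: "'e::euclidean_space \<Rightarrow> complex" and B :: real
  assumes cont: "continuous_on UNIV u" and bound: "cmod (u x) \<le> B"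
begin

lemma measurable_u [measurable]: "u \<in> borel_measurable borel"
  using cont by (rule borel_measurable_continuous_onI)

lemma B_nonneg: "0 \<le> B"
  using bound[of undefined] norm_ge_zero order_trans by blast

lemma reflect: "bounded_continuous (\<lambda>t. u (x - t)) B"
  by unfold_locales (auto intro!: continuous_intros continuous_on_compose2[OF cont] bound)

end

definition heat_mean :: "('e::euclidean_space \<Rightarrow> complex) \<Rightarrow> real \<Rightarrow> 'e \<Rightarrow> complex" where
  "heat_mean u s x = (LBINT t. of_real (heat s t) * u (x + t))"

lemma integrable_heat_complex: "integrable lborel (\<lambda>t::'e::euclidean_space. complex_of_real (heat s t))"
  by simp

context bounded_continuous
begin

lemma heat_mean_integrable: "integrable lborel (\<lambda>t. of_real (heat s t) * u (x + t))"
  by (rule integrable_mult_bounded(1)[OF integrable_heat_complex]) (use bound in auto)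

lemma heat_mean_bound: "s > 0 \<Longrightarrow> cmod (heat_mean u s x) \<le> B"
  unfolding heat_mean_def
  using integrable_mult_bounded(3)[OF integrable_heat_complex, of "\<lambda>t. u (x + t)" B s] bound
  by (simp add: integral_heat)

lemma heat_mean_measurable [measurable]: "(\<lambda>s. heat_mean u s x) \<in> borel_measurable borel"
  unfolding heat_mean_def by measurable

lemma heat_mean_reflect: "heat_mean (\<lambda>t. u (x - t)) s 0 = heat_mean u s x"
  unfolding heat_mean_def
  using lborel_affine_integral(2)[of "-1" "\<lambda>t. of_real (heat s t) * u (x + t)" 0] by simp

text \<open>Moving s from the kernel into the argument of u leaves a fixed integrable weight, which
  suits dominated convergence as s tends to 0.\<close>

lemma heat_mean_rescale:
  assumes "s > 0"
  shows "heat_mean u s x = (LBINT w. of_real (heat 1 w) * u (x + sqrt s *\<^sub>R w))"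
proof -
  have e: "sqrt s ^ DIM('e) * heat s (sqrt s *\<^sub>R w) = heat 1 w" for w :: 'e
  proof -
    have "sqrt s ^ DIM('e) = s powr (DIM('e) / 2)"
      using assms by (simp add: powr_half_sqrt[symmetric] powr_power)
    thus ?thesis using assms
      by (simp add: heat_def powr_mult power_mult_distrib powr_minus)
  qed
  show ?thesis
    unfolding heat_mean_def using assms
    by (subst lborel_scale_integral(2)[of "sqrt s" _ 0])
       (simp_all add: scaleR_conv_of_real mult.assoc[symmetric] e flip: of_real_power of_real_mult integral_mult_right_zero)
qed

lemma heat_mean_tendsto: "((\<lambda>s. heat_mean u s x) \<longlongrightarrow> u x) (at_right 0)"
  unfolding tendsto_at_iff_sequentially
proof (intro allI impI)
  fix X :: "nat \<Rightarrow> real" assume X: "\<forall>i. X i \<in> {0<..} - {0}" "X \<longlonglongrightarrow> 0"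
  have "(\<lambda>n. LBINT w. of_real (heat 1 w) * u (x + sqrt (X n) *\<^sub>R w))
      \<longlonglongrightarrow> (LBINT w. of_real (heat 1 (w::'e)) * u x)"
  proof (rule integral_dominated_convergence)
    show "integrable lborel (\<lambda>w::'e. B * heat 1 w)" by simp
    show "AE w in lborel. (\<lambda>n. of_real (heat 1 w) * u (x + sqrt (X n) *\<^sub>R w)) \<longlonglongrightarrow> of_real (heat 1 w) * u x"
    proof (rule AE_I2)
      fix w :: 'e
      have "(\<lambda>n. x + sqrt (X n) *\<^sub>R w) \<longlonglongrightarrow> x + sqrt 0 *\<^sub>R w"
        using X(2) by (intro tendsto_intros)
      hence "(\<lambda>n. u (x + sqrt (X n) *\<^sub>R w)) \<longlonglongrightarrow> u x"
        using cont by (auto simp: continuous_on_eq_continuous_at continuous_at_sequentially o_def)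
      thus "(\<lambda>n. of_real (heat 1 w) * u (x + sqrt (X n) *\<^sub>R w)) \<longlonglongrightarrow> of_real (heat 1 w) * u x"
        by (intro tendsto_intros)
    qed
    show "AE w in lborel. norm (of_real (heat 1 w) * u (x + sqrt (X n) *\<^sub>R w)) \<le> B * heat 1 w" for n
      by (intro AE_I2) (simp add: norm_mult mult.commute[of B] mult_left_mono bound)
  qed auto
  also have "(LBINT w. of_real (heat 1 (w::'e)) * u x) = u x"
    by (simp add: integral_heat)
  finally show "((\<lambda>s. heat_mean u s x) \<circ> X) \<longlonglongrightarrow> u x"
    using X(1) by (simp add: o_def heat_mean_rescale)
qed

end

text \<open>A Gaussian is a multiple of the Fourier transform of the Gaussian at time 1 / (4 s).
  Pairing an integrable function with Gaussians therefore only involves its Fourier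
  transform.\<close>

lemma fourier_heat_kernel:
  fixes z :: "'e::euclidean_space"
  assumes "s > 0"
  shows "complex_of_real (heat s z) = of_real ((4 * pi * s) powr (- (DIM('e) / 2))) *
     (CLBINT \<xi>. of_real (heat (1 / (4 * s)) \<xi>) * iexp (z \<bullet> \<xi>))"
  using assms by (subst heat_fourier_transform(2)) (simp_all add: heat_def)

text \<open>Testing against bounded continuous functions instead of proving \<open>f = 0\<close> almost everywhere
  avoids the density of nice functions in \<open>L\<^sup>1\<close>: \<open>f\<close> is orthogonal to all Gaussians,
  hence to all heat means of \<open>u\<close>.\<close>

lemma fourier_uniqueness:
  fixes f :: "'e::euclidean_space \<Rightarrow> complex"
  assumes u: "bounded_continuous u B" and f: "integrable lborel f"
    and z: "\<And>\<xi>. (CLBINT x. f x * iexp (x \<bullet> \<xi>)) = 0"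
  shows "(LBINT x. f x * u x) = 0"
proof -
  interpret bounded_continuous u B by (rule u)
  have [measurable]: "f \<in> borel_measurable borel" using f by auto
  have h: "(LBINT x. f x * of_real (heat s (y - x))) = 0" if s: "s > 0" for s y
  proof -
    let ?k = "\<lambda>x \<xi>. of_real (heat (1 / (4 * s)) \<xi>) * iexp ((x - y) \<bullet> \<xi>)"
    have "(LBINT x. f x * (LBINT \<xi>. ?k x \<xi>)) = (LBINT \<xi>. (LBINT x. f x * ?k x \<xi>))"
    proof (rule Fubini_kernel[OF f])
      show "integrable lborel (?k x)" "(LBINT \<xi>. cmod (?k x \<xi>)) \<le> 1" for x
        using integrable_mult_bounded(1,2)[OF integrable_heat_complex, of "\<lambda>\<xi>. iexp ((x - y) \<bullet> \<xi>)" 1 "1 / (4 * s)"] s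
        by (simp_all add: integral_heat)
    qed measurable
    also have "(\<lambda>\<xi>. LBINT x. f x * ?k x \<xi>) = (\<lambda>_. 0)"
    proof
      fix \<xi> :: 'e
      have "f x * ?k x \<xi> = (of_real (heat (1 / (4 * s)) \<xi>) * iexp (- (y \<bullet> \<xi>))) * (f x * iexp (x \<bullet> \<xi>))" for x
        by (simp add: inner_diff_left algebra_simps exp_diff exp_minus field_simps)
      thus "(LBINT x. f x * ?k x \<xi>) = 0" using z[of \<xi>] by (simp only: integral_mult_right_zero mult_zero_right)
    qed
    finally have "(LBINT x. f x * of_real (heat s (x - y))) = 0"
      unfolding fourier_heat_kernel[OF s] by (simp add: mult.left_commute[of "f _"])
    moreover have "heat s (y - x) = heat s (x - y)" for x
      using heat_minus[of s "x - y"] by simp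
    ultimately show ?thesis by simp
  qed
  have m: "(LBINT x. f x * heat_mean u s x) = 0" if s: "s > 0" for s
  proof -
    have e: "heat_mean u s x = (LBINT y. of_real (heat s (y - x)) * u y)" for x
      unfolding heat_mean_def
      using lborel_affine_integral(2)[of 1 "\<lambda>y. of_real (heat s (y - x)) * u y" x] by simp
    have "(LBINT x. f x * (LBINT y. of_real (heat s (y - x)) * u y)) =
      (LBINT y. (LBINT x. f x * (of_real (heat s (y - x)) * u y)))"
    proof (rule Fubini_kernel[OF f])
      show "integrable lborel (\<lambda>y. of_real (heat s (y - x)) * u y)"
         "(LBINT y. cmod (of_real (heat s (y - x)) * u y)) \<le> B" for x
        using integrable_mult_bounded(1,2)[of "\<lambda>y. of_real (heat s (y - x))" u B] s bound heat_translate[of s, where 'e = 'e]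
        by simp_all
    qed measurable
    also have "\<dots> = (LBINT y. (LBINT x. f x * of_real (heat s (y - x))) * u y)"
      by (simp add: mult.assoc flip: integral_mult_left_zero)
    finally show ?thesis using s by (simp add: h e)
  qed
  have "((\<lambda>n. LBINT x. f x * heat_mean u (1 / real (Suc n)) x) \<longlonglongrightarrow> (LBINT x. f x * u x))"
  proof (rule integral_dominated_convergence)
    show "integrable lborel (\<lambda>x. B * cmod (f x))" using f by simp
    show "(\<lambda>x. f x * heat_mean u (1 / real (Suc n)) x) \<in> borel_measurable lborel" for n
      unfolding heat_mean_def by measurable
    have "filterlim (\<lambda>n. 1 / real (Suc n)) (at_right 0) sequentially"
      by (intro tendsto_imp_filterlim_at_right LIMSEQ_Suc[OF lim_1_over_n]) auto
    from filterlim_compose[OF heat_mean_tendsto this]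
    show "AE x in lborel. (\<lambda>n. f x * heat_mean u (1 / real (Suc n)) x) \<longlonglongrightarrow> f x * u x"
      by (intro AE_I2 tendsto_intros)
    show "AE x in lborel. norm (f x * heat_mean u (1 / real (Suc n)) x) \<le> B * cmod (f x)" for n
      by (intro AE_I2) (simp add: norm_mult mult.commute[of B] mult_left_mono heat_mean_bound del: of_nat_Suc)
  qed auto
  thus ?thesis by (simp add: m LIMSEQ_const_iff del: of_nat_Suc)
qed

section \<open>The Bessel kernel as a mixture of Gaussians\<close>

text \<open>The subordination formula. For \<alpha> > 0 the s-integral diverges at most at the
  origin, when 2 \<alpha> \<le> \<open>DIM('e)\<close>; the default value 0 there affects only a
  null set.\<close>

definition bessel_density :: "real \<Rightarrow> 'e::euclidean_space \<Rightarrow> complex" where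
  "bessel_density \<alpha> x = (LBINT s. of_real (gamma_density \<alpha> s) * of_real (heat s x))"

lemma bessel_density_integral:
  fixes h :: "'e::euclidean_space \<Rightarrow> complex"
  assumes a: "\<alpha> > 0" and [measurable]: "h \<in> borel_measurable borel" and bd: "\<And>x. cmod (h x) \<le> B"
  shows "integrable lborel (\<lambda>x. bessel_density \<alpha> x * h x)"
    and "(LBINT x. bessel_density \<alpha> x * h x)
       = (LBINT s. of_real (gamma_density \<alpha> s) * (LBINT x. of_real (heat s x) * h x))"
    and "integrable lborel (\<lambda>s. of_real (gamma_density \<alpha> s) * (LBINT x. of_real (heat s x) * h x))"
proof -
  have e: "bessel_density \<alpha> x * h x = (LBINT s. of_real (gamma_density \<alpha> s) * (of_real (heat s x) * h x))" for x
    by (simp add: bessel_density_def mult.assoc flip: integral_mult_left_zero)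
  have g: "integrable lborel (\<lambda>s. complex_of_real (gamma_density \<alpha> s))"
    using gamma_density_integral(1)[OF a] by simp
  have *: "integrable lborel (\<lambda>x. complex_of_real (heat s x) * h x)"
    "(LBINT x. cmod (complex_of_real (heat s x) * h x)) \<le> B"
    if "complex_of_real (gamma_density \<alpha> s) \<noteq> 0" for s
    using that integrable_mult_bounded(1,2)[OF integrable_heat_complex, of h B s] bd
    by (auto simp: gamma_density_def integral_heat split: if_splits)
  have m: "(\<lambda>(s, x). complex_of_real (heat s x) * h x) \<in> borel_measurable (lborel \<Otimes>\<^sub>M lborel)"
    by measurable
  note F = Fubini_kernel[OF g m *]
  show "integrable lborel (\<lambda>x. bessel_density \<alpha> x * h x)" unfolding e using F(2) by simp
  show "(LBINT x. bessel_density \<alpha> x * h x)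
       = (LBINT s. of_real (gamma_density \<alpha> s) * (LBINT x. of_real (heat s x) * h x))"
    unfolding e using F(1) by simp
  show "integrable lborel (\<lambda>s. of_real (gamma_density \<alpha> s) * (LBINT x. of_real (heat s x) * h x))"
    using F(3) by simp
qed

text \<open>This witness gives the choice in \<open>bessel_kernel\<close> its meaning.\<close>

lemma is_bessel_kernel_density:
  assumes r: "r > 0"
  shows "is_bessel_kernel r (bessel_density (r / 2) :: real^'d \<Rightarrow> complex)"
  unfolding is_bessel_kernel_def
proof (intro conjI allI)
  show "integrable lborel (bessel_density (r / 2) :: real^'d \<Rightarrow> complex)"
    using bessel_density_integral(1)[of "r / 2" "\<lambda>_. 1" 1] r by simp
  fix \<omega> :: "real^'d"
  let ?h = "\<lambda>x. exp (- 2 * of_real pi * \<i> * of_real (\<omega> \<bullet> x))"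
  define \<xi> where "\<xi> = (- 2 * pi) *\<^sub>R \<omega>"
  have h: "?h x = iexp (\<xi> \<bullet> x)" for x
    by (simp add: \<xi>_def mult_ac)
  have "(LBINT x. bessel_density (r / 2) x * ?h x) =
    (LBINT s. of_real (gamma_density (r / 2) s) * (LBINT x. of_real (heat s x) * ?h x))"
    by (rule bessel_density_integral(2)[of _ _ 1]) (use r in \<open>auto simp: h\<close>)
  also have "\<dots> = (LBINT s. complex_of_real (gamma_density (r / 2) s * exp (- s * (norm \<xi>)\<^sup>2)))"
  proof (rule lint_cong[OF refl])
    fix s
    show "of_real (gamma_density (r / 2) s) * (LBINT x. of_real (heat s x) * ?h x)
       = complex_of_real (gamma_density (r / 2) s * exp (- s * (norm \<xi>)\<^sup>2))"
      unfolding h using heat_fourier_transform(2)[of s \<xi>] by (cases "s > 0") (simp_all add: gamma_density_def)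
  qed
  also have "\<dots> = of_real ((1 + (norm \<xi>)\<^sup>2) powr (- (r / 2)))"
    using r by (simp only: integral_complex_of_real, subst gamma_density_laplace) auto
  also have "norm \<xi> = norm ((2 * pi) *\<^sub>R \<omega>)"
    by (simp add: \<xi>_def)
  finally show "(LBINT x. bessel_density (r / 2) x * ?h x) =
      of_real ((1 + (norm ((2 * pi) *\<^sub>R \<omega>))\<^sup>2) powr (- r / 2))" by simp
qed

text \<open>The kernel picked by \<open>SOME\<close> may differ from \<open>bessel_density\<close>,
  but the difference has vanishing Fourier transform and is invisible to bounded continuous
  functions. The Gamma mean is thus available for the chosen kernel.\<close>

lemma bessel_kernel_integral:
  fixes u :: "real^'d \<Rightarrow> complex"
  assumes r: "r > 0" and u: "bounded_continuous u B"
  shows "(LBINT t. bessel_kernel r t * u (x - t)) =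
         (LBINT s. of_real (gamma_density (r / 2) s) * heat_mean u s x)"
proof -
  interpret bounded_continuous u B by (rule u)
  let ?G = "bessel_kernel r :: real^'d \<Rightarrow> complex" and ?D = "bessel_density (r / 2) :: real^'d \<Rightarrow> complex"
  have G: "is_bessel_kernel r ?G"
    unfolding bessel_kernel_def by (rule someI[of "is_bessel_kernel r", OF is_bessel_kernel_density[OF r]])
  have D: "is_bessel_kernel r ?D" by (rule is_bessel_kernel_density[OF r])
  have iG: "integrable lborel ?G" and iD: "integrable lborel ?D"
    using G D by (auto simp: is_bessel_kernel_def)
  have v: "bounded_continuous (\<lambda>t. u (x - t)) B" by (rule reflect)
  have "(LBINT t. (?G t - ?D t) * u (x - t)) = 0"
  proof (rule fourier_uniqueness[OF v])
    show "integrable lborel (\<lambda>t. ?G t - ?D t)" using iG iD by simp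
    fix \<xi> :: "real^'d"
    \<comment> \<open>Passes from the pairing exp (i t . \<xi>) to the normalisation exp (-2 pi i
      \<omega> . t) of \<open>is_bessel_kernel\<close>.\<close>
    define \<omega> where "\<omega> = (- 1 / (2 * pi)) *\<^sub>R \<xi>"
    have e: "iexp (t \<bullet> \<xi>) = exp (- 2 * of_real pi * \<i> * of_real (\<omega> \<bullet> t))" for t
      by (simp add: \<omega>_def inner_commute)
    have *: "integrable lborel (\<lambda>t. F t * iexp (t \<bullet> \<xi>))" if "integrable lborel F" for F :: "real^'d \<Rightarrow> complex"
      by (rule integrable_mult_bounded(1)[OF that, of _ 1]) auto
    show "(CLBINT t. (?G t - ?D t) * iexp (t \<bullet> \<xi>)) = 0"
      using G D unfolding is_bessel_kernel_def
      by (simp add: left_diff_distrib *[OF iG] *[OF iD] e[symmetric] del: of_real_mult) (simp add: e)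
  qed
  moreover have "integrable lborel (\<lambda>t. ?G t * u (x - t))" "integrable lborel (\<lambda>t. ?D t * u (x - t))"
    using bound by (intro integrable_mult_bounded(1)[where B = B] iG iD; simp)+
  ultimately have "(LBINT t. ?G t * u (x - t)) = (LBINT t. ?D t * u (x - t))"
    by (simp add: left_diff_distrib)
  also have "\<dots> = (LBINT s. of_real (gamma_density (r / 2) s) * heat_mean (\<lambda>t. u (x - t)) s 0)"
    unfolding heat_mean_def using r bound by (subst bessel_density_integral(2)[where B = B]) auto
  finally show ?thesis by (simp add: heat_mean_reflect)
qed

section \<open>Marchaud derivatives\<close>

text \<open>A bridge from gauge integrals, where antiderivatives are used, to Lebesgue integrals of
  functions extended by 0: for nonnegative measurable functions the two agree.\<close>

lemma nonneg_has_integral_lborel: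
  fixes f g :: "real \<Rightarrow> real"
  assumes I: "(f has_integral I) S" and [measurable]: "g \<in> borel_measurable borel"
    and eq: "\<And>x. x \<in> S \<Longrightarrow> g x = f x" "\<And>x. x \<notin> S \<Longrightarrow> g x = 0" and nn: "\<And>x. 0 \<le> g x"
  shows "integrable lborel g" "(LBINT x. g x) = I"
proof -
  have I0: "0 \<le> I" using I by (rule has_integral_nonneg) (use eq nn in metis)
  have "(g has_integral I) UNIV"
    using I eq by (metis has_integral_eq has_integral_on_superset subset_UNIV)
  hence n: "(\<integral>\<^sup>+ x. ennreal (g x) \<partial>lborel) = ennreal I"
    using nn_integral_has_integral_lebesgue[of UNIV g I] nn by simp
  show "integrable lborel g" by (rule integrableI_nn_integral_finite[OF _ _ n]) (auto simp: nn)
  show "(LBINT x. g x) = I"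
    using n I0 by (subst integral_eq_nn_integral) (auto simp: nn)
qed

text \<open>If f is not integrable its integral is 0 by convention, which the nonnegative g still
  dominates.\<close>

lemma cmod_integral_le:
  fixes f :: "'a \<Rightarrow> complex"
  assumes "integrable M g" "\<And>x. cmod (f x) \<le> g x"
  shows "cmod (LINT x|M. f x) \<le> (LINT x|M. g x)"
proof (cases "integrable M f")
  case True
  have "cmod (LINT x|M. f x) \<le> (LINT x|M. cmod (f x))" by (rule integral_norm_bound)
  also have "\<dots> \<le> (LINT x|M. g x)" using assms True by (intro integral_mono) auto
  finally show ?thesis .
next
  case False
  have "0 \<le> g x" for x using assms(2)[of x] norm_ge_zero order_trans by blast
  thus ?thesis using False by (simp add: not_integrable_integral_eq)
qed

lemma powr_integral_0_1:
  assumes "a > -1"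
  shows "integrable lborel (\<lambda>x::real. if 0 < x \<and> x \<le> 1 then x powr a else 0)"
  by (rule nonneg_has_integral_lborel(1)[OF has_integral_powr_from_0[OF assms, of 1]]) auto

lemma powr_integral_to_inf:
  assumes "a < -1" "c > 0"
  shows "integrable lborel (\<lambda>x::real. if c \<le> x then x powr a else 0)"
    and "(LBINT x. (if c \<le> x then x powr a else 0)) = - (c powr (a + 1)) / (a + 1)"
  by (rule nonneg_has_integral_lborel[OF has_integral_powr_to_inf[OF assms]]; simp)+

section \<open>Weights and kernels of truncated Marchaud derivatives\<close>

definition trunc_weight :: "real \<Rightarrow> real \<Rightarrow> real \<Rightarrow> real" where
  "trunc_weight \<alpha> \<delta> s = (if \<delta> \<le> s then s powr (- 1 - \<alpha>) else 0)"

lemma trunc_weight_measurable [measurable]: "trunc_weight \<alpha> \<delta> \<in> borel_measurable borel"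
  unfolding trunc_weight_def by measurable

lemma trunc_weight_nonneg [simp]: "0 \<le> trunc_weight \<alpha> \<delta> s"
  by (simp add: trunc_weight_def)

lemma trunc_weight_integral:
  assumes "\<alpha> > 0" "\<delta> > 0"
  shows "integrable lborel (trunc_weight \<alpha> \<delta>)"
    and "(LBINT s. trunc_weight \<alpha> \<delta> s) = \<delta> powr (- \<alpha>) / \<alpha>"
  using powr_integral_to_inf[of "- 1 - \<alpha>" \<delta>] assms unfolding trunc_weight_def by auto

text \<open>Up to a constant, the averaging kernel of the classical formula for the truncated
  Marchaud derivative of a fractional integral, with \<open>max 0 (x - 1)\<close> as the positive
  part of x - 1.\<close>

definition marchaud_kernel :: "real \<Rightarrow> real \<Rightarrow> real" where
  "marchaud_kernel \<alpha> x = (if x > 0 then (x powr \<alpha> - max 0 (x - 1) powr \<alpha>) / x else 0)"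

lemma marchaud_kernel_measurable [measurable]: "marchaud_kernel \<alpha> \<in> borel_measurable borel"
  unfolding marchaud_kernel_def by measurable

lemma marchaud_kernel_nonneg:
  assumes "\<alpha> > 0"
  shows "0 \<le> marchaud_kernel \<alpha> x"
  using assms by (auto simp: marchaud_kernel_def max_def intro!: divide_nonneg_pos powr_mono2)

text \<open>On (0, 1] the kernel is x^(\<alpha>-1). Beyond 1 the two powers nearly cancel: (1 -
  1/x)^\<alpha> \<ge> 1 - 1/x, valid as \<alpha> < 1, leaves at most x^(\<alpha>-2).\<close>

lemma marchaud_kernel_integrable:
  assumes a: "0 < \<alpha>" "\<alpha> < 1"
  shows "integrable lborel (marchaud_kernel \<alpha>)"
proof -
  let ?dom = "\<lambda>x::real. (if 0 < x \<and> x \<le> 1 then x powr (\<alpha> - 1) else 0)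
      + (if 1 \<le> x then x powr (\<alpha> - 2) else 0)"
  show ?thesis
  proof (rule integrable_dominated)
  show "integrable lborel ?dom"
    using a by (intro integrable_plus powr_integral_0_1 powr_integral_to_inf) auto
  show "AE x in lborel. norm (marchaud_kernel \<alpha> x) \<le> norm (?dom x)"
  proof (rule AE_I2)
    fix x :: real
    consider "x \<le> 0" | "0 < x" "x \<le> 1" | "1 < x" by linarith
    thus "norm (marchaud_kernel \<alpha> x) \<le> norm (?dom x)"
    proof cases
      case 2
      thus ?thesis by (simp add: marchaud_kernel_def powr_diff max_def)
    next
      case 3
      have y: "0 < 1 - 1 / x" "1 - 1 / x \<le> 1" using 3 by auto
      have "x * (1 - 1 / x) = x - 1" using 3 by (simp add: field_simps)
      hence "(x - 1) powr \<alpha> = x powr \<alpha> * (1 - 1 / x) powr \<alpha>"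
        using 3 y by (metis powr_mult)
      also have "(1 - 1 / x) powr \<alpha> \<ge> (1 - 1 / x) powr 1"
        using y a by (intro powr_mono') auto
      hence "x powr \<alpha> * (1 - 1 / x) powr \<alpha> \<ge> x powr \<alpha> * (1 - 1 / x)"
        using y by (intro mult_left_mono) auto
      finally have "x powr \<alpha> - (x - 1) powr \<alpha> \<le> x powr \<alpha> / x" by (simp add: algebra_simps)
      hence "marchaud_kernel \<alpha> x \<le> (x powr \<alpha> / x) / x"
        using 3 by (simp add: marchaud_kernel_def max_def del: divide_divide_eq_left) (rule divide_right_mono; simp)
      also have "\<dots> = x powr (\<alpha> - 2)" using 3 by (simp add: powr_diff power2_eq_square)
      finally show ?thesis using marchaud_kernel_nonneg[OF a(1), of x] 3 by simp
    qed (simp add: marchaud_kernel_def)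
  qed
qed simp
qed

text \<open>The integral is a factor of u in the limit of the Marchaud derivatives, so u can be
  recovered only because it is nonzero. On [1/2, 1] the kernel is x^(\<alpha>-1) \<ge> 1, and half
  of that is enough.\<close>

lemma marchaud_kernel_integral_pos:
  assumes a: "0 < \<alpha>" "\<alpha> < 1"
  shows "0 < (LBINT x. marchaud_kernel \<alpha> x)"
proof -
  have i: "integrable lborel (\<lambda>x::real. if 1 / 2 \<le> x \<and> x \<le> 1 then 1 / 2 else 0 :: real)"
  proof -
    have "(\<lambda>x::real. if 1 / 2 \<le> x \<and> x \<le> 1 then 1 / 2 else 0 :: real) = (\<lambda>x. 1 / 2 * indicator {1/2..1} x)"
      by (auto simp: indicator_def)
    moreover have "integrable lborel (\<lambda>x::real. 1 / 2 * indicator {1/2..1} x :: real)"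
      by (intro integrable_mult_right integrable_real_indicator emeasure_bounded_finite) auto
    ultimately show ?thesis by simp
  qed
  have "(LBINT x. (if 1 / 2 \<le> x \<and> x \<le> (1::real) then 1 / 2 else 0)) = (LBINT x. 1 / 2 * indicator {1/2..1::real} x :: real)"
    by (intro lint_cong) (auto simp: indicator_def)
  also have "\<dots> = 1 / 4" by simp
  finally have "1 / 4 = (LBINT x. (if 1 / 2 \<le> x \<and> x \<le> (1::real) then 1 / 2 else 0 :: real))" by simp
  also have "\<dots> \<le> (LBINT x. marchaud_kernel \<alpha> x)"
  proof (rule integral_mono[OF i marchaud_kernel_integrable[OF a]])
    fix x :: real
    show "(if 1 / 2 \<le> x \<and> x \<le> 1 then 1 / 2 else 0) \<le> marchaud_kernel \<alpha> x"
    proof (cases "1 / 2 \<le> x \<and> x \<le> 1")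
      case True
      have "x powr 1 \<le> x powr \<alpha>" using a True by (intro powr_mono') auto
      hence "1 \<le> x powr \<alpha> / x" using True by (simp add: field_simps)
      thus ?thesis using True by (simp add: marchaud_kernel_def max_absorb1)
    qed (use marchaud_kernel_nonneg[OF a(1)] in auto)
  qed
  finally show ?thesis by simp
qed

text \<open>The integrand equals (t/s - 1)^(\<alpha>-1) / s^2, with antiderivative -(t/s -
  1)^\<alpha> / (\<alpha> t). For \<alpha> < 1 it is unbounded at s = t, so the fundamental theorem
  is used with derivatives in the interior and continuity up to the endpoint.\<close>

lemma fractional_integral_trunc_weight:
  fixes \<alpha> \<delta> t :: real
  assumes a: "0 < \<alpha>" and d: "0 < \<delta>"
  shows "integrable lborel (\<lambda>s. if \<delta> \<le> s \<and> s < t then s powr (- 1 - \<alpha>) * (t - s) powr (\<alpha> - 1) else 0)"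
    and "(LBINT s. (if \<delta> \<le> s \<and> s < t then s powr (- 1 - \<alpha>) * (t - s) powr (\<alpha> - 1) else 0))
       = (if t > 0 then \<delta> powr (- \<alpha>) * max 0 (t - \<delta>) powr \<alpha> / (\<alpha> * t) else 0)"
proof -
  let ?f = "\<lambda>s. if \<delta> \<le> s \<and> s < t then s powr (- 1 - \<alpha>) * (t - s) powr (\<alpha> - 1) else 0"
  have "integrable lborel ?f \<and> (LBINT s. ?f s) = (if t > 0 then \<delta> powr (- \<alpha>) * max 0 (t - \<delta>) powr \<alpha> / (\<alpha> * t) else 0)"
  proof (cases "\<delta> < t")
    case False
    have "\<not> (\<delta> \<le> s \<and> s < t)" for s using False by linarith
    hence "?f = (\<lambda>_. 0)" by (intro ext if_not_P)
    thus ?thesis using False a by (simp add: max_def)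
  next
    case True
    hence t: "t > 0" using d by simp
    let ?F = "\<lambda>s. - ((t / s - 1) powr \<alpha> / (\<alpha> * t))"
    let ?g = "\<lambda>s. s powr (- 1 - \<alpha>) * (t - s) powr (\<alpha> - 1)"
    have I: "(?g has_integral (?F t - ?F \<delta>)) {\<delta>..t}"
    proof (rule fundamental_theorem_of_calculus_interior)
      show "continuous_on {\<delta>..t} ?F"
        using d t a by (intro continuous_intros continuous_on_powr') (auto simp: field_simps)
      fix s assume s: "s \<in> {\<delta><..<t}"
      hence s0: "s > 0" "s < t" using d by auto
      have pos: "t / s - 1 > 0" using s0 by simp
      have "(?F has_real_derivative ((t / s - 1) powr (\<alpha> - 1) / s\<^sup>2)) (at s)"
        using s0 pos t a by (auto intro!: derivative_eq_intros simp: field_simps power2_eq_square powr_diff)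
      also have "(t / s - 1) powr (\<alpha> - 1) / s\<^sup>2 = ?g s"
      proof -
        have "t / s - 1 = (t - s) / s" using s0 by (simp add: field_simps)
        thus ?thesis using s0
          by (simp add: powr_divide powr_diff powr_minus field_simps power2_eq_square)
      qed
      finally show "(?F has_vector_derivative ?g s) (at s)"
        by (simp add: has_real_derivative_iff_has_vector_derivative)
    qed (use True in auto)
    have e: "?F t - ?F \<delta> = (if t > 0 then \<delta> powr (- \<alpha>) * max 0 (t - \<delta>) powr \<alpha> / (\<alpha> * t) else 0)"
    proof -
      have "t / \<delta> - 1 = (t - \<delta>) / \<delta>" using d by (simp add: field_simps)
      thus ?thesis using t True d by (simp add: powr_divide powr_minus field_simps)
    qed
    show ?thesis
      unfolding e[symmetric] by (intro conjI nonneg_has_integral_lborel[OF I]) (use True in auto)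
  qed
  thus "integrable lborel ?f" "(LBINT s. ?f s) = (if t > 0 then \<delta> powr (- \<alpha>) * max 0 (t - \<delta>) powr \<alpha> / (\<alpha> * t) else 0)"
    by auto
qed


section \<open>Inversion of fractional integrals on the half-line\<close>

text \<open>Multiplied by exp (-s), this is the Weyl fractional integral of order \<alpha> of exp
  (-s) f s. Hence the factor exp (-s) in \<open>marchaud\<close>, the truncated Marchaud derivative
  of that integral at 0.\<close>

definition frac_mean :: "real \<Rightarrow> (real \<Rightarrow> complex) \<Rightarrow> real \<Rightarrow> complex" where
  "frac_mean \<alpha> f s = (LBINT y. of_real (gamma_density \<alpha> y) * f (s + y))"

lemma frac_mean_measurable [measurable]:
  assumes [measurable]: "f \<in> borel_measurable borel"
  shows "frac_mean \<alpha> f \<in> borel_measurable borel"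
  unfolding frac_mean_def by measurable

context
  fixes \<alpha> B :: real and f :: "real \<Rightarrow> complex"
  assumes a: "0 < \<alpha>" "\<alpha> < 1" and f_measurable [measurable]: "f \<in> borel_measurable borel"
    and bd: "\<And>x. 0 < x \<Longrightarrow> cmod (f x) \<le> B"
begin

abbreviation "marchaud \<delta> \<equiv>
  (LBINT s. of_real (trunc_weight \<alpha> \<delta> s) * (frac_mean \<alpha> f 0 - of_real (exp (- s)) * frac_mean \<alpha> f s))"

lemma cutoff_bound: "cmod (if 0 < x then f x else 0) \<le> B"
  using bd[of x] bd[of 1] norm_ge_zero[of "f 1"] by (simp del: norm_ge_zero)

text \<open>The Gamma density vanishes at y \<le> 0, so only values of f at positive arguments,
  where f is bounded, contribute.\<close>

lemma gamma_density_cutoff: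
  "0 \<le> s \<Longrightarrow> of_real (gamma_density \<alpha> y) * f (s + y) = of_real (gamma_density \<alpha> y) * (if 0 < s + y then f (s + y) else 0)"
  by (auto simp: gamma_density_def)

lemma frac_mean_integrable:
  assumes "0 \<le> s"
  shows "integrable lborel (\<lambda>y. of_real (gamma_density \<alpha> y) * f (s + y))"
    and "(LBINT y. cmod (of_real (gamma_density \<alpha> y) * f (s + y))) \<le> B"
    and "cmod (frac_mean \<alpha> f s) \<le> B"
proof -
  have g: "integrable lborel (\<lambda>y. complex_of_real (gamma_density \<alpha> y))"
    using gamma_density_integral(1)[OF a(1)] by simp
  have m: "(\<lambda>y. if 0 < s + y then f (s + y) else 0) \<in> borel_measurable borel" by measurable
  note I = integrable_mult_bounded[OF g m, of B]
  have n: "(LBINT y. cmod (complex_of_real (gamma_density \<alpha> y))) = 1"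
    using gamma_density_integral(2)[OF a(1)] by (simp add: gamma_density_nonneg[OF a(1)])
  show "integrable lborel (\<lambda>y. of_real (gamma_density \<alpha> y) * f (s + y))"
    "(LBINT y. cmod (of_real (gamma_density \<alpha> y) * f (s + y))) \<le> B"
    "cmod (frac_mean \<alpha> f s) \<le> B"
    unfolding frac_mean_def gamma_density_cutoff[OF assms]
    using I[unfolded n] cutoff_bound by auto
qed

lemma trunc_weight_frac_mean_integrable:
  fixes h :: "real \<Rightarrow> real"
  assumes d: "\<delta> > 0" and h[measurable]: "h \<in> borel_measurable borel" and "\<And>s. 0 \<le> s \<Longrightarrow> \<bar>h s\<bar> \<le> 1"
  shows "integrable lborel (\<lambda>s. of_real (trunc_weight \<alpha> \<delta> s) * (of_real (h s) * frac_mean \<alpha> f s))"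
proof (rule integrable_dominated)
  show "integrable lborel (\<lambda>s. trunc_weight \<alpha> \<delta> s * B)"
    using trunc_weight_integral(1)[OF a(1) d] by simp
  show "AE s in lborel. norm (of_real (trunc_weight \<alpha> \<delta> s) * (of_real (h s) * frac_mean \<alpha> f s))
      \<le> norm (trunc_weight \<alpha> \<delta> s * B)"
  proof (rule AE_I2)
    fix s
    show "norm (of_real (trunc_weight \<alpha> \<delta> s) * (of_real (h s) * frac_mean \<alpha> f s)) \<le> norm (trunc_weight \<alpha> \<delta> s * B)"
    proof (cases "\<delta> \<le> s")
      case True
      hence "\<bar>h s\<bar> * cmod (frac_mean \<alpha> f s) \<le> 1 * B"
        using assms(3)[of s] frac_mean_integrable(3)[of s] d by (intro mult_mono) auto
      thus ?thesis
        by (auto simp: norm_mult abs_mult intro!: mult_left_mono)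
    qed (simp add: trunc_weight_def)
  qed
qed measurable

text \<open>The truncated Marchaud derivative of order \<open>\<alpha>\<close>, applied to the fractional integral of order \<open>\<alpha>\<close>
  of \<open>exp (-s) f s\<close>, is a mean of the latter against an \<open>L\<^sup>1\<close> kernel at scale \<open>\<delta>\<close>.\<close>

lemma marchaud_representation:
  assumes d: "\<delta> > 0"
  shows "(marchaud \<delta>)
     = of_real (1 / (\<alpha> * Gamma \<alpha>)) *
       (LBINT x. of_real (marchaud_kernel \<alpha> x) * (of_real (exp (- (\<delta> * x))) * f (\<delta> * x)))"
proof -
  have G: "Gamma \<alpha> > 0" using a by (rule_tac Gamma_real_pos)
  let ?w = "\<lambda>s. complex_of_real (trunc_weight \<alpha> \<delta> s)"
  have w: "integrable lborel ?w" using trunc_weight_integral(1)[OF a(1) d] by simp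
  have i1: "integrable lborel (\<lambda>s. ?w s * frac_mean \<alpha> f 0)" using w by simp
  have i2: "integrable lborel (\<lambda>s. ?w s * (of_real (exp (- s)) * frac_mean \<alpha> f s))"
    by (rule trunc_weight_frac_mean_integrable[OF d]) auto
  \<comment> \<open>The shift of y by s leaves s in the weights only, so that f y can be pulled out
    once the integrals are exchanged.\<close>
  let ?k = "\<lambda>s y. of_real (exp (- s)) * (of_real (gamma_density \<alpha> (y - s)) * f y)"
  have tr: "integrable lborel (\<lambda>y. of_real (gamma_density \<alpha> (y - s)) * f y)"
    "(LBINT y. cmod (of_real (gamma_density \<alpha> (y - s)) * f y)) \<le> B"
    "frac_mean \<alpha> f s = (LBINT y. of_real (gamma_density \<alpha> (y - s)) * f y)" if "0 \<le> s" for s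
    using frac_mean_integrable[OF that] lborel_affine_integral[of 1 "\<lambda>y. of_real (gamma_density \<alpha> (y - s)) * f y" s]
      lborel_affine_integral[of 1 "\<lambda>y. cmod (of_real (gamma_density \<alpha> (y - s)) * f y)" s]
    by (simp_all add: frac_mean_def)
  have pos: "0 \<le> s" if "?w s \<noteq> 0" for s using that d by (auto simp: trunc_weight_def split: if_splits)
  have R: "(LBINT s. ?w s * (of_real (exp (- s)) * frac_mean \<alpha> f s)) = (LBINT s. ?w s * (LBINT y. ?k s y))"
    by (intro lint_cong refl) (use pos tr(3) in force)
  have F: "(LBINT s. ?w s * (LBINT y. ?k s y)) = (LBINT y. (LBINT s. ?w s * ?k s y))"
    and F': "integrable lborel (\<lambda>y. LBINT s. ?w s * ?k s y)"
  proof -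
    have m: "case_prod ?k \<in> borel_measurable (lborel \<Otimes>\<^sub>M lborel)" by measurable
    have b: "(LBINT y. cmod (?k s y)) \<le> B" if "?w s \<noteq> 0" for s
    proof -
      have "(LBINT y. cmod (?k s y)) = exp (- s) * (LBINT y. cmod (of_real (gamma_density \<alpha> (y - s)) * f y))"
        by (simp add: norm_mult)
      also have "\<dots> \<le> 1 * B" using tr(2)[OF pos[OF that]] pos[OF that] by (intro mult_mono) auto
      finally show ?thesis by simp
    qed
    have i: "integrable lborel (?k s)" if "?w s \<noteq> 0" for s
      using tr(1)[OF pos[OF that]] by (rule integrable_mult_right)
    show "(LBINT s. ?w s * (LBINT y. ?k s y)) = (LBINT y. (LBINT s. ?w s * ?k s y))"
      by (rule Fubini_kernel(1)[OF w m i b])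
    show "integrable lborel (\<lambda>y. LBINT s. ?w s * ?k s y)"
      by (rule Fubini_kernel(2)[OF w m i b])
  qed
  \<comment> \<open>The factor exp (-s) combines with the one in
    \<open>gamma_density \<alpha> (y - s)\<close> to exp (-y), and the remaining s-integral is the
    explicit one.\<close>
  have inner: "(LBINT s. ?w s * ?k s y) =
      of_real (if y > 0 then \<delta> powr (- \<alpha>) * max 0 (y - \<delta>) powr \<alpha> / (\<alpha> * y) * (exp (- y) / Gamma \<alpha>) else 0) * f y" for y
  proof -
    have "?w s * ?k s y = of_real (if \<delta> \<le> s \<and> s < y then s powr (- 1 - \<alpha>) * (y - s) powr (\<alpha> - 1) else 0)
        * (of_real (exp (- y) / Gamma \<alpha>) * f y)" for s
      by (auto simp: trunc_weight_def gamma_density_def exp_diff exp_minus field_simps simp flip: of_real_mult)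
    hence "(LBINT s. ?w s * ?k s y) =
       (LBINT s. of_real (if \<delta> \<le> s \<and> s < y then s powr (- 1 - \<alpha>) * (y - s) powr (\<alpha> - 1) else 0))
        * (of_real (exp (- y) / Gamma \<alpha>) * f y)"
      by (simp only: integral_mult_left_zero)
    also have "\<dots> = of_real (if y > 0 then \<delta> powr (- \<alpha>) * max 0 (y - \<delta>) powr \<alpha> / (\<alpha> * y) else 0)
       * (of_real (exp (- y) / Gamma \<alpha>) * f y)"
      by (simp only: integral_complex_of_real fractional_integral_trunc_weight[OF a(1) d])
    finally show ?thesis by (auto simp: mult_ac)
  qed
  have c: "(LBINT s. ?w s * frac_mean \<alpha> f 0) =
     (LBINT y. of_real (\<delta> powr (- \<alpha>) / \<alpha>) * (of_real (gamma_density \<alpha> y) * f y))"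
    using trunc_weight_integral(2)[OF a(1) d] by (simp add: frac_mean_def)
  have i0: "integrable lborel (\<lambda>y. of_real (gamma_density \<alpha> y) * f y)"
    using frac_mean_integrable(1)[of 0] by simp
  have "(LBINT s. ?w s * (frac_mean \<alpha> f 0 - of_real (exp (- s)) * frac_mean \<alpha> f s)) =
     (LBINT y. of_real (\<delta> powr (- \<alpha>) / \<alpha>) * (of_real (gamma_density \<alpha> y) * f y)) -
     (LBINT y. (LBINT s. ?w s * ?k s y))"
    unfolding right_diff_distrib lint_diff[OF i1 i2] c R F ..
  also have "\<dots> = (LBINT y. of_real (\<delta> powr (- \<alpha>) / \<alpha>) * (of_real (gamma_density \<alpha> y) * f y) -
     (LBINT s. ?w s * ?k s y))"
    by (intro lint_diff[symmetric] integrable_mult_right i0 F')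
  also have "\<dots> = (LBINT y. of_real (1 / (\<alpha> * Gamma \<alpha>)) * (of_real (marchaud_kernel \<alpha> (y / \<delta>) / \<delta>) * (of_real (exp (- y)) * f y)))"
  proof (rule lint_cong[OF refl])
    fix y :: real
    have "\<delta> powr (- \<alpha>) / \<alpha> * gamma_density \<alpha> y -
      (if y > 0 then \<delta> powr (- \<alpha>) * max 0 (y - \<delta>) powr \<alpha> / (\<alpha> * y) * (exp (- y) / Gamma \<alpha>) else 0)
      = 1 / (\<alpha> * Gamma \<alpha>) * (marchaud_kernel \<alpha> (y / \<delta>) / \<delta> * exp (- y))"
    proof (cases "y > 0")
      case True
      have "max 0 (y / \<delta> - 1) = max 0 (y - \<delta>) / \<delta>"
        using d by (simp add: max_def field_simps)
      hence "marchaud_kernel \<alpha> (y / \<delta>) = ((y / \<delta>) powr \<alpha> - (max 0 (y - \<delta>) / \<delta>) powr \<alpha>) / (y / \<delta>)"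
        using True d by (simp add: marchaud_kernel_def)
      also have "\<dots> = \<delta> powr (- \<alpha>) * (y powr \<alpha> - max 0 (y - \<delta>) powr \<alpha>) / (y / \<delta>)"
        using True d by (simp add: powr_divide powr_minus field_simps)
      finally have k: "marchaud_kernel \<alpha> (y / \<delta>) = \<dots>" .
      \<comment> \<open>With the powers abstracted to plain reals only a rational identity is
        left.\<close>
      have "P / \<alpha> * (X / y * e / g) - P * M / (\<alpha> * y) * (e / g) = 1 / (\<alpha> * g) * (P * (X - M) / (y / \<delta>) / \<delta> * e)"
        if "g \<noteq> 0" for P X M e g :: real
        using True d a that by (simp add: divide_simps) (simp add: algebra_simps)
      thus ?thesis unfolding k using True G
        by (simp add: gamma_density_def powr_diff)
    qed (use d in \<open>simp add: marchaud_kernel_def gamma_density_def zero_less_divide_iff\<close>)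
    from arg_cong[OF this, of "\<lambda>c. of_real c * f y"]
    show "of_real (\<delta> powr (- \<alpha>) / \<alpha>) * (of_real (gamma_density \<alpha> y) * f y) - (LBINT s. ?w s * ?k s y)
      = of_real (1 / (\<alpha> * Gamma \<alpha>)) * (of_real (marchaud_kernel \<alpha> (y / \<delta>) / \<delta>) * (of_real (exp (- y)) * f y))"
      unfolding inner by (simp only: of_real_mult of_real_diff left_diff_distrib mult.assoc)
  qed
  also have "\<dots> = of_real (1 / (\<alpha> * Gamma \<alpha>)) * (LBINT y. of_real (marchaud_kernel \<alpha> (y / \<delta>) / \<delta>) * (of_real (exp (- y)) * f y))"
    by (rule integral_mult_right_zero)
  also have "(LBINT y. of_real (marchaud_kernel \<alpha> (y / \<delta>) / \<delta>) * (of_real (exp (- y)) * f y)) =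
     (LBINT x. of_real (marchaud_kernel \<alpha> x) * (of_real (exp (- (\<delta> * x))) * f (\<delta> * x)))"
  proof -
    let ?g = "\<lambda>y. of_real (marchaud_kernel \<alpha> (y / \<delta>) / \<delta>) * (of_real (exp (- y)) * f y)"
    have "(LBINT y. ?g y) = \<bar>\<delta>\<bar> *\<^sub>R (LBINT x. ?g (0 + \<delta> * x))"
      using d by (intro lborel_integral_real_affine) simp
    also have "\<dots> = (LBINT x. \<bar>\<delta>\<bar> *\<^sub>R ?g (0 + \<delta> * x))"
      by (rule integral_scaleR_right[symmetric])
    finally show ?thesis using d by (simp add: scaleR_conv_of_real)
  qed
  finally show ?thesis .
qed

text \<open>In the representation \<delta> occurs only in the arguments of f and of an exponential
  that is at most 1, which makes the estimate uniform in \<delta>.\<close>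

lemma marchaud_bound:
  assumes d: "\<delta> > 0"
  shows "cmod (marchaud \<delta>)
     \<le> (LBINT x. marchaud_kernel \<alpha> x) / (\<alpha> * Gamma \<alpha>) * B"
proof -
  have G: "Gamma \<alpha> > 0" using a by (rule_tac Gamma_real_pos)
  have "cmod (LBINT x. of_real (marchaud_kernel \<alpha> x) * (of_real (exp (- (\<delta> * x))) * f (\<delta> * x)))
    \<le> (LBINT x. marchaud_kernel \<alpha> x * B)"
  proof (rule cmod_integral_le)
    show "integrable lborel (\<lambda>x. marchaud_kernel \<alpha> x * B)" using marchaud_kernel_integrable[OF a] by simp
    fix x :: real
    show "cmod (of_real (marchaud_kernel \<alpha> x) * (of_real (exp (- (\<delta> * x))) * f (\<delta> * x))) \<le> marchaud_kernel \<alpha> x * B"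
    proof (cases "x > 0")
      case True
      have "exp (- (\<delta> * x)) * cmod (f (\<delta> * x)) \<le> 1 * B"
        using True d by (intro mult_mono bd) auto
      thus ?thesis using marchaud_kernel_nonneg[OF a(1), of x] by (simp add: norm_mult mult_left_mono)
    qed (simp add: marchaud_kernel_def)
  qed
  hence "1 / (\<alpha> * Gamma \<alpha>) * cmod (LBINT x. of_real (marchaud_kernel \<alpha> x) * (of_real (exp (- (\<delta> * x))) * f (\<delta> * x)))
    \<le> 1 / (\<alpha> * Gamma \<alpha>) * ((LBINT x. marchaud_kernel \<alpha> x) * B)"
    using a G by (intro mult_left_mono) auto
  thus ?thesis
    unfolding marchaud_representation[OF d] norm_mult norm_of_real using a G by simp
qed

lemma marchaud_limit:
  assumes l: "(f \<longlongrightarrow> l) (at_right 0)"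
  shows "(\<lambda>n. marchaud (1 / real (Suc n)))
     \<longlonglongrightarrow> of_real ((LBINT x. marchaud_kernel \<alpha> x) / (\<alpha> * Gamma \<alpha>)) * l"
proof -
  let ?F = "\<lambda>n x. of_real (marchaud_kernel \<alpha> x) * (of_real (exp (- (1 / real (Suc n) * x))) * f (1 / real (Suc n) * x))"
  have "(\<lambda>n. LBINT x. ?F n x)
    \<longlonglongrightarrow> (LBINT x. of_real (marchaud_kernel \<alpha> x) * l)"
  proof (rule integral_dominated_convergence)
    show "integrable lborel (\<lambda>x. marchaud_kernel \<alpha> x * B)" using marchaud_kernel_integrable[OF a] by simp
    show "AE x in lborel. norm (?F n x)
       \<le> marchaud_kernel \<alpha> x * B" for n
    proof (rule AE_I2)
      fix x :: real
      show "norm (?F n x)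
         \<le> marchaud_kernel \<alpha> x * B"
      proof (cases "x > 0")
        case True
        have "exp (- (1 / real (Suc n) * x)) * cmod (f (1 / real (Suc n) * x)) \<le> 1 * B"
          using True by (intro mult_mono bd) (auto simp del: of_nat_Suc)
        thus ?thesis using marchaud_kernel_nonneg[OF a(1), of x] by (simp add: norm_mult mult_left_mono del: of_nat_Suc)
      qed (simp add: marchaud_kernel_def)
    qed
    show "AE x in lborel. (\<lambda>n. ?F n x)
      \<longlonglongrightarrow> of_real (marchaud_kernel \<alpha> x) * l"
    proof (rule AE_I2)
      fix x :: real
      show "(\<lambda>n. ?F n x)
        \<longlonglongrightarrow> of_real (marchaud_kernel \<alpha> x) * l"
      proof (cases "x > 0")
        case True
        have t: "(\<lambda>n. 1 / real (Suc n) * x) \<longlonglongrightarrow> 0 * x"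
          by (rule tendsto_mult[OF LIMSEQ_Suc[OF lim_1_over_n] tendsto_const])
        hence "filterlim (\<lambda>n. 1 / real (Suc n) * x) (at_right 0) sequentially"
          using True by (intro tendsto_imp_filterlim_at_right) auto
        hence "(\<lambda>n. f (1 / real (Suc n) * x)) \<longlonglongrightarrow> l"
          by (rule filterlim_compose[OF l])
        hence "(\<lambda>n. ?F n x)
          \<longlonglongrightarrow> of_real (marchaud_kernel \<alpha> x) * (of_real (exp (- (0 * x))) * l)"
          by (intro tendsto_mult tendsto_const tendsto_of_real tendsto_exp tendsto_minus t)
        thus ?thesis by simp
      qed (simp add: marchaud_kernel_def)
    qed
  qed measurable
  hence "(\<lambda>n. of_real (1 / (\<alpha> * Gamma \<alpha>)) * (LBINT x. ?F n x))
    \<longlonglongrightarrow> of_real (1 / (\<alpha> * Gamma \<alpha>)) * (LBINT x. of_real (marchaud_kernel \<alpha> x) * l)"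
    by (intro tendsto_intros)
  moreover have "(LBINT x. of_real (marchaud_kernel \<alpha> x) * l) = of_real (LBINT x. marchaud_kernel \<alpha> x) * l"
    by simp
  ultimately show ?thesis by (subst marchaud_representation) (simp_all del: of_nat_Suc)
qed

text \<open>The two differences are taken in opposite order, so their sum leaves the weight
  s^(-1-\<alpha>) (1 - exp (-s)), integrable at 0 as \<alpha> < 1 and at infinity as \<alpha> > 0.
  \<open>C\<close> is kept apart from \<open>B\<close> because the lower estimate needs the size of
  v, not of u.\<close>

lemma trunc_weight_correction:
  defines "w \<equiv> \<lambda>s. if 0 < s then s powr (- 1 - \<alpha>) * (1 - exp (- s)) else (0::real)"
  assumes d: "\<delta> > 0" and V: "\<And>s. 0 < s \<Longrightarrow> cmod (frac_mean \<alpha> f s) \<le> C"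
  shows "integrable lborel w"
    "cmod ((LBINT s. of_real (trunc_weight \<alpha> \<delta> s) * (frac_mean \<alpha> f s - frac_mean \<alpha> f 0)) +
       (marchaud \<delta>))
     \<le> (LBINT s. w s) * C"
proof -
  let ?dom = "\<lambda>x::real. (if 0 < x \<and> x \<le> 1 then x powr (- \<alpha>) else 0) + (if 1 \<le> x then x powr (- 1 - \<alpha>) else 0)"
  have nn: "0 \<le> w s" for s by (simp add: w_def)
  show i: "integrable lborel w"
  proof (rule integrable_dominated)
    show "integrable lborel ?dom"
      using a by (intro integrable_plus powr_integral_0_1 powr_integral_to_inf) auto
    show "w \<in> borel_measurable lborel" unfolding w_def by measurable
    show "AE x in lborel. norm (w x) \<le> norm (?dom x)"
    proof (rule AE_I2)
      fix x :: real
      consider "x \<le> 0" | "0 < x" "x \<le> 1" | "1 < x" by linarith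
      thus "norm (w x) \<le> norm (?dom x)"
      proof cases
        case 2
        have "w x = x powr (- 1 - \<alpha>) * (1 - exp (- x))" using 2 by (simp add: w_def)
        also have "\<dots> \<le> x powr (- 1 - \<alpha>) * x"
          using exp_ge_add_one_self[of "- x"] by (intro mult_left_mono) auto
        also have "\<dots> = x powr (- \<alpha>)" using 2 by (simp add: powr_diff powr_minus field_simps)
        finally show ?thesis using nn[of x] 2 by (cases "x = 1") auto
      next
        case 3
        have "w x = x powr (- 1 - \<alpha>) * (1 - exp (- x))" using 3 by (simp add: w_def)
        also have "\<dots> \<le> x powr (- 1 - \<alpha>) * 1" by (intro mult_left_mono) auto
        finally show ?thesis using nn[of x] 3 by simp
      qed (simp add: w_def)
    qed
  qed
  have i1: "integrable lborel (\<lambda>s. of_real (trunc_weight \<alpha> \<delta> s) * frac_mean \<alpha> f 0)"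
    using trunc_weight_integral(1)[OF a(1) d] by simp
  have i2: "integrable lborel (\<lambda>s. of_real (trunc_weight \<alpha> \<delta> s) * frac_mean \<alpha> f s)"
    using trunc_weight_frac_mean_integrable[OF d, of "\<lambda>_. 1"] by simp
  have i3: "integrable lborel (\<lambda>s. of_real (trunc_weight \<alpha> \<delta> s) * (of_real (exp (- s)) * frac_mean \<alpha> f s))"
    by (rule trunc_weight_frac_mean_integrable[OF d]) auto
  have "(LBINT s. of_real (trunc_weight \<alpha> \<delta> s) * (frac_mean \<alpha> f s - frac_mean \<alpha> f 0)) +
       (marchaud \<delta>)
    = (LBINT s. of_real (trunc_weight \<alpha> \<delta> s) * frac_mean \<alpha> f s - of_real (trunc_weight \<alpha> \<delta> s) * (of_real (exp (- s)) * frac_mean \<alpha> f s))"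
    unfolding right_diff_distrib lint_diff[OF i2 i1] lint_diff[OF i1 i3]
      lint_diff[OF i2 i3] by simp
  also have "cmod \<dots> \<le> (LBINT s. w s * C)"
  proof (rule cmod_integral_le)
    show "integrable lborel (\<lambda>s. w s * C)" using i by simp
    have C: "0 \<le> C" using V[of 1] norm_ge_zero order_trans zero_less_one by blast
    fix s
    show "cmod (of_real (trunc_weight \<alpha> \<delta> s) * frac_mean \<alpha> f s - of_real (trunc_weight \<alpha> \<delta> s) * (of_real (exp (- s)) * frac_mean \<alpha> f s)) \<le> w s * C"
    proof (cases "\<delta> \<le> s")
      case True
      hence s: "s > 0" using d by simp
      have "of_real (trunc_weight \<alpha> \<delta> s) * frac_mean \<alpha> f s - of_real (trunc_weight \<alpha> \<delta> s) * (of_real (exp (- s)) * frac_mean \<alpha> f s)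
        = of_real (w s) * frac_mean \<alpha> f s"
        using True s by (simp add: trunc_weight_def w_def algebra_simps)
      thus ?thesis using V[OF s] nn[of s] by (simp add: norm_mult mult_left_mono)
    qed (use nn C in \<open>simp add: trunc_weight_def\<close>)
  qed
  finally show "cmod ((LBINT s. of_real (trunc_weight \<alpha> \<delta> s) * (frac_mean \<alpha> f s - frac_mean \<alpha> f 0)) +
       (marchaud \<delta>))
     \<le> (LBINT s. w s) * C" by simp
qed

end

section \<open>Bessel potentials of bounded continuous functions\<close>

lemma heat_mean_joint_measurable [measurable]:
  fixes u :: "'e::euclidean_space \<Rightarrow> complex"
  assumes [measurable]: "u \<in> borel_measurable borel" "f \<in> borel_measurable M" "g \<in> borel_measurable M"
  shows "(\<lambda>x. heat_mean u (f x) (g x)) \<in> borel_measurable M"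
  unfolding heat_mean_def by measurable

context bounded_continuous
begin

lemma heat_mean_eq: "heat_mean u s x = (LBINT w. of_real (heat s (w - x)) * u w)"
  unfolding heat_mean_def
  using lborel_affine_integral(2)[of 1 "\<lambda>w. of_real (heat s (w - x)) * u w" x] by simp

lemma heat_mean_eq_integrable: "integrable lborel (\<lambda>w. of_real (heat s (w - x)) * u w)"
  using lborel_affine_integral(1)[of 1 "\<lambda>w. of_real (heat s (w - x)) * u w" x] heat_mean_integrable
  by simp

lemma heat_mean_heat_mean:
  assumes s: "s > 0" and t: "t > 0"
  shows "heat_mean (heat_mean u t) s 0 = heat_mean u (s + t) 0"
proof -
  have h: "integrable lborel (\<lambda>y::'e. complex_of_real (heat s y))" by simp
  have "heat_mean (heat_mean u t) s 0 =
     (LBINT y. of_real (heat s y) * (LBINT w. of_real (heat t (w - y)) * u w))"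
    by (subst heat_mean_def) (simp add: heat_mean_eq)
  also have "\<dots> = (LBINT w. (LBINT y. of_real (heat s y) * (of_real (heat t (w - y)) * u w)))"
  proof (rule Fubini_kernel(1)[OF h])
    show "integrable lborel (\<lambda>w. of_real (heat t (w - y)) * u w)"
       "(LBINT w. cmod (of_real (heat t (w - y)) * u w)) \<le> B" for y
      using integrable_mult_bounded(1,2)[of "\<lambda>w. of_real (heat t (w - y))" u B] t bound
        heat_translate[of t, where 'e = 'e] by simp_all
  qed measurable
  also have "(\<lambda>w. LBINT y. of_real (heat s y) * (of_real (heat t (w - y)) * u w))
      = (\<lambda>w. of_real (heat (s + t) (w - 0)) * u w)"
  proof
    fix w
    have "(LBINT y. of_real (heat s y) * (of_real (heat t (w - y)) * u w))
      = (LBINT y. complex_of_real (heat t (w - y) * heat s y)) * u w"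
      by (simp add: mult_ac flip: integral_mult_left_zero)
    also have "\<dots> = of_real (heat (s + t) (w - 0)) * u w"
      by (simp only: integral_complex_of_real heat_semigroup(2)[OF t s]) (simp add: add.commute)
    finally show "(LBINT y. of_real (heat s y) * (of_real (heat t (w - y)) * u w))
       = of_real (heat (s + t) (w - 0)) * u w" .
  qed
  finally show ?thesis by (simp only: heat_mean_eq[of "s + t" 0])
qed

lemma heat_mean_second_difference:
  assumes s: "s > 0"
  shows "cmod (heat_mean u s t + heat_mean u s (- t) - 2 * heat_mean u s 0) \<le> B * min 4 ((norm t)\<^sup>2 / s)"
proof -
  let ?D = "\<lambda>w. heat s (w - t) + heat s (w + t) - 2 * heat s w"
  have "heat_mean u s t + heat_mean u s (- t) - 2 * heat_mean u s 0 = (LBINT w. of_real (?D w) * u w)"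
  proof -
    note i = heat_mean_eq_integrable[of s t] heat_mean_eq_integrable[of s "- t"] heat_mean_eq_integrable[of s 0]
    have "of_real (?D w) * u w = of_real (heat s (w - t)) * u w + of_real (heat s (w - - t)) * u w
        - 2 * (of_real (heat s (w - 0)) * u w)" for w
      by (simp add: algebra_simps)
    thus ?thesis
      by (simp only: heat_mean_eq lint_add[OF i(1,2)] integral_mult_right_zero
          lint_diff[OF integrable_plus[OF i(1,2)] integrable_mult_right[OF i(3)]])
  qed
  also have "cmod \<dots> \<le> B * (LBINT w. cmod (of_real (?D w)))"
  proof (rule integrable_mult_bounded(3))
    have "integrable lborel ?D"
      by (intro integrable_plus integrable_minus
          integrable_mult_right heat_translate integrable_heat)
    thus "integrable lborel (\<lambda>w. complex_of_real (?D w))" by (rule integrable_of_real)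
  qed (use bound in auto)
  also have "(LBINT w. cmod (of_real (?D w))) = (LBINT w. \<bar>?D w\<bar>)"
    by (simp only: norm_of_real)
  also have "B * \<dots> \<le> B * min 4 ((norm t)\<^sup>2 / s)"
    by (intro mult_left_mono heat_second_difference s B_nonneg)
  finally show ?thesis .
qed

end

text \<open>Split at s = c: below it 4 s^(\<alpha>-1) is integrable as \<alpha> > 0, above it c
  s^(\<alpha>-2) as \<alpha> < 1, and both give multiples of c^\<alpha>. The minimum is that of
  \<open>heat_second_difference\<close> with c = |t|^2.\<close>

lemma gamma_density_min_integral:
  assumes a: "0 < \<alpha>" "\<alpha> < 1" and c: "c > 0"
  shows "integrable lborel (\<lambda>s. gamma_density \<alpha> s * min 4 (c / s))"
    and "(LBINT s. gamma_density \<alpha> s * min 4 (c / s)) \<le> (4 / \<alpha> + 1 / (1 - \<alpha>)) / Gamma \<alpha> * c powr \<alpha>"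
proof -
  have G: "Gamma \<alpha> > 0" using a by (rule_tac Gamma_real_pos)
  let ?f = "\<lambda>s::real. if 0 < s \<and> s \<le> c then s powr (\<alpha> - 1) else 0"
  let ?g = "\<lambda>s::real. if c \<le> s then s powr (\<alpha> - 2) else 0"
  have f: "integrable lborel ?f" "(LBINT s. ?f s) = c powr \<alpha> / \<alpha>"
  proof -
    have h: "((\<lambda>x. x powr (\<alpha> - 1)) has_integral c powr \<alpha> / \<alpha>) {0..c}"
      using has_integral_powr_from_0[of "\<alpha> - 1" c] a c by simp
    show "integrable lborel ?f" "(LBINT s. ?f s) = c powr \<alpha> / \<alpha>"
      by (rule nonneg_has_integral_lborel[OF h]; auto)+
  qed
  have g: "integrable lborel ?g" "(LBINT s. ?g s) = c powr (\<alpha> - 1) / (1 - \<alpha>)"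
  proof -
    have "- x / (\<alpha> - 1) = x / (1 - \<alpha>)" for x :: real
      using a by (simp add: field_simps)
    moreover have "\<alpha> - 2 + 1 = \<alpha> - 1" by simp
    ultimately show "integrable lborel ?g" "(LBINT s. ?g s) = c powr (\<alpha> - 1) / (1 - \<alpha>)"
      using powr_integral_to_inf[of "\<alpha> - 2" c] a c by simp_all
  qed
  have le: "\<bar>gamma_density \<alpha> s * min 4 (c / s)\<bar> \<le> (4 * ?f s + c * ?g s) / Gamma \<alpha>" for s
  proof (cases "s > 0")
    case True
    have e: "s powr (\<alpha> - 1) * exp (- s) \<le> s powr (\<alpha> - 1) * 1"
      using True by (intro mult_left_mono) auto
    have m: "s powr (\<alpha> - 1) * exp (- s) * min 4 (c / s) \<le> 4 * ?f s + c * ?g s"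
    proof (cases "s \<le> c")
      case False
      have "s powr (\<alpha> - 1) * exp (- s) * min 4 (c / s) \<le> s powr (\<alpha> - 1) * (c / s)"
        using True e c by (intro mult_mono) auto
      also have "\<dots> = c * s powr (\<alpha> - 2)" using powr_diff[of s "\<alpha> - 1" 1] True by simp
      finally show ?thesis using False by simp
    next
      case le: True
      have "s powr (\<alpha> - 1) * exp (- s) * min 4 (c / s) \<le> s powr (\<alpha> - 1) * 4"
        using True e c by (intro mult_mono) auto
      also have "\<dots> \<le> 4 * ?f s + c * ?g s" using le True c by simp
      finally show ?thesis .
    qed
    have "\<bar>gamma_density \<alpha> s * min 4 (c / s)\<bar> = s powr (\<alpha> - 1) * exp (- s) * min 4 (c / s) / Gamma \<alpha>"
      using True G c by (simp add: gamma_density_def abs_mult)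
    also have "\<dots> \<le> (4 * ?f s + c * ?g s) / Gamma \<alpha>"
      using m G by (intro divide_right_mono) auto
    finally show ?thesis .
  qed (use c in \<open>simp add: gamma_density_def\<close>)
  have fg: "integrable lborel (\<lambda>s. (4 * ?f s + c * ?g s) / Gamma \<alpha>)"
    using f(1) g(1) by (intro integrable_divide integrable_plus integrable_mult_right) auto
  show i: "integrable lborel (\<lambda>s. gamma_density \<alpha> s * min 4 (c / s))"
  proof (rule integrable_dominated[OF fg])
    show "AE s in lborel. norm (gamma_density \<alpha> s * min 4 (c / s)) \<le> norm ((4 * ?f s + c * ?g s) / Gamma \<alpha>)"
      unfolding real_norm_def by (intro AE_I2 order_trans[OF le abs_ge_self])
  qed measurable
  have "(LBINT s. gamma_density \<alpha> s * min 4 (c / s)) \<le> (LBINT s. (4 * ?f s + c * ?g s) / Gamma \<alpha>)"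
    by (rule integral_mono[OF i fg]) (rule order_trans[OF abs_ge_self le])
  also have "\<dots> = (4 * (c powr \<alpha> / \<alpha>) + c * (c powr (\<alpha> - 1) / (1 - \<alpha>))) / Gamma \<alpha>"
    by (simp only: f(2) g(2) integral_divide_zero integral_mult_right_zero
        lint_add[OF integrable_mult_right[OF f(1)] integrable_mult_right[OF g(1)]])
  also have "c * (c powr (\<alpha> - 1) / (1 - \<alpha>)) = c powr \<alpha> / (1 - \<alpha>)"
    using c by (simp add: powr_diff)
  also have "4 * (c powr \<alpha> / \<alpha>) + c powr \<alpha> / (1 - \<alpha>) = (4 / \<alpha> + 1 / (1 - \<alpha>)) * c powr \<alpha>"
    by (simp add: distrib_right)
  finally show "(LBINT s. gamma_density \<alpha> s * min 4 (c / s)) \<le> (4 / \<alpha> + 1 / (1 - \<alpha>)) / Gamma \<alpha> * c powr \<alpha>"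
    by simp
qed

section \<open>Bessel potentials: transfer to the half-line and smoothness\<close>

text \<open>The exponent \<open>p\<close> arises from s^(-1-\<alpha>) times the factor s^(-d/2) of
  the heat kernel, which is s^(-1-p).\<close>

locale bessel_potential = U: bounded_continuous u B + V: bounded_continuous v C
  for u v :: "'e::euclidean_space \<Rightarrow> complex" and B C :: real +
  fixes \<alpha> p :: real
  assumes alpha: "0 < \<alpha>" "\<alpha> < 1" and p_eq: "p = \<alpha> + DIM('e) / 2"
    and v_eq: "\<And>x. v x = (LBINT s. of_real (gamma_density \<alpha> s) * heat_mean u s x)"
begin

abbreviation "profile \<equiv> \<lambda>s. heat_mean u s 0"

lemma v_0: "v 0 = frac_mean \<alpha> profile 0"
  by (simp add: v_eq frac_mean_def)

lemma gamma_heat_mean_integrable: "integrable lborel (\<lambda>s. of_real (gamma_density \<alpha> s) * heat_mean u s x)"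
  using frac_mean_integrable(1)[OF alpha U.heat_mean_measurable U.heat_mean_bound, of 0 x] by simp

text \<open>Heat means commute with the Gamma mean, and H_s H_y = H_(s+y). All heat means of v at 0
  are thus fractional means of the one-variable function \<open>profile\<close>, which brings the
  Marchaud calculus to bear.\<close>

lemma heat_mean_v:
  assumes s: "s > 0"
  shows "heat_mean v s 0 = frac_mean \<alpha> profile s"
proof -
  have g: "integrable lborel (\<lambda>y. complex_of_real (gamma_density \<alpha> y))"
    using gamma_density_integral(1)[OF alpha(1)] by simp
  let ?k = "\<lambda>y t. of_real (heat s t) * heat_mean u y t"
  have i: "integrable lborel (?k y)" "(LBINT t. cmod (?k y t)) \<le> B" if "y > 0" for y
    using integrable_mult_bounded(1,2)[OF integrable_heat_complex, of "heat_mean u y" B s] s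
      U.heat_mean_bound[OF that] by (simp_all add: integral_heat)
  have pos: "y > 0" if "complex_of_real (gamma_density \<alpha> y) \<noteq> 0" for y
    using that by (auto simp: gamma_density_def split: if_splits)
  have "(LBINT y. of_real (gamma_density \<alpha> y) * (LBINT t. ?k y t)) =
      (LBINT t. (LBINT y. of_real (gamma_density \<alpha> y) * ?k y t))"
    by (rule Fubini_kernel(1)[OF g _ i(1)[OF pos] i(2)[OF pos]]) auto
  also have "\<dots> = (LBINT t. of_real (heat s t) * v t)"
    unfolding v_eq mult.left_commute[of _ "of_real (heat s _)"] integral_mult_right_zero ..
  also have "\<dots> = heat_mean v s 0" by (simp add: heat_mean_def)
  finally have "heat_mean v s 0 = (LBINT y. of_real (gamma_density \<alpha> y) * (LBINT t. ?k y t))" ..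
  also have "\<dots> = frac_mean \<alpha> profile s"
    unfolding frac_mean_def
  proof (rule lint_cong[OF refl])
    fix y
    show "of_real (gamma_density \<alpha> y) * (LBINT t. ?k y t) = of_real (gamma_density \<alpha> y) * heat_mean u (s + y) 0"
    proof (cases "y > 0")
      case True
      show ?thesis using U.heat_mean_heat_mean[OF s True] by (simp add: heat_mean_def[of "heat_mean u y"])
    qed (simp add: gamma_density_def)
  qed
  finally show ?thesis .
qed

text \<open>Zygmund smoothness of order 2 \<alpha>: the second differences of the heat means are at
  most B min (4, |t|^2 / s), and the Gamma mean of this is O(|t|^(2 \<alpha>)).\<close>

lemma v_second_difference:
  "cmod (v t + v (- t) - 2 * v 0) \<le> (4 / \<alpha> + 1 / (1 - \<alpha>)) / Gamma \<alpha> * B * norm t powr (2 * \<alpha>)"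
proof (cases "t = 0")
  case False
  have c: "(norm t)\<^sup>2 > 0" using False by simp
  note M = gamma_density_min_integral[OF alpha c]
  have "v t + v (- t) - 2 * v 0 = (LBINT s. of_real (gamma_density \<alpha> s) *
      (heat_mean u s t + heat_mean u s (- t) - 2 * heat_mean u s 0))"
    unfolding v_eq distrib_left right_diff_distrib mult.left_commute[of _ 2]
      lint_diff[OF integrable_plus[OF gamma_heat_mean_integrable[of t]
        gamma_heat_mean_integrable[of "- t"]] integrable_mult_right[OF gamma_heat_mean_integrable[of 0]]]
      lint_add[OF gamma_heat_mean_integrable[of t] gamma_heat_mean_integrable[of "- t"]]
      integral_mult_right_zero ..
  also have "cmod \<dots> \<le> (LBINT s. B * (gamma_density \<alpha> s * min 4 ((norm t)\<^sup>2 / s)))"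
  proof (rule cmod_integral_le)
    show "integrable lborel (\<lambda>s. B * (gamma_density \<alpha> s * min 4 ((norm t)\<^sup>2 / s)))" using M(1) by simp
    fix s
    show "cmod (of_real (gamma_density \<alpha> s) * (heat_mean u s t + heat_mean u s (- t) - 2 * heat_mean u s 0))
       \<le> B * (gamma_density \<alpha> s * min 4 ((norm t)\<^sup>2 / s))"
    proof (cases "s > 0")
      case True
      have "gamma_density \<alpha> s * cmod (heat_mean u s t + heat_mean u s (- t) - 2 * heat_mean u s 0)
        \<le> gamma_density \<alpha> s * (B * min 4 ((norm t)\<^sup>2 / s))"
        by (intro mult_left_mono U.heat_mean_second_difference True gamma_density_nonneg alpha)
      thus ?thesis using gamma_density_nonneg[OF alpha(1), of s] by (simp add: norm_mult mult_ac)
    qed (simp add: gamma_density_def)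
  qed
  also have "\<dots> \<le> B * ((4 / \<alpha> + 1 / (1 - \<alpha>)) / Gamma \<alpha> * (norm t)\<^sup>2 powr \<alpha>)"
    unfolding integral_mult_right_zero by (rule mult_left_mono[OF M(2) U.B_nonneg])
  also have "(norm t)\<^sup>2 powr \<alpha> = norm t powr (2 * \<alpha>)"
    using False by (simp add: powr_powr flip: powr_numeral)
  finally show ?thesis by (simp add: mult_ac)
qed simp

lemma heat_difference_integrable:
  "integrable lborel (\<lambda>t. of_real (heat s t) * (v t - v 0))"
  "s > 0 \<Longrightarrow> (LBINT t. cmod (of_real (heat s t) * (v t - v 0))) \<le> 2 * C"
  "s > 0 \<Longrightarrow> (LBINT t. of_real (heat s t) * (v t - v 0)) = frac_mean \<alpha> profile s - frac_mean \<alpha> profile 0"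
proof -
  have b: "cmod (v t - v 0) \<le> 2 * C" for t
    using norm_triangle_ineq4[of "v t" "v 0"] V.bound[of t] V.bound[of 0] by linarith
  show "integrable lborel (\<lambda>t. of_real (heat s t) * (v t - v 0))"
    "s > 0 \<Longrightarrow> (LBINT t. cmod (of_real (heat s t) * (v t - v 0))) \<le> 2 * C"
    using integrable_mult_bounded(1,2)[OF integrable_heat_complex, of "\<lambda>t. v t - v 0" "2 * C" s] b
    by (simp_all add: integral_heat)
  show "(LBINT t. of_real (heat s t) * (v t - v 0)) = frac_mean \<alpha> profile s - frac_mean \<alpha> profile 0" if s: "s > 0"
    using V.heat_mean_integrable[of s 0] heat_mean_v[OF s] s
    by (simp add: right_diff_distrib heat_mean_def integral_heat v_0)
qed

end

section \<open>Hypersingular integrals\<close>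

text \<open>The lower incomplete Gamma function: \<open>Gamma p * gamma_density p s\<close> is
  s^(p-1) exp (-s) on s > 0 and 0 elsewhere.\<close>

definition lower_gamma :: "real \<Rightarrow> real \<Rightarrow> real" where
  "lower_gamma p X = (LBINT s. (if s \<le> X then Gamma p * gamma_density p s else 0))"

context
  fixes p :: real
  assumes p: "p > 0"
begin

lemma lower_gamma_integrable: "integrable lborel (\<lambda>s. if s \<le> X then Gamma p * gamma_density p s else 0)"
  by (rule integrable_dominated[OF integrable_mult_right[OF gamma_density_integral(1)[OF p], of "Gamma p"]])
     auto

lemma Gamma_density_nonneg: "0 \<le> Gamma p * gamma_density p s"
  using Gamma_real_pos[OF p] gamma_density_nonneg[OF p] by simp

lemma lower_gamma_nonneg: "0 \<le> lower_gamma p X"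
  unfolding lower_gamma_def using Gamma_density_nonneg by (intro integral_nonneg_AE) auto

lemma lower_gamma_mono: "X \<le> Y \<Longrightarrow> lower_gamma p X \<le> lower_gamma p Y"
  unfolding lower_gamma_def using Gamma_density_nonneg
  by (intro integral_mono lower_gamma_integrable) auto

lemma lower_gamma_le:
  assumes "0 \<le> X"
  shows "lower_gamma p X \<le> X powr p / p"
proof -
  have h: "((\<lambda>x. x powr (p - 1)) has_integral X powr p / p) {0..X}"
    using has_integral_powr_from_0[of "p - 1" X] p assms by simp
  let ?g = "\<lambda>s. if 0 \<le> s \<and> s \<le> X then s powr (p - 1) else 0"
  have g: "integrable lborel ?g" "(LBINT s. ?g s) = X powr p / p"
    by (rule nonneg_has_integral_lborel[OF h]; auto)+
  have "lower_gamma p X \<le> (LBINT s. ?g s)"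
    unfolding lower_gamma_def
  proof (rule integral_mono[OF lower_gamma_integrable g(1)])
    fix s
    have "s powr (p - 1) * exp (- s) \<le> s powr (p - 1) * 1" if "s > 0" using that by (intro mult_left_mono) auto
    thus "(if s \<le> X then Gamma p * gamma_density p s else 0) \<le> ?g s"
      using Gamma_real_pos[OF p] by (auto simp: gamma_density_def)
  qed
  thus ?thesis using g by simp
qed

text \<open>Markov's inequality: 1 \<le> s / X on the tail, and the extra factor s raises the order
  to p + 1. The gain 1 / X later makes the difference of sharp and smooth kernels integrable at
  infinity.\<close>

lemma lower_gamma_tail:
  assumes X: "X > 0"
  shows "\<bar>Gamma p - lower_gamma p X\<bar> \<le> Gamma (p + 1) / X"
proof -
  have i: "integrable lborel (\<lambda>s. Gamma p * gamma_density p s)"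
    using gamma_density_integral(1)[OF p] by simp
  have "Gamma p - lower_gamma p X = (LBINT s. Gamma p * gamma_density p s - (if s \<le> X then Gamma p * gamma_density p s else 0))"
    unfolding lower_gamma_def lint_diff[OF i lower_gamma_integrable]
    by (simp add: gamma_density_integral(2)[OF p])
  also have "\<dots> = (LBINT s. (if s \<le> X then 0 else Gamma p * gamma_density p s))"
    by (intro lint_cong) auto
  finally have e: "Gamma p - lower_gamma p X = \<dots>" .
  have "\<bar>Gamma p - lower_gamma p X\<bar> = Gamma p - lower_gamma p X"
    unfolding e using Gamma_density_nonneg by (intro abs_of_nonneg integral_nonneg_AE) auto
  also have "\<dots> \<le> (LBINT s. (Gamma (p + 1) / X) * gamma_density (p + 1) s)"
    unfolding e
  proof (rule integral_mono)
    show "integrable lborel (\<lambda>s. if s \<le> X then 0 else Gamma p * gamma_density p s)"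
      by (rule integrable_dominated[OF i]) auto
    show "integrable lborel (\<lambda>s. (Gamma (p + 1) / X) * gamma_density (p + 1) s)"
      using gamma_density_integral(1)[of "p + 1"] p by simp
    fix s
    show "(if s \<le> X then 0 else Gamma p * gamma_density p s) \<le> (Gamma (p + 1) / X) * gamma_density (p + 1) s"
    proof (cases "s \<le> X")
      case True
      thus ?thesis using X p gamma_density_nonneg[of "p + 1" s] Gamma_real_pos[of "p + 1"] by simp
    next
      case False
      hence s: "s > 0" "s > X" using X by auto
      have "Gamma p * gamma_density p s = s powr (p - 1) * exp (- s)"
        using Gamma_real_pos[OF p] s by (simp add: gamma_density_def)
      also have "\<dots> \<le> s powr (p - 1) * exp (- s) * (s / X)"
      proof -
        have "s powr (p - 1) * exp (- s) * 1 \<le> s powr (p - 1) * exp (- s) * (s / X)"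
          using s X by (intro mult_left_mono) auto
        thus ?thesis by simp
      qed
      also have "\<dots> = s powr p * exp (- s) / X"
        using s powr_add[of s "p - 1" 1] by simp
      also have "\<dots> = (Gamma (p + 1) / X) * gamma_density (p + 1) s"
      proof -
        have "Gamma (p + 1) \<noteq> 0" using Gamma_real_pos[of "p + 1"] p by linarith
        thus ?thesis using s by (simp add: gamma_density_def)
      qed
      finally show ?thesis using False by simp
    qed
  qed
  also have "\<dots> = Gamma (p + 1) / X" using p by (simp add: gamma_density_integral(2))
  finally show ?thesis .
qed

text \<open>This value becomes a denominator when sharp kernels are dominated by heat
  potentials.\<close>

lemma lower_gamma_1_pos: "0 < lower_gamma p 1"
proof -
  have h: "((\<lambda>x. x powr (p - 1)) has_integral 1 powr p / p) {0..1}"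
    using has_integral_powr_from_0[of "p - 1" 1] p by simp
  let ?g = "\<lambda>s::real. if 0 \<le> s \<and> s \<le> 1 then s powr (p - 1) else 0"
  have g: "integrable lborel ?g" "(LBINT s. ?g s) = 1 powr p / p"
    by (rule nonneg_has_integral_lborel[OF h]; auto)+
  have "exp (- 1) * (1 / p) = (LBINT s. exp (- 1) * ?g s)"
    using g by (simp only: integral_mult_right_zero) simp
  also have "\<dots> \<le> lower_gamma p 1"
    unfolding lower_gamma_def
  proof (rule integral_mono[OF integrable_mult_right[OF g(1)] lower_gamma_integrable])
    fix s :: real
    have "exp (- 1) * s powr (p - 1) \<le> exp (- s) * s powr (p - 1)" if "s \<le> 1"
      using that by (intro mult_right_mono) auto
    thus "exp (- 1) * ?g s \<le> (if s \<le> 1 then Gamma p * gamma_density p s else 0)"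
      using Gamma_real_pos[OF p] Gamma_density_nonneg[of s]
      by (cases "s = 0") (auto simp: gamma_density_def mult.commute)
  qed
  finally show ?thesis using p by (auto intro: less_le_trans[rotated])
qed

text \<open>The substitution x = A / s maps [\<delta>, infinity) onto (0, A / \<delta>] and produces
  the integrand x^(p-1) exp (-x).\<close>

lemma inversion_integral:
  assumes A: "A > 0" and d: "\<delta> > 0"
  shows "(LBINT s. (if \<delta> \<le> s then s powr (- 1 - p) * exp (- A / s) else 0)) = A powr (- p) * lower_gamma p (A / \<delta>)"
proof -
  let ?f = "\<lambda>x. Gamma p * gamma_density p x" and ?g = "\<lambda>s. A / s" and ?g' = "\<lambda>s. - A / s\<^sup>2"
  have img: "?g ` {\<delta>..} = {0<..A / \<delta>}"
  proof (intro equalityI subsetI)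
    fix x assume x: "x \<in> {0<..A / \<delta>}"
    hence "A / x \<in> {\<delta>..}" "?g (A / x) = x" using A d by (auto simp: field_simps)
    thus "x \<in> ?g ` {\<delta>..}" by (metis image_eqI)
  qed (use A d in \<open>auto simp: frac_le\<close>)
  have ind: "(\<lambda>x. indicator {0<..A / \<delta>} x *\<^sub>R ?f x) = (\<lambda>s. if s \<le> A / \<delta> then Gamma p * gamma_density p s else 0)"
    by (auto simp: fun_eq_iff indicator_def gamma_density_def)
  have ai: "?f absolutely_integrable_on {0<..A / \<delta>}"
    unfolding set_integrable_def ind using lower_gamma_integrable[of "A / \<delta>"]
    by (subst integrable_completion) auto
  have "integral {0<..A / \<delta>} ?f = (LINT x : {0<..A / \<delta>} | lebesgue. ?f x)"
    by (rule set_lebesgue_integral_eq_integral(2)[OF ai, symmetric])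
  also have "\<dots> = lower_gamma p (A / \<delta>)"
    unfolding set_lebesgue_integral_def ind lower_gamma_def
    by (subst integral_completion) auto
  finally have I: "integral {0<..A / \<delta>} ?f = lower_gamma p (A / \<delta>)" .
  have cov: "(\<lambda>x. \<bar>?g' x\<bar> * ?f (?g x)) absolutely_integrable_on {\<delta>..} \<and> integral {\<delta>..} (\<lambda>x. \<bar>?g' x\<bar> * ?f (?g x)) = lower_gamma p (A / \<delta>)
    \<longleftrightarrow> ?f absolutely_integrable_on ?g ` {\<delta>..} \<and> integral (?g ` {\<delta>..}) ?f = lower_gamma p (A / \<delta>)"
  proof (rule has_absolute_integral_change_of_variables_1')
    show "inj_on ?g {\<delta>..}" using A d by (auto simp: inj_on_def)
    fix x assume "x \<in> {\<delta>..}"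
    thus "(?g has_field_derivative ?g' x) (at x within {\<delta>..})"
      using d by (auto intro!: derivative_eq_intros simp: power2_eq_square)
  qed auto
  hence "(\<lambda>x. \<bar>?g' x\<bar> * ?f (?g x)) absolutely_integrable_on {\<delta>..}"
     and i2: "integral {\<delta>..} (\<lambda>x. \<bar>?g' x\<bar> * ?f (?g x)) = lower_gamma p (A / \<delta>)"
    using ai I unfolding img by auto
  hence "((\<lambda>x. \<bar>?g' x\<bar> * ?f (?g x)) has_integral lower_gamma p (A / \<delta>)) {\<delta>..}"
    using set_lebesgue_integral_eq_integral(1) integrable_integral by fastforce
  from has_integral_mult_right[OF this, of "A powr (- p)"]
  have H: "((\<lambda>x. A powr (- p) * (\<bar>?g' x\<bar> * ?f (?g x))) has_integral A powr (- p) * lower_gamma p (A / \<delta>)) {\<delta>..}" .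
  have e: "A powr (- p) * (\<bar>?g' s\<bar> * ?f (?g s)) = s powr (- 1 - p) * exp (- A / s)" if "\<delta> \<le> s" for s
  proof -
    have s: "s > 0" using that d by simp
    have "A powr (- p) * (A / s\<^sup>2 * ((A / s) powr (p - 1))) = s powr (- 1 - p)"
    proof -
      have "A / s\<^sup>2 * (A / s) powr (p - 1) = (A / s) * (A / s) powr (p - 1) / s"
        by (simp add: power2_eq_square)
      also have "(A / s) * (A / s) powr (p - 1) = (A / s) powr p"
        using A s powr_add[of "A / s" 1 "p - 1"] by simp
      also have "A powr (- p) * ((A / s) powr p / s) = s powr (- 1 - p)"
        using A s by (simp add: powr_divide powr_minus powr_diff field_simps)
      finally show ?thesis by simp
    qed
    moreover have "\<bar>?g' s\<bar> * ?f (?g s) = A / s\<^sup>2 * ((A / s) powr (p - 1)) * exp (- A / s)"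
      using A s Gamma_real_pos[OF p] by (simp add: gamma_density_def)
    ultimately show ?thesis by (simp only: mult.assoc[symmetric])
  qed
  show ?thesis
  proof (rule nonneg_has_integral_lborel(2)[OF H])
    fix s assume "s \<in> {\<delta>..}"
    thus "(if \<delta> \<le> s then s powr (- 1 - p) * exp (- A / s) else 0) = A powr (- p) * (\<bar>?g' s\<bar> * ?f (?g s))"
      using e[of s] by simp
  qed auto
qed

end

section \<open>Smooth and sharp truncations of the hypersingular kernel\<close>

definition heat_potential :: "real \<Rightarrow> real \<Rightarrow> 'e::euclidean_space \<Rightarrow> real" where
  "heat_potential \<beta> \<delta> t = (LBINT s. trunc_weight \<beta> \<delta> s * heat s t)"

text \<open>The first factor normalises the heat kernel; the power of 4 comes from raising |t|^2 / 4
  to the exponent -(\<beta> + d/2).\<close>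

definition potential_const :: "'e::euclidean_space itself \<Rightarrow> real \<Rightarrow> real" where
  "potential_const TYPE('e) \<beta> = (4 * pi) powr (- (DIM('e) / 2)) * 4 powr (\<beta> + DIM('e) / 2)"

lemma potential_const_pos: "0 < potential_const TYPE('e::euclidean_space) \<beta>"
  by (simp add: potential_const_def)

lemma heat_potential_nonneg: "0 \<le> heat_potential \<beta> \<delta> t"
  unfolding heat_potential_def by (intro integral_nonneg_AE) auto

lemma heat_potential_eq:
  fixes t :: "'e::euclidean_space" and \<beta> :: real
  assumes b: "\<beta> > 0" and d: "\<delta> > 0" and t: "t \<noteq> 0"
  shows "heat_potential \<beta> \<delta> t = potential_const TYPE('e) \<beta> *
    (norm t powr (- (2 * \<beta>) - DIM('e)) * lower_gamma (\<beta> + DIM('e) / 2) ((norm t)\<^sup>2 / (4 * \<delta>)))"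
proof -
  define p A where "p = \<beta> + DIM('e) / 2" and "A = (norm t)\<^sup>2 / 4"
  have pA: "p > 0" "A > 0" using b t by (auto simp: p_def A_def intro: add_pos_nonneg)
  have e: "trunc_weight \<beta> \<delta> s * heat s t = (4 * pi) powr (- (DIM('e) / 2)) * (if \<delta> \<le> s then s powr (- 1 - p) * exp (- A / s) else 0)" for s
  proof (cases "\<delta> \<le> s")
    case True
    hence s: "s > 0" using d by simp
    have "s powr (- 1 - p) = s powr (- 1 - \<beta>) * s powr (- (DIM('e) / 2))"
      by (simp add: p_def algebra_simps flip: powr_add)
    thus ?thesis using True s by (simp add: trunc_weight_def heat_def A_def powr_mult mult_ac)
  qed (simp add: trunc_weight_def)
  have "heat_potential \<beta> \<delta> t = (4 * pi) powr (- (DIM('e) / 2)) * (A powr (- p) * lower_gamma p (A / \<delta>))"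
    unfolding heat_potential_def e integral_mult_right_zero inversion_integral[OF pA d] ..
  also have "A powr (- p) = 4 powr p * norm t powr (- (2 * \<beta>) - DIM('e))"
  proof -
    have "A powr (- p) = (norm t powr 2) powr (- p) * 4 powr p"
      using t by (simp add: A_def powr_divide powr_minus powr_numeral field_simps)
    also have "(norm t powr 2) powr (- p) = norm t powr (- (2 * \<beta>) - DIM('e))"
      unfolding powr_powr by (simp add: p_def algebra_simps)
    finally show ?thesis by simp
  qed
  finally show ?thesis by (simp add: potential_const_def p_def A_def)
qed

text \<open>Each heat kernel has mass 1, so by Fubini only the mass of the weight remains.\<close>

lemma heat_potential_integral:
  assumes b: "\<beta> > 0" and d: "\<delta> > 0"
  shows "integrable lborel (heat_potential \<beta> \<delta> :: 'e::euclidean_space \<Rightarrow> real)"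
    and "(LBINT t. heat_potential \<beta> \<delta> (t::'e)) = \<delta> powr (- \<beta>) / \<beta>"
proof -
  have w: "integrable lborel (\<lambda>s. complex_of_real (trunc_weight \<beta> \<delta> s))"
    using trunc_weight_integral(1)[OF b d] by simp
  have pos: "s > 0" if "complex_of_real (trunc_weight \<beta> \<delta> s) \<noteq> 0" for s
    using that d by (auto simp: trunc_weight_def split: if_splits)
  have h: "integrable lborel (\<lambda>t::'e. complex_of_real (heat s t))" for s by simp
  have hb: "(LBINT t. cmod (complex_of_real (heat s (t::'e)))) \<le> 1" if "s > 0" for s
    using that by (simp add: integral_heat)
  have m: "(\<lambda>(s, t::'e). complex_of_real (heat s t)) \<in> borel_measurable (lborel \<Otimes>\<^sub>M lborel)" by measurable
  have F: "(LBINT s. of_real (trunc_weight \<beta> \<delta> s) * (LBINT t. complex_of_real (heat s (t::'e)))) =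
     (LBINT t. (LBINT s. complex_of_real (trunc_weight \<beta> \<delta> s) * of_real (heat s (t::'e))))"
    and F': "integrable lborel (\<lambda>t::'e. LBINT s. complex_of_real (trunc_weight \<beta> \<delta> s) * of_real (heat s t))"
    by (rule Fubini_kernel[OF w m h hb[OF pos]]; simp)+
  have e: "(LBINT s. complex_of_real (trunc_weight \<beta> \<delta> s) * of_real (heat s t)) = of_real (heat_potential \<beta> \<delta> t)" for t :: 'e
    unfolding heat_potential_def by (simp only: integral_complex_of_real[symmetric] of_real_mult)
  have i: "integrable lborel (\<lambda>t::'e. complex_of_real (heat_potential \<beta> \<delta> t))"
    using F' by (simp only: e)
  from integrable_Re[OF this] show "integrable lborel (heat_potential \<beta> \<delta> :: 'e \<Rightarrow> real)" by simp
  have "complex_of_real (LBINT t. heat_potential \<beta> \<delta> (t::'e)) =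
     (LBINT s. of_real (trunc_weight \<beta> \<delta> s) * (LBINT t. complex_of_real (heat s (t::'e))))"
    unfolding F e by simp
  also have "\<dots> = (LBINT s. complex_of_real (trunc_weight \<beta> \<delta> s))"
  proof (rule lint_cong[OF refl])
    fix s
    show "of_real (trunc_weight \<beta> \<delta> s) * (LBINT t. complex_of_real (heat s (t::'e))) = complex_of_real (trunc_weight \<beta> \<delta> s)"
      using pos[of s] integral_heat[of s, where 'e = 'e] by (cases "trunc_weight \<beta> \<delta> s = 0") auto
  qed
  also have "\<dots> = of_real (\<delta> powr (- \<beta>) / \<beta>)"
    by (simp only: integral_complex_of_real trunc_weight_integral(2)[OF b d])
  finally show "(LBINT t. heat_potential \<beta> \<delta> (t::'e)) = \<delta> powr (- \<beta>) / \<beta>"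
    by (simp only: of_real_eq_iff)
qed

text \<open>Unlike the kernel of a Riesz potential, the power is not integrable at 0 for \<beta> >
  0: it belongs to the hypersingular integral of order \<beta> and is cut off sharply.\<close>

definition riesz_kernel :: "real \<Rightarrow> real \<Rightarrow> 'e::euclidean_space \<Rightarrow> real" where
  "riesz_kernel \<beta> \<eta> t = (if \<eta> \<le> norm t then norm t powr (- \<beta> - DIM('e)) else 0)"

lemma riesz_kernel_measurable [measurable]:
  assumes [measurable]: "f \<in> borel_measurable M" "g \<in> borel_measurable M"
  shows "(\<lambda>x. riesz_kernel \<beta> (f x) (g x)) \<in> borel_measurable M"
  unfolding riesz_kernel_def by measurable

lemma riesz_kernel_nonneg [simp]: "0 \<le> riesz_kernel \<beta> \<eta> t"
  by (simp add: riesz_kernel_def)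

lemma riesz_kernel_minus [simp]: "riesz_kernel \<beta> \<eta> (- t) = riesz_kernel \<beta> \<eta> t"
  by (simp add: riesz_kernel_def)

text \<open>For \<delta> = \<eta>^2 / 4 the argument |t|^2 / (4 \<delta>) of the incomplete Gamma
  function is at least 1 outside the ball. There the heat potential of order \<beta> / 2 dominates a
  multiple of the kernel, and its mass is known.\<close>

lemma riesz_kernel_integral:
  assumes b: "\<beta> > 0" and eps: "\<eta> > 0"
  shows "integrable lborel (riesz_kernel \<beta> \<eta> :: 'e::euclidean_space \<Rightarrow> real)"
    and "(LBINT t. riesz_kernel \<beta> \<eta> (t::'e)) \<le> 2 * 2 powr \<beta> / (\<beta> * potential_const TYPE('e) (\<beta> / 2)
       * lower_gamma (\<beta> / 2 + DIM('e) / 2) 1) * \<eta> powr (- \<beta>)"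
proof -
  define c where "c = potential_const TYPE('e) (\<beta> / 2) * lower_gamma (\<beta> / 2 + DIM('e) / 2) 1"
  define \<delta> where "\<delta> = \<eta>\<^sup>2 / 4"
  have b2: "\<beta> / 2 > 0" and p: "\<beta> / 2 + DIM('e) / 2 > 0" using b by (auto intro: add_pos_nonneg)
  have d: "\<delta> > 0" using eps by (simp add: \<delta>_def)
  have c: "c > 0" unfolding c_def by (intro mult_pos_pos potential_const_pos lower_gamma_1_pos p)
  have le: "riesz_kernel \<beta> \<eta> t \<le> heat_potential (\<beta> / 2) \<delta> t / c" for t :: 'e
  proof (cases "\<eta> \<le> norm t")
    case True
    hence t: "t \<noteq> 0" using eps by auto
    have "\<eta>\<^sup>2 \<le> (norm t)\<^sup>2" using True eps by (intro power_mono) auto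
    hence "1 \<le> (norm t)\<^sup>2 / (4 * \<delta>)" using eps by (simp add: \<delta>_def)
    hence "lower_gamma (\<beta> / 2 + DIM('e) / 2) 1 \<le> lower_gamma (\<beta> / 2 + DIM('e) / 2) ((norm t)\<^sup>2 / (4 * \<delta>))"
      by (rule lower_gamma_mono[OF p])
    hence "potential_const TYPE('e) (\<beta> / 2) * (norm t powr (- (2 * (\<beta> / 2)) - DIM('e)) * lower_gamma (\<beta> / 2 + DIM('e) / 2) 1)
       \<le> heat_potential (\<beta> / 2) \<delta> t"
      unfolding heat_potential_eq[OF b2 d t]
      by (intro mult_left_mono less_imp_le[OF potential_const_pos]) auto
    thus ?thesis using True c by (simp add: riesz_kernel_def c_def field_simps)
  qed (use c heat_potential_nonneg[of "\<beta> / 2" \<delta> t] in \<open>simp add: riesz_kernel_def\<close>)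
  note H = heat_potential_integral[OF b2 d, where 'e = 'e]
  have ic: "integrable lborel (\<lambda>t::'e. heat_potential (\<beta> / 2) \<delta> t / c)" using H(1) by simp
  show i: "integrable lborel (riesz_kernel \<beta> \<eta> :: 'e \<Rightarrow> real)"
  proof (rule integrable_dominated[OF ic])
    show "AE t in lborel. norm (riesz_kernel \<beta> \<eta> (t::'e)) \<le> norm (heat_potential (\<beta> / 2) \<delta> t / c)"
    proof (rule AE_I2)
      fix t :: 'e
      show "norm (riesz_kernel \<beta> \<eta> t) \<le> norm (heat_potential (\<beta> / 2) \<delta> t / c)"
        using order_trans[OF le[of t] abs_ge_self] by (simp del: abs_divide)
    qed
  qed measurable
  have "(LBINT t. riesz_kernel \<beta> \<eta> (t::'e)) \<le> (LBINT t. heat_potential (\<beta> / 2) \<delta> (t::'e) / c)"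
    by (rule integral_mono[OF i ic le])
  also have "\<dots> = \<delta> powr (- (\<beta> / 2)) / (\<beta> / 2) / c" by (simp add: H(2))
  also have "\<delta> powr (- (\<beta> / 2)) = 2 powr \<beta> * \<eta> powr (- \<beta>)"
  proof -
    have "\<delta> = (\<eta> / 2) powr 2" using eps by (simp add: \<delta>_def power_divide powr_numeral)
    hence "\<delta> powr (- (\<beta> / 2)) = (\<eta> / 2) powr (- \<beta>)" by (simp add: powr_powr)
    thus ?thesis using eps by (simp add: powr_divide powr_minus field_simps)
  qed
  finally show "(LBINT t. riesz_kernel \<beta> \<eta> (t::'e)) \<le> 2 * 2 powr \<beta> / (\<beta> * potential_const TYPE('e) (\<beta> / 2)
       * lower_gamma (\<beta> / 2 + DIM('e) / 2) 1) * \<eta> powr (- \<beta>)"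
    by (simp add: c_def mult_ac)
qed

text \<open>Bounds the mass of \<open>comparison_bound\<close>, the radius having cancelled: the
  first summand is the ball, the second the bound of \<open>riesz_kernel_integral\<close> at \<beta>
  = 2, left unsimplified so that it matches.\<close>

definition comparison_const :: "'e::euclidean_space itself \<Rightarrow> real \<Rightarrow> real \<Rightarrow> real" where
  "comparison_const TYPE('e) \<alpha> p = potential_const TYPE('e) \<alpha> * (unit_ball_vol DIM('e) / p +
     Gamma (p + 1) * (2 * 2 powr 2 / (2 * potential_const TYPE('e) (2 / 2) * lower_gamma (2 / 2 + DIM('e) / 2) 1)))"

section \<open>Comparison of sharp and smooth hypersingular integrals\<close>

context bessel_potential
begin

abbreviation "heat_hypersingular \<delta> \<equiv>
  (LBINT s. of_real (trunc_weight \<alpha> \<delta> s) * (frac_mean \<alpha> profile s - frac_mean \<alpha> profile 0))"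

abbreviation "riesz_hypersingular \<eta> \<equiv> (LBINT t. of_real (riesz_kernel (2 * \<alpha>) \<eta> t) * (v t - v 0))"

lemma v_difference_bound: "cmod (v t - v 0) \<le> 2 * C"
  using norm_triangle_ineq4[of "v t" "v 0"] V.bound[of t] V.bound[of 0] by linarith

lemma mult_v_difference_integrable:
  assumes "integrable lborel f"
  shows "integrable lborel (\<lambda>t. complex_of_real (f t) * (v t - v 0))"
  using v_difference_bound
  by (intro integrable_mult_bounded(1)[where B = "2 * C"] integrable_of_real assms) auto

text \<open>Because heat kernels have mass 1, v 0 can be moved under the spatial integral; Fubini
  then collects the kernels over s into the heat potential.\<close>

lemma heat_hypersingular_eq:
  assumes d: "\<delta> > 0"
  shows "heat_hypersingular \<delta> = (LBINT t. of_real (heat_potential \<alpha> \<delta> t) * (v t - v 0))"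
proof -
  have w: "integrable lborel (\<lambda>s. complex_of_real (trunc_weight \<alpha> \<delta> s))"
    using trunc_weight_integral(1)[OF alpha(1) d] by simp
  have pos: "s > 0" if "complex_of_real (trunc_weight \<alpha> \<delta> s) \<noteq> 0" for s
    using that d by (auto simp: trunc_weight_def split: if_splits)
  have m: "(\<lambda>(s, t). complex_of_real (heat s t) * (v t - v 0)) \<in> borel_measurable (lborel \<Otimes>\<^sub>M lborel)" by measurable
  have "heat_hypersingular \<delta> = (LBINT s. of_real (trunc_weight \<alpha> \<delta> s) * (LBINT t. of_real (heat s t) * (v t - v 0)))"
  proof (rule lint_cong[OF refl])
    fix s
    show "of_real (trunc_weight \<alpha> \<delta> s) * (frac_mean \<alpha> profile s - frac_mean \<alpha> profile 0) =
       of_real (trunc_weight \<alpha> \<delta> s) * (LBINT t. of_real (heat s t) * (v t - v 0))"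
      using pos[of s] heat_difference_integrable(3)[of s] by (cases "trunc_weight \<alpha> \<delta> s = 0") auto
  qed
  also have "\<dots> = (LBINT t. (LBINT s. of_real (trunc_weight \<alpha> \<delta> s) * (of_real (heat s t) * (v t - v 0))))"
    by (rule Fubini_kernel(1)[OF w m heat_difference_integrable(1) heat_difference_integrable(2)[OF pos]])
  also have "(\<lambda>t. LBINT s. of_real (trunc_weight \<alpha> \<delta> s) * (of_real (heat s t) * (v t - v 0)))
    = (\<lambda>t. of_real (heat_potential \<alpha> \<delta> t) * (v t - v 0))"
  proof
    fix t
    have "(LBINT s. of_real (trunc_weight \<alpha> \<delta> s) * (of_real (heat s t) * (v t - v 0)))
      = (LBINT s. complex_of_real (trunc_weight \<alpha> \<delta> s * heat s t)) * (v t - v 0)"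
      by (simp only: of_real_mult mult.assoc flip: integral_mult_left_zero)
    thus "(LBINT s. of_real (trunc_weight \<alpha> \<delta> s) * (of_real (heat s t) * (v t - v 0)))
       = of_real (heat_potential \<alpha> \<delta> t) * (v t - v 0)"
      by (simp only: integral_complex_of_real heat_potential_def)
  qed
  finally show ?thesis .
qed

lemma p_pos: "0 < p"
  unfolding p_eq using alpha by (intro add_pos_nonneg) auto

text \<open>The heat potential is \<open>|t|\<^bsup>-2\<alpha>-d\<^esup>\<close> times an increasing function of \<open>|t|\<close>, hence a superposition
  of sharply truncated kernels.\<close>

lemma heat_potential_average:
  fixes t :: 'e
  assumes d: "\<delta> > 0" and t: "t \<noteq> 0"
  shows "integrable lborel (\<lambda>y. Gamma p * gamma_density p y * riesz_kernel (2 * \<alpha>) (2 * sqrt (\<delta> * y)) t)"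
    and "heat_potential \<alpha> \<delta> t = potential_const TYPE('e) \<alpha> *
       (LBINT y. Gamma p * gamma_density p y * riesz_kernel (2 * \<alpha>) (2 * sqrt (\<delta> * y)) t)"
proof -
  have e: "Gamma p * gamma_density p y * riesz_kernel (2 * \<alpha>) (2 * sqrt (\<delta> * y)) t =
    norm t powr (- (2 * \<alpha>) - DIM('e)) * (if y \<le> (norm t)\<^sup>2 / (4 * \<delta>) then Gamma p * gamma_density p y else 0)" for y
  proof (cases "y > 0")
    case True
    have "2 * sqrt (\<delta> * y) \<le> norm t \<longleftrightarrow> (2 * sqrt (\<delta> * y))\<^sup>2 \<le> (norm t)\<^sup>2"
      using True d by (intro power_mono_iff[symmetric]) auto
    also have "(2 * sqrt (\<delta> * y))\<^sup>2 = 4 * \<delta> * y"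
      using True d by (simp add: power_mult_distrib)
    also have "\<dots> \<le> (norm t)\<^sup>2 \<longleftrightarrow> y \<le> (norm t)\<^sup>2 / (4 * \<delta>)"
      using d by (simp add: field_simps)
    finally show ?thesis by (simp add: riesz_kernel_def)
  qed (simp add: gamma_density_def)
  show "integrable lborel (\<lambda>y. Gamma p * gamma_density p y * riesz_kernel (2 * \<alpha>) (2 * sqrt (\<delta> * y)) t)"
    unfolding e by (intro integrable_mult_right lower_gamma_integrable p_pos)
  show "heat_potential \<alpha> \<delta> t = potential_const TYPE('e) \<alpha> *
       (LBINT y. Gamma p * gamma_density p y * riesz_kernel (2 * \<alpha>) (2 * sqrt (\<delta> * y)) t)"
    unfolding e heat_potential_eq[OF alpha(1) d t] p_eq[symmetric] integral_mult_right_zero lower_gamma_def ..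
qed

text \<open>The smooth kernel is a mixture of sharp ones of total weight
  \<open>potential_const TYPE('e) \<alpha> * Gamma p\<close>, so by Fubini the smooth integral is
  the same mixture of the sharp integrals.\<close>

lemma heat_hypersingular_le:
  assumes d: "\<delta> > 0" and X: "\<And>\<eta>. \<eta> > 0 \<Longrightarrow> cmod (riesz_hypersingular \<eta>) \<le> X"
  shows "cmod (heat_hypersingular \<delta>) \<le> potential_const TYPE('e) \<alpha> * Gamma p * X"
proof -
  let ?c = "potential_const TYPE('e) \<alpha>"
  let ?k = "\<lambda>y t. Gamma p * gamma_density p y * riesz_kernel (2 * \<alpha>) (2 * sqrt (\<delta> * y)) t"
  let ?F = "\<lambda>t y. complex_of_real (?k y t) * (v t - v 0)"
  have G: "Gamma p > 0" by (rule Gamma_real_pos[OF p_pos])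
  have gn: "gamma_density p y \<ge> 0" for y by (rule gamma_density_nonneg[OF p_pos])
  \<comment> \<open>The averaging formula is stated for t \<noteq> 0; at t = 0 the factor v t - v 0
    vanishes.\<close>
  have iF: "integrable lborel (?F t)" for t
  proof (cases "t = 0")
    case False
    show ?thesis by (intro integrable_mult_left integrable_of_real heat_potential_average(1)[OF d False])
  qed simp
  have eF: "of_real ?c * (LBINT y. ?F t y) = of_real (heat_potential \<alpha> \<delta> t) * (v t - v 0)" for t
  proof (cases "t = 0")
    case False
    have "(LBINT y. ?F t y) = of_real (LBINT y. ?k y t) * (v t - v 0)"
      by (simp only: integral_mult_left_zero integral_complex_of_real)
    thus ?thesis by (simp only: heat_potential_average(2)[OF d False] of_real_mult mult.assoc)
  qed simp
  \<comment> \<open>Exact since the weights are nonnegative. It reduces the Fubini condition to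
    integrability of the heat potential times a bounded function.\<close>
  have nF: "(LBINT y. cmod (?F t y)) = cmod (of_real (heat_potential \<alpha> \<delta> t) * (v t - v 0)) / ?c" for t
  proof (cases "t = 0")
    case False
    have "cmod (?F t y) = ?k y t * cmod (v t - v 0)" for y
      using G gn[of y] by (simp add: norm_mult abs_mult)
    hence "(LBINT y. cmod (?F t y)) = (LBINT y. ?k y t) * cmod (v t - v 0)"
      by (simp only: integral_mult_left_zero)
    moreover have "cmod (of_real (heat_potential \<alpha> \<delta> t) * (v t - v 0)) = heat_potential \<alpha> \<delta> t * cmod (v t - v 0)"
      by (simp add: norm_mult heat_potential_nonneg)
    ultimately show ?thesis
      using potential_const_pos[of \<alpha>, where 'e = 'e] by (simp only: heat_potential_average(2)[OF d False]) simp
  qed simp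
  have prod: "integrable (lborel \<Otimes>\<^sub>M lborel) (\<lambda>(t, y). ?F t y)"
  proof (rule lborel_pair.Fubini_integrable)
    show "(\<lambda>(t, y). ?F t y) \<in> borel_measurable (lborel \<Otimes>\<^sub>M lborel)" by measurable
    show "integrable lborel (\<lambda>t. LBINT y. norm (case (t, y) of (t, y) \<Rightarrow> ?F t y))"
      unfolding prod.case nF
      by (intro integrable_divide integrable_norm mult_v_difference_integrable heat_potential_integral(1) alpha d)
    show "AE t in lborel. integrable lborel (\<lambda>y. case (t, y) of (t, y) \<Rightarrow> ?F t y)"
      unfolding prod.case by (intro AE_I2 iF)
  qed
  have "heat_hypersingular \<delta> = of_real ?c * (LBINT t. (LBINT y. ?F t y))"
    unfolding heat_hypersingular_eq[OF d] eF[symmetric] integral_mult_right_zero ..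
  also have "(LBINT t. (LBINT y. ?F t y)) = (LBINT y. (LBINT t. ?F t y))"
    by (rule lborel_pair.Fubini_integral[OF prod, symmetric])
  also have "cmod (of_real ?c * \<dots>) = ?c * cmod (LBINT y. (LBINT t. ?F t y))"
    using potential_const_pos[of \<alpha>, where 'e = 'e] by (simp add: norm_mult)
  also have "\<dots> \<le> ?c * (LBINT y. Gamma p * gamma_density p y * X)"
  proof (intro mult_left_mono less_imp_le[OF potential_const_pos] cmod_integral_le)
    show "integrable lborel (\<lambda>y. Gamma p * gamma_density p y * X)"
      using gamma_density_integral(1)[OF p_pos] by simp
    fix y
    have "?F t y = of_real (Gamma p * gamma_density p y) * (of_real (riesz_kernel (2 * \<alpha>) (2 * sqrt (\<delta> * y)) t) * (v t - v 0))" for t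
      by simp
    hence "(LBINT t. ?F t y) = of_real (Gamma p * gamma_density p y) * riesz_hypersingular (2 * sqrt (\<delta> * y))"
      by (simp only: integral_mult_right_zero)
    hence "cmod (LBINT t. ?F t y) = Gamma p * gamma_density p y * cmod (riesz_hypersingular (2 * sqrt (\<delta> * y)))"
      using G gn[of y] by (simp only: norm_mult norm_of_real abs_mult abs_of_pos abs_of_nonneg)
    also have "\<dots> \<le> Gamma p * gamma_density p y * X"
    proof (cases "y > 0")
      case True
      thus ?thesis using G gn d by (intro mult_left_mono X) auto
    qed (simp add: gamma_density_def)
    finally show "cmod (LBINT t. ?F t y) \<le> Gamma p * gamma_density p y * X" .
  qed
  also have "(LBINT y. Gamma p * gamma_density p y * X) = Gamma p * X"
    by (simp add: gamma_density_integral(2)[OF p_pos])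
  finally show ?thesis by (simp add: mult.assoc)
qed

text \<open>Reflection of t leaves the even weight unchanged, so averaging the integral with its
  reflection replaces first differences by second ones.\<close>

lemma integral_symmetrize:
  fixes D :: "'e \<Rightarrow> real"
  assumes D: "integrable lborel D" "\<And>t. D (- t) = D t"
  shows "(LBINT t. of_real (D t) * (v t - v 0)) = (LBINT t. of_real (D t) * (v t + v (- t) - 2 * v 0)) / 2"
proof -
  note i = mult_v_difference_integrable[OF D(1)]
  have i2: "integrable lborel (\<lambda>t. of_real (D t) * (v (- t) - v 0))"
    and e: "(LBINT t. of_real (D t) * (v (- t) - v 0)) = (LBINT t. of_real (D t) * (v t - v 0))"
    using lborel_affine_integral[of "-1" "\<lambda>t. of_real (D t) * (v t - v 0)" 0] i by (simp_all add: D(2))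
  have "(LBINT t. of_real (D t) * (v t + v (- t) - 2 * v 0)) =
     (LBINT t. of_real (D t) * (v t - v 0) + of_real (D t) * (v (- t) - v 0))"
    by (intro lint_cong refl) (simp add: algebra_simps)
  also have "\<dots> = 2 * (LBINT t. of_real (D t) * (v t - v 0))"
    unfolding lint_add[OF i i2] e by simp
  finally show ?thesis by simp
qed

text \<open>A majorant of |t|^(2 \<alpha>) times the difference of the scaled sharp kernel and the
  smooth kernel. The masses of both summands are bounded independently of \<eta>, which gives
  uniformity in the radius.\<close>

definition comparison_bound :: "real \<Rightarrow> 'e \<Rightarrow> real" where
  "comparison_bound \<eta> t = potential_const TYPE('e) \<alpha> *
     (\<eta> powr (- real DIM('e)) / p * indicator (ball 0 \<eta>) t + Gamma (p + 1) * \<eta>\<^sup>2 * riesz_kernel 2 \<eta> t)"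

lemma comparison_bound_integral:
  assumes eps: "\<eta> > 0"
  shows "integrable lborel (comparison_bound \<eta>)" "(LBINT t. comparison_bound \<eta> t) \<le> comparison_const TYPE('e) \<alpha> p"
proof -
  have two: "(2::real) > 0" by simp
  note R = riesz_kernel_integral[OF two eps, where 'e = 'e]
  have ib: "integrable lborel (indicator (ball (0::'e) \<eta>) :: 'e \<Rightarrow> real)"
    by (intro integrable_real_indicator emeasure_bounded_finite) auto
  have lb: "(LBINT t. indicator (ball (0::'e) \<eta>) t) = unit_ball_vol DIM('e) * \<eta> ^ DIM('e)"
    using content_ball[of \<eta> "0::'e"] eps by simp
  note i = integrable_plus[OF integrable_mult_right[OF ib] integrable_mult_right[OF R(1)]]
  show "integrable lborel (comparison_bound \<eta>)"
    unfolding comparison_bound_def by (intro integrable_mult_right i)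
  have "(LBINT t. comparison_bound \<eta> t) = potential_const TYPE('e) \<alpha> *
     (\<eta> powr (- real DIM('e)) / p * (unit_ball_vol DIM('e) * \<eta> ^ DIM('e)) +
      Gamma (p + 1) * \<eta>\<^sup>2 * (LBINT t. riesz_kernel 2 \<eta> (t::'e)))"
    unfolding comparison_bound_def integral_mult_right_zero
      lint_add[OF integrable_mult_right[OF ib] integrable_mult_right[OF R(1)]] lb ..
  also have "\<dots> \<le> comparison_const TYPE('e) \<alpha> p"
    unfolding comparison_const_def
  proof (intro mult_left_mono add_mono less_imp_le[OF potential_const_pos])
    show "\<eta> powr (- real DIM('e)) / p * (unit_ball_vol DIM('e) * \<eta> ^ DIM('e)) \<le> unit_ball_vol DIM('e) / p"
    proof -
      have "\<eta> powr (- real DIM('e)) * \<eta> ^ DIM('e) = 1" using eps by (simp add: powr_minus powr_realpow)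
      moreover have "x / p * (y * z) = x * z * y / p" for x y z :: real by simp
      ultimately have "\<eta> powr (- real DIM('e)) / p * (unit_ball_vol DIM('e) * \<eta> ^ DIM('e)) = 1 * unit_ball_vol DIM('e) / p"
        by (simp only:)
      thus ?thesis by (simp only: mult_1_left order_refl)
    qed
    let ?K = "2 * 2 powr 2 / (2 * potential_const TYPE('e) (2 / 2) * lower_gamma (2 / 2 + DIM('e) / 2) 1)"
    have "Gamma (p + 1) * \<eta>\<^sup>2 * (LBINT t. riesz_kernel 2 \<eta> (t::'e)) \<le> Gamma (p + 1) * \<eta>\<^sup>2 * (?K * \<eta> powr (- 2))"
      using R(2) p_pos Gamma_real_pos[of "p + 1"] by (intro mult_left_mono) auto
    also have "\<dots> = Gamma (p + 1) * ?K * (\<eta>\<^sup>2 * \<eta> powr (- 2))" by (simp only: mult_ac)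
    also have "\<eta>\<^sup>2 * \<eta> powr (- 2) = 1" using eps by (simp add: powr_minus powr_numeral)
    finally show "Gamma (p + 1) * \<eta>\<^sup>2 * (LBINT t. riesz_kernel 2 \<eta> (t::'e)) \<le> Gamma (p + 1) * ?K" by simp
  qed
  finally show "(LBINT t. comparison_bound \<eta> t) \<le> comparison_const TYPE('e) \<alpha> p" .
qed

text \<open>The difference of the two kernels is even, which brings in the second difference of \<open>v\<close>; this is
  why \<open>\<alpha> < 1\<close> suffices.\<close>

lemma riesz_heat_comparison:
  assumes eps: "\<eta> > 0"
  shows "cmod (of_real (potential_const TYPE('e) \<alpha> * Gamma p) * riesz_hypersingular \<eta> - heat_hypersingular (\<eta>\<^sup>2 / 4))
    \<le> (4 / \<alpha> + 1 / (1 - \<alpha>)) / Gamma \<alpha> * comparison_const TYPE('e) \<alpha> p / 2 * B"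
proof -
  let ?c = "potential_const TYPE('e) \<alpha>" and ?K = "(4 / \<alpha> + 1 / (1 - \<alpha>)) / Gamma \<alpha>"
  have c: "?c > 0" by (rule potential_const_pos)
  \<comment> \<open>With \<delta> = \<eta>^2 / 4 the incomplete Gamma function has argument |t|^2 /
    \<eta>^2, so both truncations act at radius \<eta>.\<close>
  have d: "\<eta>\<^sup>2 / 4 > 0" using eps by simp
  define D where "D t = ?c * Gamma p * riesz_kernel (2 * \<alpha>) \<eta> t - heat_potential \<alpha> (\<eta>\<^sup>2 / 4) t" for t :: 'e
  have a2: "2 * \<alpha> > 0" using alpha by simp
  note R = riesz_kernel_integral(1)[OF a2 eps, where 'e = 'e]
  note H = heat_potential_integral(1)[OF alpha(1) d, where 'e = 'e]
  have iD: "integrable lborel D" unfolding D_def using R H by simp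
  have symm: "D (- t) = D t" for t by (simp add: D_def heat_potential_def)
  have le: "\<bar>D t\<bar> * norm t powr (2 * \<alpha>) \<le> comparison_bound \<eta> t" if t: "t \<noteq> 0" for t
  proof -
    define X where "X = (norm t)\<^sup>2 / \<eta>\<^sup>2"
    have X: "X > 0" using t eps by (simp add: X_def)
    have hp: "heat_potential \<alpha> (\<eta>\<^sup>2 / 4) t = ?c * (norm t powr (- (2 * \<alpha>) - DIM('e)) * lower_gamma p X)"
      unfolding heat_potential_eq[OF alpha(1) d t] p_eq[symmetric] X_def by simp
    have pw: "norm t powr (- (2 * \<alpha>) - DIM('e)) * norm t powr (2 * \<alpha>) = norm t powr (- real DIM('e))"
      by (simp flip: powr_add)
    \<comment> \<open>Outside the radius the leading terms cancel and the Gamma tail supplies the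
      decay \<eta>^2 / |t|^2. Inside, only the smooth kernel is present, and the bound X^p / p
      removes its singularity.\<close>
    show ?thesis
    proof (cases "\<eta> \<le> norm t")
      case True
      have "D t = ?c * (norm t powr (- (2 * \<alpha>) - DIM('e)) * (Gamma p - lower_gamma p X))"
        using True by (simp add: D_def hp riesz_kernel_def algebra_simps)
      hence "\<bar>D t\<bar> * norm t powr (2 * \<alpha>) = ?c * (norm t powr (- real DIM('e)) * \<bar>Gamma p - lower_gamma p X\<bar>)"
        using c by (simp add: abs_mult pw[symmetric])
      also have "\<dots> \<le> ?c * (norm t powr (- real DIM('e)) * (Gamma (p + 1) / X))"
        using c by (intro mult_left_mono lower_gamma_tail p_pos X) auto
      also have "norm t powr (- real DIM('e)) * (Gamma (p + 1) / X) = Gamma (p + 1) * \<eta>\<^sup>2 * riesz_kernel 2 \<eta> t"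
        using True t by (simp add: X_def riesz_kernel_def powr_diff powr_minus powr_numeral field_simps)
      finally show ?thesis using True by (simp add: comparison_bound_def)
    next
      case False
      have "D t = - (?c * (norm t powr (- (2 * \<alpha>) - DIM('e)) * lower_gamma p X))"
        using False by (simp add: D_def hp riesz_kernel_def)
      hence "\<bar>D t\<bar> * norm t powr (2 * \<alpha>) = ?c * (norm t powr (- real DIM('e)) * lower_gamma p X)"
        using c lower_gamma_nonneg[OF p_pos, of X] by (simp add: abs_mult pw[symmetric])
      also have "\<dots> \<le> ?c * (norm t powr (- real DIM('e)) * (X powr p / p))"
        using c X by (intro mult_left_mono lower_gamma_le p_pos) auto
      also have "X powr p = norm t powr (2 * p) * \<eta> powr (- (2 * p))"
      proof -
        have "X = (norm t / \<eta>) powr 2" using t eps by (simp add: X_def power_divide powr_numeral)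
        hence "X powr p = (norm t / \<eta>) powr (2 * p)" by (simp only: powr_powr)
        thus ?thesis using eps t by (simp add: powr_divide powr_minus_divide)
      qed
      also have "norm t powr (- real DIM('e)) * (norm t powr (2 * p) * \<eta> powr (- (2 * p)) / p) =
         norm t powr (2 * \<alpha>) * \<eta> powr (- (2 * p)) / p"
      proof -
        have "norm t powr (- real DIM('e)) * norm t powr (2 * p) = norm t powr (2 * \<alpha>)"
          by (simp add: p_eq algebra_simps flip: powr_add)
        moreover have "x * (y * z / p) = x * y * z / p" for x y z :: real by simp
        ultimately show ?thesis by (simp only:)
      qed
      also have "?c * \<dots> \<le> ?c * (\<eta> powr (2 * \<alpha>) * \<eta> powr (- (2 * p)) / p)"
        using False c p_pos alpha by (intro mult_left_mono divide_right_mono mult_right_mono powr_mono2) auto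
      also have "\<eta> powr (2 * \<alpha>) * \<eta> powr (- (2 * p)) = \<eta> powr (- real DIM('e))"
        by (simp add: p_eq algebra_simps flip: powr_add)
      finally show ?thesis using False by (simp add: comparison_bound_def riesz_kernel_def)
    qed
  qed
  have "of_real (?c * Gamma p) * riesz_hypersingular \<eta> - heat_hypersingular (\<eta>\<^sup>2 / 4)
    = (LBINT t. of_real (?c * Gamma p) * (of_real (riesz_kernel (2 * \<alpha>) \<eta> t) * (v t - v 0)) - of_real (heat_potential \<alpha> (\<eta>\<^sup>2 / 4) t) * (v t - v 0))"
    unfolding heat_hypersingular_eq[OF d] integral_mult_right_zero[symmetric]
    by (intro lint_diff[symmetric] integrable_mult_right mult_v_difference_integrable R H)
  also have "\<dots> = (LBINT t. of_real (D t) * (v t - v 0))"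
    by (intro lint_cong refl) (simp add: D_def algebra_simps)
  also have "\<dots> = (LBINT t. of_real (D t) * (v t + v (- t) - 2 * v 0)) / 2"
    by (rule integral_symmetrize[OF iD symm])
  also have "cmod \<dots> \<le> (LBINT t. ?K * B * comparison_bound \<eta> t) / 2"
  proof -
    have "cmod (LBINT t. of_real (D t) * (v t + v (- t) - 2 * v 0)) \<le> (LBINT t. ?K * B * comparison_bound \<eta> t)"
    proof (rule cmod_integral_le)
      show "integrable lborel (\<lambda>t. ?K * B * comparison_bound \<eta> t)"
        by (intro integrable_mult_right comparison_bound_integral eps)
      have K: "?K * B \<ge> 0" using alpha U.B_nonneg Gamma_real_pos[OF alpha(1)] by (auto intro!: mult_nonneg_nonneg divide_nonneg_pos add_nonneg_nonneg)
      fix t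
      show "cmod (of_real (D t) * (v t + v (- t) - 2 * v 0)) \<le> ?K * B * comparison_bound \<eta> t"
      proof (cases "t = 0")
        case True
        have "0 \<le> comparison_bound \<eta> t"
          using c p_pos Gamma_real_pos[of "p + 1"] by (auto simp: comparison_bound_def intro!: mult_nonneg_nonneg add_nonneg_nonneg)
        hence "0 \<le> ?K * B * comparison_bound \<eta> t" by (rule mult_nonneg_nonneg[OF K])
        thus ?thesis using True by simp
      next
        case False
        have "cmod (of_real (D t) * (v t + v (- t) - 2 * v 0)) \<le> \<bar>D t\<bar> * (?K * B * norm t powr (2 * \<alpha>))"
          unfolding norm_mult norm_of_real by (intro mult_left_mono v_second_difference) auto
        also have "\<dots> = ?K * B * (\<bar>D t\<bar> * norm t powr (2 * \<alpha>))" by (simp only: mult_ac)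
        also have "\<dots> \<le> ?K * B * comparison_bound \<eta> t" by (intro mult_left_mono le False K)
        finally show ?thesis .
      qed
    qed
    thus ?thesis by (simp add: norm_divide)
  qed
  also have "\<dots> \<le> ?K * B * comparison_const TYPE('e) \<alpha> p / 2"
    using alpha U.B_nonneg Gamma_real_pos[OF alpha(1)] comparison_bound_integral(2)[OF eps]
    unfolding integral_mult_right_zero
    by (intro divide_right_mono mult_left_mono) (auto intro!: mult_nonneg_nonneg divide_nonneg_pos add_nonneg_nonneg)
  finally show ?thesis by (simp add: mult_ac)
qed

end

section \<open>The scalar equivalence\<close>

definition marchaud_const :: "real \<Rightarrow> real" where
  "marchaud_const \<alpha> = (LBINT x. marchaud_kernel \<alpha> x) / (\<alpha> * Gamma \<alpha>)"

definition correction_const :: "real \<Rightarrow> real" where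
  "correction_const \<alpha> = (LBINT s. (if 0 < s then s powr (- 1 - \<alpha>) * (1 - exp (- s)) else 0))"

lemma marchaud_const_pos: "0 < \<alpha> \<Longrightarrow> \<alpha> < 1 \<Longrightarrow> 0 < marchaud_const \<alpha>"
  unfolding marchaud_const_def using marchaud_kernel_integral_pos Gamma_real_pos
  by (intro divide_pos_pos mult_pos_pos) auto

context bessel_potential
begin

abbreviation "marchaud_difference \<delta> \<equiv>
  (LBINT s. of_real (trunc_weight \<alpha> \<delta> s) * (frac_mean \<alpha> profile 0 - of_real (exp (- s)) * frac_mean \<alpha> profile s))"

lemma profile_bound: "0 < s \<Longrightarrow> cmod (profile s) \<le> B"
  by (rule U.heat_mean_bound)

lemma heat_marchaud_comparison:
  assumes d: "\<delta> > 0" and D: "\<And>s. 0 < s \<Longrightarrow> cmod (frac_mean \<alpha> profile s) \<le> D"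
  shows "cmod (heat_hypersingular \<delta> + marchaud_difference \<delta>) \<le> correction_const \<alpha> * D"
  unfolding correction_const_def
  by (rule trunc_weight_correction(2)[OF alpha U.heat_mean_measurable profile_bound d D])

text \<open>At \<delta> = \<eta>^2 / 4 the sharp integral, the smooth one and the Marchaud
  derivative are linked, each link costing a multiple of \<open>B\<close>. The heat means of v are
  bounded by \<open>B\<close> as Gamma averages of those of u.\<close>

lemma riesz_hypersingular_bound:
  assumes eps: "\<eta> > 0"
  shows "potential_const TYPE('e) \<alpha> * Gamma p * cmod (riesz_hypersingular \<eta>)
    \<le> (marchaud_const \<alpha> + correction_const \<alpha> + (4 / \<alpha> + 1 / (1 - \<alpha>)) / Gamma \<alpha> * comparison_const TYPE('e) \<alpha> p / 2) * B"
proof -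
  let ?c = "potential_const TYPE('e) \<alpha> * Gamma p"
  have c: "?c > 0" by (intro mult_pos_pos potential_const_pos Gamma_real_pos p_pos)
  have d: "\<eta>\<^sup>2 / 4 > 0" using eps by simp
  have "cmod (frac_mean \<alpha> profile s) \<le> B" if "0 < s" for s
    by (rule frac_mean_integrable(3)[OF alpha U.heat_mean_measurable profile_bound]) (use that in auto)
  hence h1: "cmod (heat_hypersingular (\<eta>\<^sup>2 / 4) + marchaud_difference (\<eta>\<^sup>2 / 4)) \<le> correction_const \<alpha> * B"
    by (rule heat_marchaud_comparison[OF d])
  have h2: "cmod (marchaud_difference (\<eta>\<^sup>2 / 4)) \<le> marchaud_const \<alpha> * B"
    unfolding marchaud_const_def by (rule marchaud_bound[OF alpha U.heat_mean_measurable profile_bound d])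
  note h3 = riesz_heat_comparison[OF eps]
  have "?c * cmod (riesz_hypersingular \<eta>) = cmod (of_real ?c * riesz_hypersingular \<eta>)"
    using c by (simp only: norm_mult norm_of_real abs_of_pos)
  also have "\<dots> \<le> cmod (of_real ?c * riesz_hypersingular \<eta> - heat_hypersingular (\<eta>\<^sup>2 / 4))
      + cmod (heat_hypersingular (\<eta>\<^sup>2 / 4) + marchaud_difference (\<eta>\<^sup>2 / 4)) + cmod (marchaud_difference (\<eta>\<^sup>2 / 4))"
    by norm
  finally show ?thesis using h1 h2 h3 by (simp only: distrib_right)
qed

text \<open>As \<delta> tends to 0 the Marchaud derivative tends to a positive multiple of u 0,
  while all bounds are uniform in \<delta>. The correction is charged to \<open>C\<close>, since u
  is what has to be estimated.\<close>

lemma value_le_hypersingular: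
  assumes X: "\<And>\<eta>. \<eta> > 0 \<Longrightarrow> cmod (riesz_hypersingular \<eta>) \<le> X"
  shows "marchaud_const \<alpha> * cmod (u 0) \<le> potential_const TYPE('e) \<alpha> * Gamma p * X + correction_const \<alpha> * C"
proof -
  have l: "(\<lambda>n. marchaud_difference (1 / real (Suc n))) \<longlonglongrightarrow> of_real (marchaud_const \<alpha>) * u 0"
    unfolding marchaud_const_def
    by (rule marchaud_limit[OF alpha U.heat_mean_measurable profile_bound U.heat_mean_tendsto])
  have "cmod (frac_mean \<alpha> profile s) \<le> C" if "0 < s" for s
    using V.heat_mean_bound[OF that, of 0] heat_mean_v[OF that] by simp
  note h1 = heat_marchaud_comparison[OF _ this]
  have "cmod (marchaud_difference \<delta>) \<le> potential_const TYPE('e) \<alpha> * Gamma p * X + correction_const \<alpha> * C" if d: "\<delta> > 0" for \<delta>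
  proof -
    have "cmod (marchaud_difference \<delta>) \<le> cmod (heat_hypersingular \<delta> + marchaud_difference \<delta>) + cmod (heat_hypersingular \<delta>)"
      by norm
    thus ?thesis using h1[OF d] heat_hypersingular_le[OF d X] by linarith
  qed
  hence "cmod (of_real (marchaud_const \<alpha>) * u 0) \<le> potential_const TYPE('e) \<alpha> * Gamma p * X + correction_const \<alpha> * C"
    by (intro Lim_bounded[OF tendsto_norm[OF l], of 0] allI impI) (simp del: of_nat_Suc)
  thus ?thesis using marchaud_const_pos[OF alpha] by (simp add: norm_mult)
qed

end

text \<open>\<open>K\<close> precedes the functions and their bounds, which makes it uniform over
  functionals. Upper bounds \<open>X\<close> take the place of a supremum whose finiteness would
  have to be known.\<close>

theorem hypersingular_equivalence:
  assumes alpha: "0 < \<alpha>" "\<alpha> < 1"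
  shows "\<exists>K>0. \<forall>(u :: 'e::euclidean_space \<Rightarrow> complex) v B C. bessel_potential u v B C \<alpha> (\<alpha> + DIM('e) / 2) \<longrightarrow>
     (\<forall>\<eta>>0. cmod (LBINT t. of_real (riesz_kernel (2 * \<alpha>) \<eta> t) * (v t - v 0)) \<le> K * B) \<and>
     (\<forall>X. (\<forall>\<eta>>0. cmod (LBINT t. of_real (riesz_kernel (2 * \<alpha>) \<eta> t) * (v t - v 0)) \<le> X) \<longrightarrow>
       cmod (u 0) \<le> K * (X + C))"
proof -
  define p where "p = \<alpha> + DIM('e) / 2"
  define c where "c = potential_const TYPE('e) \<alpha> * Gamma p"
  define q where "q = marchaud_const \<alpha> + correction_const \<alpha> + (4 / \<alpha> + 1 / (1 - \<alpha>)) / Gamma \<alpha> * comparison_const TYPE('e) \<alpha> p / 2"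
  have p: "p > 0" unfolding p_def using alpha by (intro add_pos_nonneg) auto
  define m w where "m = marchaud_const \<alpha>" and "w = correction_const \<alpha>"
  have m: "m > 0" using alpha by (simp add: m_def marchaud_const_pos)
  have c: "c > 0" unfolding c_def by (intro mult_pos_pos potential_const_pos Gamma_real_pos p)
  \<comment> \<open>The first entry serves the upper estimate, the other two are the coefficients of
    X and C in the lower one. The absolute value avoids discussing the sign of
    \<open>q\<close>.\<close>
  define K where "K = max (\<bar>q\<bar> / c) (max (c / m) (w / m))"
  show ?thesis
  proof (intro exI[of _ K] conjI allI impI)
    show "K > 0" unfolding K_def using c m by (simp add: less_max_iff_disj)
  next
    fix u v :: "'e \<Rightarrow> complex" and B C \<eta> :: real
    assume bp: "bessel_potential u v B C \<alpha> (\<alpha> + DIM('e) / 2)" and eps: "0 < \<eta>"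
    interpret bessel_potential u v B C \<alpha> p using bp by (simp add: p_def)
    have "c * cmod (riesz_hypersingular \<eta>) \<le> q * B"
      using riesz_hypersingular_bound[OF eps] by (simp only: c_def q_def)
    also have "\<dots> \<le> \<bar>q\<bar> * B" using U.B_nonneg by (intro mult_right_mono) auto
    finally have "cmod (riesz_hypersingular \<eta>) \<le> \<bar>q\<bar> / c * B" using c by (simp add: field_simps)
    also have "\<dots> \<le> K * B" using U.B_nonneg by (intro mult_right_mono) (auto simp: K_def)
    finally show "cmod (riesz_hypersingular \<eta>) \<le> K * B" .
  next
    fix u v :: "'e \<Rightarrow> complex" and B C X :: real
    assume bp: "bessel_potential u v B C \<alpha> (\<alpha> + DIM('e) / 2)"
    interpret bessel_potential u v B C \<alpha> p using bp by (simp add: p_def)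
    assume "\<forall>\<eta>>0. cmod (riesz_hypersingular \<eta>) \<le> X"
    hence X: "\<And>\<eta>. \<eta> > 0 \<Longrightarrow> cmod (riesz_hypersingular \<eta>) \<le> X" by blast
    have X0: "0 \<le> X" using X[of 1] norm_ge_zero order_trans zero_less_one by blast
    have "m * cmod (u 0) \<le> c * X + w * C"
      using value_le_hypersingular[OF X] by (simp only: c_def m_def w_def)
    hence "cmod (u 0) \<le> c / m * X + w / m * C" using m by (simp add: field_simps)
    also have "\<dots> \<le> K * X + K * C"
      using X0 V.B_nonneg by (intro add_mono mult_right_mono) (auto simp: K_def)
    finally show "cmod (u 0) \<le> K * (X + C)" by (simp add: distrib_left)
  qed
qed

section \<open>Weak integrals over orbits\<close>

locale Cw_automorphism_group =
  fixes \<psi> :: "real^'d \<Rightarrow> 'a::complex_banach_algebra \<Rightarrow> 'a"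
  assumes Cw: "Cw_group \<psi>"
begin

abbreviation "D \<equiv> dual_Psi \<psi>"

definition M where "M = (SUP t. onorm (\<psi> t))"

lemma group_add: "\<psi> s (\<psi> t x) = \<psi> (s + t) x"
  using Cw by (auto simp: Cw_group_def automorphism_group_def fun_eq_iff o_def)

lemma psi_linear: "bounded_linear (\<psi> t)"
  using Cw by (auto simp: Cw_group_def automorphism_group_def banach_algebra_automorphism_def)

lemma psi_scaleC: "\<psi> t (scaleC c x) = scaleC c (\<psi> t x)"
  using Cw by (auto simp: Cw_group_def automorphism_group_def banach_algebra_automorphism_def)

text \<open>\<open>\<psi> 0\<close> is idempotent by the group law and injective, hence the
  identity.\<close>

lemma psi_0 [simp]: "\<psi> 0 x = x"
proof -
  have "inj (\<psi> 0)"
    using Cw by (auto simp: Cw_group_def automorphism_group_def banach_algebra_automorphism_def bij_def)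
  thus ?thesis using group_add[of 0 0 x] by (simp add: inj_eq)
qed

lemma onorm_psi_le: "onorm (\<psi> t) \<le> M"
  unfolding M_def using Cw by (intro cSUP_upper) (auto simp: Cw_group_def automorphism_group_def)

lemma M_nonneg: "0 \<le> M"
  using onorm_psi_le[of 0] onorm_pos_le[OF psi_linear[of 0]] by linarith

lemma norm_psi_le: "norm (\<psi> t x) \<le> M * norm x"
  using onorm[OF psi_linear, of t x] mult_right_mono[OF onorm_psi_le[of t] norm_ge_zero[of x]] by linarith

lemma dual_linear: "a' \<in> D \<Longrightarrow> bounded_linear a'"
  by (simp add: dual_Psi_def dual_space_def)

lemmas dual_linear' = bounded_linear.linear[OF dual_linear]

lemma dual_scaleC: "a' \<in> D \<Longrightarrow> a' (scaleC c x) = c * a' x"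
  by (simp add: dual_Psi_def dual_space_def)

text \<open>Translating an orbit keeps it continuous, so \<open>dual_Psi \<psi>\<close> is invariant
  under the group. This yields the convolution identity along a whole orbit instead of at one
  point.\<close>

lemma dual_compose:
  assumes "a' \<in> D"
  shows "(\<lambda>x. a' (\<psi> t x)) \<in> D"
proof -
  have "continuous_on UNIV (\<lambda>s. a' (\<psi> (t + s) x))" for x
    by (rule continuous_on_compose2[of UNIV "\<lambda>s. a' (\<psi> s x)" UNIV "\<lambda>s. t + s"])
      (use assms in \<open>auto simp: dual_Psi_def intro!: continuous_intros\<close>)
  thus ?thesis
    using assms bounded_linear_compose[OF dual_linear[OF assms] psi_linear]
    by (auto simp: dual_Psi_def dual_space_def psi_scaleC group_add)
qed

lemma dual_bound: "a' \<in> D \<Longrightarrow> cmod (a' x) \<le> onorm a' * norm x"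
  by (rule onorm[OF dual_linear])

lemma dual_le_norm: "a' \<in> D \<Longrightarrow> onorm a' \<le> 1 \<Longrightarrow> cmod (a' x) \<le> norm x"
  using dual_bound[of a' x] mult_right_mono[of "onorm a'" 1 "norm x"] by simp

lemma norm_le_dual:
  assumes "\<And>a'. a' \<in> D \<Longrightarrow> onorm a' \<le> 1 \<Longrightarrow> cmod (a' x) \<le> K"
  shows "norm x \<le> K"
proof -
  \<comment> \<open>The zero functional keeps the index set nonempty, as \<open>cSUP_least\<close>
    demands.\<close>
  have "(\<lambda>x. 0) \<in> {a' \<in> D. onorm a' \<le> 1}"
    by (auto simp: dual_Psi_def dual_space_def onorm_zero intro: bounded_linear_zero)
  hence "(SUP a'\<in>{a' \<in> D. onorm a' \<le> 1}. cmod (a' x)) \<le> K"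
    using assms by (intro cSUP_least) auto
  thus ?thesis using Cw by (simp add: Cw_group_def norm_fundamental_def)
qed

lemma dual_separates:
  assumes "\<And>a'. a' \<in> D \<Longrightarrow> a' x = a' y"
  shows "x = y"
proof -
  have "norm (x - y) \<le> 0"
    using assms by (intro norm_le_dual) (simp add: linear_diff[OF dual_linear'])
  thus ?thesis by simp
qed

lemma orbit_bounded_continuous:
  assumes "a' \<in> D"
  shows "bounded_continuous (\<lambda>t. a' (\<psi> t a)) (onorm a' * (M * norm a))"
proof
  show "continuous_on UNIV (\<lambda>t. a' (\<psi> t a))" using assms by (simp add: dual_Psi_def)
  show "cmod (a' (\<psi> t a)) \<le> onorm a' * (M * norm a)" for t
    using dual_bound[OF assms, of "\<psi> t a"] mult_left_mono[OF norm_psi_le[of t a] onorm_pos_le[OF dual_linear[OF assms]]]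
    by linarith
qed

lemma orbit_measurable: "a' \<in> D \<Longrightarrow> (\<lambda>t. a' (\<psi> t a)) \<in> borel_measurable borel"
  by (rule bounded_continuous.measurable_u[OF orbit_bounded_continuous])

lemma orbit_integral:
  assumes "a' \<in> D" "integrable lborel f"
  shows "integrable lborel (\<lambda>t. f t * a' (\<psi> t a))"
    and "cmod (LBINT t. f t * a' (\<psi> t a)) \<le> onorm a' * (M * norm a) * (LBINT t. cmod (f t))"
  using integrable_mult_bounded(1,3)[OF assms(2) orbit_measurable[OF assms(1)]
      bounded_continuous.bound[OF orbit_bounded_continuous[OF assms(1)]]] by auto

section \<open>Existence of barycentres of orbits\<close>

lemma sigma_topspace: "topspace (sigma_topology D) = UNIV"
proof -
  have z: "(\<lambda>x. 0) \<in> D" by (auto simp: dual_Psi_def dual_space_def intro: bounded_linear_zero)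
  have "(\<lambda>x. 0) -` UNIV \<in> {a' -` U | a' U. a' \<in> D \<and> open U}"
    using z by blast
  thus ?thesis unfolding sigma_topology_def topology_generated_by_topspace by auto
qed

lemma sigma_open: "a' \<in> D \<Longrightarrow> open U \<Longrightarrow> openin (sigma_topology D) (a' -` U)"
  unfolding sigma_topology_def by (rule topology_generated_by_Basis) auto

lemma sigma_closed: "a' \<in> D \<Longrightarrow> closed U \<Longrightarrow> closedin (sigma_topology D) (a' -` U)"
  using sigma_open[of a' "- U"] by (auto simp: closedin_def sigma_topspace vimage_Compl Compl_eq_Diff_UNIV[symmetric])

text \<open>Continuity of all orbit functions says that the orbit map is continuous into the weak
  topology. Orbits of balls are therefore compact sets to which the convex hull condition of a
  \<open>Cw_group\<close> applies.\<close>

lemma orbit_compact: "compact S \<Longrightarrow> compactin (sigma_topology D) ((\<lambda>t. \<psi> t a) ` S)"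
proof (rule image_compactin)
  show "compact S \<Longrightarrow> compactin euclidean S" by simp
  show "continuous_map euclidean (sigma_topology D) (\<lambda>t. \<psi> t a)"
    unfolding sigma_topology_def
  proof (rule continuous_on_generated_topo)
    fix V assume "V \<in> {a' -` U | a' U. a' \<in> D \<and> open U}"
    then obtain a' U where V: "V = a' -` U" "a' \<in> D" "open U" by blast
    have "open ((\<lambda>t. a' (\<psi> t a)) -` U)"
      using V by (intro open_vimage) (auto simp: dual_Psi_def)
    thus "openin euclidean ((\<lambda>t. \<psi> t a) -` V \<inter> topspace euclidean)"
      by (simp add: V vimage_def)
  next
    show "(\<lambda>t. \<psi> t a) ` topspace euclidean \<subseteq> \<Union> {a' -` U | a' U. a' \<in> D \<and> open U}"
      using sigma_topspace unfolding sigma_topology_def topology_generated_by_topspace by auto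
  qed
qed

text \<open>Moving a point of the hull towards every point of the orbit and averaging shows that the squared
  distance to the barycentre, seen through finitely many functionals, has infimum 0.\<close>

lemma hull_approximates_average:
  fixes g :: "real^'d \<Rightarrow> real" and a :: 'a
  assumes A: "finite A" "A \<subseteq> D" and eta: "\<eta> > 0"
    and g: "integrable lborel g" "\<And>t. 0 \<le> g t" "\<And>t. t \<notin> S \<Longrightarrow> g t = 0" "(LBINT t. g t) = 1" and S: "S \<noteq> {}"
  defines "I \<equiv> \<lambda>a'. (LBINT t. of_real (g t) * a' (\<psi> t a))"
  shows "\<exists>x\<in>convex hull ((\<lambda>t. \<psi> t a) ` S). (\<Sum>a'\<in>A. (cmod (a' x - I a'))\<^sup>2) < \<eta>"
proof (rule ccontr)
  assume no: "\<not> ?thesis"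
  define H where "H = convex hull ((\<lambda>t. \<psi> t a) ` S)"
  define Q where "Q x = (\<Sum>a'\<in>A. (cmod (a' x - I a'))\<^sup>2)" for x
  define m where "m = (INF x\<in>H. Q x)"
  have Q0: "0 \<le> Q x" for x unfolding Q_def by (intro sum_nonneg) auto
  have H: "H \<noteq> {}" using S by (simp add: H_def)
  have bdd: "bdd_below (Q ` H)" using Q0 by (rule bdd_belowI2)
  have mQ: "m \<le> Q x" if "x \<in> H" for x unfolding m_def by (rule cINF_lower[OF bdd that])
  have "\<eta> \<le> m" unfolding m_def using no H by (intro cINF_greatest) (auto simp: H_def Q_def not_less)
  hence m: "m > 0" using eta by simp
  define Bd where "Bd = (\<Sum>a'\<in>A. (onorm a' * (2 * (M * norm a)))\<^sup>2)"
  have Bd0: "0 \<le> Bd" unfolding Bd_def by (intro sum_nonneg) auto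
  have Hn: "norm x \<le> M * norm a" if "x \<in> H" for x
  proof -
    have "H \<subseteq> cball 0 (M * norm a)" unfolding H_def
      by (intro hull_minimal convex_cball) (auto simp: norm_psi_le)
    thus ?thesis using that by auto
  qed
  \<comment> \<open>The step length: s Bd \<le> m keeps the quadratic term below s m, and s \<le>
    1/2 keeps 1 - 2 s nonnegative.\<close>
  define s where "s = min (1 / 2) (m / (Bd + 1))"
  have s: "0 < s" "s \<le> 1 / 2"
    using m Bd0 min.cobounded1[of "1 / 2" "m / (Bd + 1)"] unfolding s_def by simp_all
  have "s * Bd \<le> m / (Bd + 1) * Bd" using Bd0 by (intro mult_right_mono) (auto simp: s_def)
  also have "\<dots> \<le> m" using Bd0 m by (simp add: field_simps)
  finally have sB: "s * Bd \<le> m" .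
  \<comment> \<open>The slack s m / 2 is less than the net gain: the linear term wins about 2 s m
    and the quadratic term costs at most s m.\<close>
  have "\<exists>x\<in>H. Q x < m + s * m / 2"
    using cINF_less_iff[OF H bdd, of "m + s * m / 2"] s m by (auto simp: m_def)
  then obtain x where x: "x \<in> H" "Q x < m + s * m / 2" by blast
  \<comment> \<open>2 Re (\<open>L t\<close>) is the derivative of \<open>Q\<close> at x towards
    \<psi> t a. Averaging against g replaces a' (\<psi> t a) by I a', so the mean of
    \<open>L\<close> is - Q x.\<close>
  define L where "L t = (\<Sum>a'\<in>A. cnj (a' x - I a') * (a' (\<psi> t a) - a' x))" for t
  have step: "m \<le> Q x + 2 * s * Re (L t) + s\<^sup>2 * Bd" if t: "t \<in> S" for t
  proof -
    let ?k = "\<psi> t a"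
    have kH: "?k \<in> H" using t by (simp add: H_def hull_inc)
    let ?y = "(1 - s) *\<^sub>R x + s *\<^sub>R ?k"
    have "?y \<in> H" unfolding H_def using s x(1) kH convex_convex_hull[of "(\<lambda>t. \<psi> t a) ` S"]
      by (intro convexD) (auto simp: H_def)
    hence "m \<le> Q ?y" by (rule mQ)
    also have "Q ?y \<le> (\<Sum>a'\<in>A. (cmod (a' x - I a'))\<^sup>2 + 2 * s * Re (cnj (a' x - I a') * (a' ?k - a' x))
        + s\<^sup>2 * (onorm a' * (2 * (M * norm a)))\<^sup>2)"
      unfolding Q_def
    proof (rule sum_mono)
      fix a' assume "a' \<in> A"
      hence a': "a' \<in> D" using A by auto
      interpret a': bounded_linear a' by (rule dual_linear[OF a'])
      have "a' ?y - I a' = (a' x - I a') + of_real s * (a' ?k - a' x)"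
        by (simp only: a'.add a'.scaleR scaleR_conv_of_real) (simp add: algebra_simps)
      also have "(cmod \<dots>)\<^sup>2 = (cmod (a' x - I a'))\<^sup>2 + 2 * s * Re (cnj (a' x - I a') * (a' ?k - a' x))
        + s\<^sup>2 * (cmod (a' ?k - a' x))\<^sup>2"
        unfolding cmod_power2 by (simp add: power2_eq_square algebra_simps)
      also have "\<dots> \<le> (cmod (a' x - I a'))\<^sup>2 + 2 * s * Re (cnj (a' x - I a') * (a' ?k - a' x))
        + s\<^sup>2 * (onorm a' * (2 * (M * norm a)))\<^sup>2"
      proof -
        have "cmod (a' ?k - a' x) \<le> onorm a' * norm (?k - x)"
          using dual_bound[OF a', of "?k - x"] by (simp add: a'.diff)
        also have "norm (?k - x) \<le> 2 * (M * norm a)"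
          using norm_triangle_ineq4[of ?k x] Hn[OF kH] Hn[OF x(1)] by linarith
        hence "onorm a' * norm (?k - x) \<le> onorm a' * (2 * (M * norm a))"
          by (intro mult_left_mono onorm_pos_le dual_linear a')
        finally show ?thesis by (intro add_left_mono mult_left_mono power_mono) auto
      qed
      finally show "(cmod (a' ?y - I a'))\<^sup>2 \<le> (cmod (a' x - I a'))\<^sup>2 + 2 * s * Re (cnj (a' x - I a') * (a' ?k - a' x))
        + s\<^sup>2 * (onorm a' * (2 * (M * norm a)))\<^sup>2" .
    qed
    also have "\<dots> = Q x + 2 * s * Re (L t) + s\<^sup>2 * Bd"
      by (simp add: sum.distrib Q_def L_def Bd_def sum_distrib_left Re_sum)
    finally show ?thesis .
  qed
  have gc: "integrable lborel (\<lambda>t. complex_of_real (g t))" using g(1) by simp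
  have gL: "of_real (g t) * L t = (\<Sum>a'\<in>A. cnj (a' x - I a') * (of_real (g t) * a' (\<psi> t a) - of_real (g t) * a' x))" for t
    by (simp add: L_def sum_distrib_left algebra_simps)
  have i1: "integrable lborel (\<lambda>t. of_real (g t) * a' (\<psi> t a) - of_real (g t) * a' x)" if "a' \<in> A" for a'
    using that A by (intro integrable_minus orbit_integral(1) integrable_mult_left gc) auto
  have iL: "integrable lborel (\<lambda>t. of_real (g t) * L t)"
    unfolding gL by (intro Bochner_Integration.integrable_sum integrable_mult_right i1)
  have "(LBINT t. of_real (g t) * L t) = (\<Sum>a'\<in>A. cnj (a' x - I a') * (I a' - a' x))"
    unfolding gL
  proof (subst Bochner_Integration.integral_sum)
    show "(\<Sum>a'\<in>A. LBINT t. cnj (a' x - I a') * (of_real (g t) * a' (\<psi> t a) - of_real (g t) * a' x))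
      = (\<Sum>a'\<in>A. cnj (a' x - I a') * (I a' - a' x))"
    proof (rule sum.cong[OF refl])
      fix a' assume "a' \<in> A"
      hence a': "a' \<in> D" using A by auto
      have "(LBINT t. of_real (g t) * a' (\<psi> t a) - of_real (g t) * a' x) = I a' - a' x"
        using g(4) by (subst lint_diff[OF orbit_integral(1)[OF a' gc] integrable_mult_left[OF gc]])
          (simp add: I_def)
      thus "(LBINT t. cnj (a' x - I a') * (of_real (g t) * a' (\<psi> t a) - of_real (g t) * a' x)) =
          cnj (a' x - I a') * (I a' - a' x)"
        by (simp only: integral_mult_right_zero)
    qed
  qed (intro integrable_mult_right i1)
  also have "\<dots> = - of_real (Q x)"
  proof -
    have "cnj z * (- z) = - of_real ((cmod z)\<^sup>2)" for z
      by (simp only: mult_minus_right complex_norm_square mult.commute[of "cnj z"])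
    from this[of "a' x - I a'" for a'] show ?thesis
      by (simp add: Q_def sum_negf)
  qed
  finally have "Re (LBINT t. of_real (g t) * L t) = - Q x" by simp
  hence RL: "(LBINT t. g t * Re (L t)) = - Q x"
    using integral_Re[OF iL] by simp
  have iR: "integrable lborel (\<lambda>t. g t * Re (L t))" using integrable_Re[OF iL] by simp
  have "0 \<le> (LBINT t. g t * (Q x + s\<^sup>2 * Bd - m) + 2 * s * (g t * Re (L t)))"
  proof (intro integral_nonneg_AE AE_I2)
    fix t
    have "g t * (Q x + s\<^sup>2 * Bd - m) + 2 * s * (g t * Re (L t)) = g t * (Q x + 2 * s * Re (L t) + s\<^sup>2 * Bd - m)"
      by (simp add: algebra_simps)
    also have "\<dots> \<ge> 0" using g(2,3)[of t] step[of t] by (cases "t \<in> S") auto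
    finally show "0 \<le> g t * (Q x + s\<^sup>2 * Bd - m) + 2 * s * (g t * Re (L t))" .
  qed
  also have "\<dots> = (Q x + s\<^sup>2 * Bd - m) - 2 * s * Q x"
    using g(1) iR by (simp add: RL g(4))
  finally have "m \<le> (1 - 2 * s) * Q x + s * (s * Bd)" by (simp add: algebra_simps power2_eq_square)
  also have "\<dots> \<le> (1 - 2 * s) * (m + s * m / 2) + s * m"
    using x(2) s sB by (intro add_mono mult_left_mono) auto
  also have "\<dots> = m - s * m / 2 - s * s * m" by (simp add: field_simps)
  also have "\<dots> < m"
  proof -
    have "0 < s * m" "0 < s * s * m" using s m by auto
    thus ?thesis by linarith
  qed
  finally show False by simp
qed

text \<open>In the weakly compact closed hull of the orbit of the ball, the closed conditions |a' x
  - I a'| \<le> \<eta> have the finite intersection property by the approximation in the hull. A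
  common point is the barycentre.\<close>

lemma average_exists:
  fixes f :: "real^'d \<Rightarrow> real" and a :: 'a
  assumes f: "integrable lborel f" "\<And>t. 0 \<le> f t" "\<And>t. t \<notin> cball 0 R \<Longrightarrow> f t = 0" and R: "0 \<le> R"
  shows "\<exists>x. \<forall>a'\<in>D. a' x = (LBINT t. of_real (f t) * a' (\<psi> t a))"
proof (cases "(LBINT t. f t) = 0")
  case True
  have "(LBINT t. of_real (f t) * a' (\<psi> t a)) = 0" if "a' \<in> D" for a'
    using orbit_integral(2)[OF that, of "\<lambda>t. of_real (f t)" a] f True by simp
  thus ?thesis by (intro exI[of _ 0]) (simp add: linear_0[OF dual_linear'])
next
  case False
  define c where "c = (LBINT t. f t)"
  have c: "c > 0" using False f(2) integral_nonneg_AE[of f lborel] by (auto simp: c_def less_le)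
  define g where "g t = f t / c" for t
  have g: "integrable lborel g" "\<And>t. 0 \<le> g t" "\<And>t. t \<notin> cball 0 R \<Longrightarrow> g t = 0" "(LBINT t. g t) = 1"
    using f c unfolding g_def by (auto simp: c_def[symmetric])
  define I where "I a' = (LBINT t. of_real (g t) * a' (\<psi> t a))" for a' :: "'a \<Rightarrow> complex"
  let ?H = "convex hull ((\<lambda>t. \<psi> t a) ` cball 0 R)"
  let ?C = "sigma_topology D closure_of ?H"
  let ?E = "\<lambda>(a', \<eta>). a' -` cball (I a') \<eta>"
  let ?U = "?E ` (D \<times> {0<..})"
  have sub: "?H \<subseteq> ?C" by (rule closure_of_subset) (simp add: sigma_topspace)
  have "compactin (sigma_topology D) ?C"
    using Cw orbit_compact[OF compact_cball, of a 0 R] by (simp add: Cw_group_def)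
  moreover have "\<forall>E\<in>?U. closedin (sigma_topology D) E"
    using sigma_closed[OF _ closed_cball] by auto
  moreover have "\<forall>F. finite F \<and> F \<subseteq> ?U \<longrightarrow> ?C \<inter> \<Inter>F \<noteq> {}"
  proof (intro allI impI)
    fix F assume "finite F \<and> F \<subseteq> ?U"
    then obtain J where J: "J \<subseteq> D \<times> {0<..}" "finite J" "F = ?E ` J"
      using finite_subset_image[of F ?E "D \<times> {0<..}"] by auto
    \<comment> \<open>The least of the finitely many radii; the inserted 1 covers an empty
      family.\<close>
    define \<eta> where "\<eta> = Min (insert 1 (snd ` J))"
    have e: "\<eta> > 0" "\<And>j. j \<in> J \<Longrightarrow> \<eta> \<le> snd j"
      using J by (auto simp: \<eta>_def)
    have "\<exists>x\<in>?H. (\<Sum>a'\<in>fst ` J. (cmod (a' x - I a'))\<^sup>2) < \<eta>\<^sup>2"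
      unfolding I_def by (rule hull_approximates_average) (use J e R g in auto)
    then obtain x where x: "x \<in> ?H" "(\<Sum>a'\<in>fst ` J. (cmod (a' x - I a'))\<^sup>2) < \<eta>\<^sup>2" by blast
    have "x \<in> ?E j" if j: "j \<in> J" for j
    proof -
      have "(cmod (fst j x - I (fst j)))\<^sup>2 \<le> (\<Sum>a'\<in>fst ` J. (cmod (a' x - I a'))\<^sup>2)"
        using j J(2) by (intro member_le_sum) auto
      hence "(cmod (fst j x - I (fst j)))\<^sup>2 < \<eta>\<^sup>2" using x(2) by linarith
      hence "cmod (fst j x - I (fst j)) \<le> snd j"
        using e(1) e(2)[OF j] power_less_imp_less_base[of _ 2 \<eta>] by fastforce
      thus ?thesis by (cases j) (simp add: dist_norm norm_minus_commute)
    qed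
    thus "?C \<inter> \<Inter>F \<noteq> {}" using x(1) sub J(3) by blast
  qed
  ultimately have "?C \<inter> \<Inter>?U \<noteq> {}" unfolding compactin_fip by blast
  then obtain x where xU: "x \<in> \<Inter>?U" by blast
  have x: "cmod (I a' - a' x) \<le> \<eta>" if "a' \<in> D" "\<eta> > 0" for a' \<eta>
  proof -
    have "?E (a', \<eta>) \<in> ?U" by (rule imageI) (use that in simp)
    with xU have "x \<in> ?E (a', \<eta>)" by (rule InterD)
    thus ?thesis by (simp add: dist_norm)
  qed
  have "a' (c *\<^sub>R x) = (LBINT t. of_real (f t) * a' (\<psi> t a))" if a': "a' \<in> D" for a'
  proof -
    have "cmod (I a' - a' x) \<le> 0"
    proof (rule field_le_epsilon)
      fix e :: real assume "0 < e"
      thus "cmod (I a' - a' x) \<le> 0 + e" using x[OF a', of e] by simp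
    qed
    hence I: "I a' = a' x" by simp
    have "a' (c *\<^sub>R x) = c *\<^sub>R a' x"
      by (rule linear_scale[OF dual_linear'[OF a']])
    also have "\<dots> = of_real c * I a'" by (simp only: I scaleR_conv_of_real)
    also have "\<dots> = (LBINT t. of_real c * (of_real (g t) * a' (\<psi> t a)))"
      unfolding I_def by (rule integral_mult_right_zero[symmetric])
    finally show ?thesis using c by (simp add: g_def)
  qed
  thus ?thesis by blast
qed

text \<open>The barycentres of the cut-off densities are a Cauchy sequence in norm, because their
  distances are at most M norm a times sums of L1 errors. Compactness is used only for the
  cut-offs.\<close>

lemma nonneg_average_exists:
  fixes f :: "real^'d \<Rightarrow> real" and a :: 'a
  assumes f: "integrable lborel f" "\<And>t. 0 \<le> f t"
  shows "\<exists>x. \<forall>a'\<in>D. a' x = (LBINT t. of_real (f t) * a' (\<psi> t a))"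
proof -
  let ?I = "\<lambda>a'. LBINT t. of_real (f t) * a' (\<psi> t a)"
  define F where "F n t = f t * indicator (cball 0 (real n)) t" for n t
  have [measurable]: "f \<in> borel_measurable borel" using f by auto
  have iF: "integrable lborel (F n)" for n
    unfolding F_def by (rule integrable_dominated[OF f(1)]) (auto simp: indicator_def)
  have "\<exists>x. \<forall>a'\<in>D. a' x = (LBINT t. of_real (F n t) * a' (\<psi> t a))" for n
    by (rule average_exists[OF iF, of n "real n"]) (auto simp: F_def f(2))
  then obtain X where X: "\<And>n a'. a' \<in> D \<Longrightarrow> a' (X n) = (LBINT t. of_real (F n t) * a' (\<psi> t a))" by metis
  define e where "e n = (LBINT t. cmod (of_real (F n t) - of_real (f t)))" for n
  have [measurable]: "F n \<in> borel_measurable borel" for n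
    using borel_measurable_integrable[OF iF] by simp
  have "e \<longlonglongrightarrow> (LINT t|(lborel :: (real^'d) measure). (0::real))"
    unfolding e_def
  proof (rule integral_dominated_convergence[OF _ _ f(1)])
    show "AE t in lborel. (\<lambda>n. cmod (of_real (F n t) - of_real (f t))) \<longlonglongrightarrow> 0"
    proof (rule AE_I2)
      fix t :: "real^'d"
      have "eventually (\<lambda>n. norm t \<le> real n) sequentially"
        using eventually_ge_at_top[of "nat \<lceil>norm t\<rceil>"] by eventually_elim linarith
      hence "eventually (\<lambda>n. cmod (of_real (F n t) - of_real (f t)) = 0) sequentially"
        by eventually_elim (simp add: F_def)
      thus "(\<lambda>n. cmod (of_real (F n t) - of_real (f t))) \<longlonglongrightarrow> 0"
        by (rule tendsto_eventually)
    qed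
    show "AE t in lborel. norm (cmod (of_real (F n t) - of_real (f t))) \<le> f t" for n
      using f(2) by (intro AE_I2) (auto simp: F_def indicator_def)
  qed measurable
  hence e0: "e \<longlonglongrightarrow> 0" by simp
  define N where "N = M * norm a"
  have N: "0 \<le> N" using M_nonneg by (simp add: N_def)
  have fc: "integrable lborel (\<lambda>t. complex_of_real (f t))" and Fc: "\<And>n. integrable lborel (\<lambda>t. complex_of_real (F n t))"
    using f(1) iF by auto
  have diff: "cmod (a' (X n) - ?I a') \<le> onorm a' * N * e n" if a': "a' \<in> D" for a' n
  proof -
    have "a' (X n) - ?I a' = (LBINT t. (of_real (F n t) - of_real (f t)) * a' (\<psi> t a))"
      unfolding X[OF a'] left_diff_distrib
      by (rule lint_diff[symmetric]; rule orbit_integral(1)[OF a']; rule fc Fc)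
    also have "cmod \<dots> \<le> onorm a' * N * e n"
      unfolding e_def N_def by (intro orbit_integral(2)[OF a'] integrable_minus fc Fc)
    finally show ?thesis .
  qed
  have XX: "norm (X n - X k) \<le> N * (e n + e k)" for n k
  proof (rule norm_le_dual)
    fix a' assume a': "a' \<in> D" "onorm a' \<le> 1"
    have en: "0 \<le> e n" "0 \<le> e k" by (auto simp: e_def)
    have "cmod (a' (X n - X k)) = cmod ((a' (X n) - ?I a') - (a' (X k) - ?I a'))"
      by (simp add: linear_diff[OF dual_linear'[OF a'(1)]])
    also have "\<dots> \<le> onorm a' * N * e n + onorm a' * N * e k"
      by (intro order_trans[OF norm_triangle_ineq4] add_mono diff a')
    also have "\<dots> \<le> 1 * N * e n + 1 * N * e k"
      using a' N en by (intro add_mono mult_right_mono) auto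
    finally show "cmod (a' (X n - X k)) \<le> N * (e n + e k)" by (simp add: algebra_simps)
  qed
  have "Cauchy X"
  proof (rule metric_CauchyI)
    fix \<eta> :: real assume "\<eta> > 0"
    have "(\<lambda>n. N * e n) \<longlonglongrightarrow> N * 0" by (intro tendsto_intros e0)
    hence "eventually (\<lambda>n. N * e n < \<eta> / 2) sequentially"
      by (rule order_tendstoD) (use \<open>\<eta> > 0\<close> in simp)
    then obtain n0 where n0: "\<And>n. n \<ge> n0 \<Longrightarrow> N * e n < \<eta> / 2" by (auto simp: eventually_sequentially)
    show "\<exists>n0. \<forall>n\<ge>n0. \<forall>k\<ge>n0. dist (X n) (X k) < \<eta>"
    proof (intro exI allI impI)
      fix n k assume "n \<ge> n0" "k \<ge> n0"
      thus "dist (X n) (X k) < \<eta>" using XX[of n k] n0[of n] n0[of k] by (simp add: dist_norm distrib_left)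
    qed
  qed
  then obtain x where x: "X \<longlonglongrightarrow> x" using Cauchy_convergent convergent_def by blast
  have "a' x = ?I a'" if a': "a' \<in> D" for a'
  proof (rule LIMSEQ_unique)
    show "(\<lambda>n. a' (X n)) \<longlonglongrightarrow> a' x"
      by (rule bounded_linear.tendsto[OF dual_linear[OF a'] x])
    have l0: "(\<lambda>n. onorm a' * N * e n) \<longlonglongrightarrow> 0"
      using tendsto_mult_left[OF e0, of "onorm a' * N"] by simp
    have "(\<lambda>n. a' (X n) - ?I a') \<longlonglongrightarrow> 0"
      by (rule Lim_null_comparison[OF _ l0]) (intro always_eventually allI diff a')
    thus "(\<lambda>n. a' (X n)) \<longlonglongrightarrow> ?I a'"
      by (rule LIM_zero_cancel)
  qed
  thus ?thesis by blast
qed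

text \<open>Real and imaginary parts, each split into positive and negative parts, reduce to
  nonnegative densities; \<open>scaleC\<close> supplies the factor i.\<close>

theorem orbit_integral_exists:
  fixes f :: "real^'d \<Rightarrow> complex" and a :: 'a
  assumes f: "integrable lborel f"
  shows "\<exists>x. \<forall>a'\<in>D. a' x = (LBINT t. f t * a' (\<psi> t a))"
proof -
  have real: "\<exists>x. \<forall>a'\<in>D. a' x = (LBINT t. of_real (h t) * a' (\<psi> t a))" if h: "integrable lborel h" for h :: "real^'d \<Rightarrow> real"
  proof -
    have p: "integrable lborel (\<lambda>t. max 0 (h t))" "integrable lborel (\<lambda>t. max 0 (- h t))"
      using h by auto
    obtain x where x: "\<And>a'. a' \<in> D \<Longrightarrow> a' x = (LBINT t. of_real (max 0 (h t)) * a' (\<psi> t a))"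
      using nonneg_average_exists[OF p(1) max.cobounded1, of a] by blast
    obtain y where y: "\<And>a'. a' \<in> D \<Longrightarrow> a' y = (LBINT t. of_real (max 0 (- h t)) * a' (\<psi> t a))"
      using nonneg_average_exists[OF p(2) max.cobounded1, of a] by blast
    have "a' (x - y) = (LBINT t. of_real (h t) * a' (\<psi> t a))" if a': "a' \<in> D" for a'
    proof -
      have "a' (x - y) = a' x - a' y" by (rule linear_diff[OF dual_linear'[OF a']])
      also have "\<dots> = (LBINT t. of_real (max 0 (h t)) * a' (\<psi> t a) - of_real (max 0 (- h t)) * a' (\<psi> t a))"
        unfolding x[OF a'] y[OF a']
        by (intro lint_diff[symmetric] orbit_integral(1) a' integrable_of_real p)
      also have "\<dots> = (LBINT t. of_real (h t) * a' (\<psi> t a))"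
        by (intro lint_cong refl) (auto simp: max_def)
      finally show ?thesis .
    qed
    thus ?thesis by blast
  qed
  have r: "integrable lborel (\<lambda>t. Re (f t))" "integrable lborel (\<lambda>t. Im (f t))" using f by auto
  obtain x where x: "\<And>a'. a' \<in> D \<Longrightarrow> a' x = (LBINT t. of_real (Re (f t)) * a' (\<psi> t a))"
    using real[OF r(1)] by blast
  obtain y where y: "\<And>a'. a' \<in> D \<Longrightarrow> a' y = (LBINT t. of_real (Im (f t)) * a' (\<psi> t a))"
    using real[OF r(2)] by blast
  have "a' (x + scaleC \<i> y) = (LBINT t. f t * a' (\<psi> t a))" if a': "a' \<in> D" for a'
  proof -
    have "a' (x + scaleC \<i> y) = a' x + \<i> * a' y"
      by (simp add: linear_add[OF dual_linear'[OF a']] dual_scaleC[OF a'])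
    also have "\<dots> = (LBINT t. of_real (Re (f t)) * a' (\<psi> t a) + \<i> * (of_real (Im (f t)) * a' (\<psi> t a)))"
      unfolding x[OF a'] y[OF a'] integral_mult_right_zero[symmetric]
      by (intro lint_add[symmetric] integrable_mult_right orbit_integral(1) a' integrable_of_real r)
    also have "\<dots> = (LBINT t. f t * a' (\<psi> t a))"
    proof (intro lint_cong refl)
      fix t
      have "f t = of_real (Re (f t)) + \<i> * of_real (Im (f t))" by (rule complex_eq)
      thus "of_real (Re (f t)) * a' (\<psi> t a) + \<i> * (of_real (Im (f t)) * a' (\<psi> t a)) = f t * a' (\<psi> t a)"
        by (metis distrib_right mult.assoc)
    qed
    finally show ?thesis .
  qed
  thus ?thesis by blast
qed

end

section \<open>Equivalence of the norms\<close>

context Cw_automorphism_group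
begin

lemma weak_integral_eqI:
  assumes "has_weak_integral \<psi> S F x"
  shows "weak_integral \<psi> S F = x"
  unfolding weak_integral_def
proof (rule the_equality[of "has_weak_integral \<psi> S F", OF assms])
  fix y assume y: "has_weak_integral \<psi> S F y"
  show "y = x"
  proof (rule dual_separates)
    fix a' assume "a' \<in> D"
    thus "a' y = a' x" using y assms unfolding has_weak_integral_def by (metis (no_types, lifting))
  qed
qed

text \<open>The orbit integral of the reflected density satisfies the description behind
  \<open>conv\<close>, and separation by functionals identifies the two.\<close>

lemma dual_conv:
  assumes f: "integrable lborel f" and a': "a' \<in> D"
  shows "a' (conv \<psi> f a) = (LBINT t. f t * a' (\<psi> (- t) a))"
proof -
  have f': "integrable lborel (\<lambda>t. f (- t))"
    using lborel_affine_integral(1)[of "-1" f 0] f by simp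
  obtain x where x: "\<And>a'. a' \<in> D \<Longrightarrow> a' x = (LBINT t. f (- t) * a' (\<psi> t a))"
    using orbit_integral_exists[OF f', of a] by blast
  have "has_weak_integral \<psi> UNIV (\<lambda>t. scaleC (f t) (\<psi> (- t) a)) x"
    unfolding has_weak_integral_def
  proof (intro ballI conjI)
    fix b assume b: "b \<in> D"
    have e: "integrable lborel (\<lambda>t. f t * b (\<psi> (- t) a))" "(LBINT t. f t * b (\<psi> (- t) a)) = (LBINT t. f (- t) * b (\<psi> t a))"
      using lborel_affine_integral[of "-1" "\<lambda>t. f (- t) * b (\<psi> t a)" 0] orbit_integral(1)[OF b f', of a] by simp_all
    show "set_integrable lborel UNIV (\<lambda>t. b (scaleC (f t) (\<psi> (- t) a)))"
      using e(1) by (simp add: set_integrable_def dual_scaleC[OF b])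
    show "b x = (LINT t:UNIV|lborel. b (scaleC (f t) (\<psi> (- t) a)))"
      using e(2) x[OF b] by (simp add: set_lebesgue_integral_def dual_scaleC[OF b])
  qed
  from weak_integral_eqI[OF this] have c: "conv \<psi> f a = x" by (simp add: conv_def)
  show ?thesis unfolding c x[OF a']
    using lborel_affine_integral(2)[of "-1" "\<lambda>t. f (- t) * a' (\<psi> t a)" 0] by simp
qed

lemma dual_weak_integral_difference:
  fixes k h :: "real^'d \<Rightarrow> real"
  assumes h: "integrable lborel h" "\<And>t. h t = indicator S t * k t" and a': "a' \<in> D"
  shows "a' (weak_integral \<psi> S (\<lambda>t. k t *\<^sub>R (\<psi> t a - a))) = (LBINT t. of_real (h t) * (a' (\<psi> t a) - a' a))"
proof -
  have hc: "integrable lborel (\<lambda>t. complex_of_real (h t))" using h(1) by simp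
  obtain x where x: "\<And>a'. a' \<in> D \<Longrightarrow> a' x = (LBINT t. of_real (h t) * a' (\<psi> t a))"
    using orbit_integral_exists[OF hc, of a] by blast
  \<comment> \<open>The constant term contributes a times the mass of \<open>h\<close>, so the
    existence theorem is applied to the orbit term alone.\<close>
  define y where "y = x - (LBINT t. h t) *\<^sub>R a"
  have y: "b y = (LBINT t. of_real (h t) * (b (\<psi> t a) - b a))"
     and i: "integrable lborel (\<lambda>t. of_real (h t) * (b (\<psi> t a) - b a))" if b: "b \<in> D" for b
  proof -
    interpret b: bounded_linear b by (rule dual_linear[OF b])
    note i1 = orbit_integral(1)[OF b hc, of a] and i2 = integrable_mult_left[OF hc, of "b a"]
    show "integrable lborel (\<lambda>t. of_real (h t) * (b (\<psi> t a) - b a))"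
      unfolding right_diff_distrib by (rule integrable_minus[OF i1 i2])
    show "b y = (LBINT t. of_real (h t) * (b (\<psi> t a) - b a))"
      unfolding right_diff_distrib lint_diff[OF i1 i2]
      by (simp add: y_def b.diff b.scaleR x[OF b] scaleR_conv_of_real)
  qed
  have "has_weak_integral \<psi> S (\<lambda>t. k t *\<^sub>R (\<psi> t a - a)) y"
    unfolding has_weak_integral_def
  proof (intro ballI conjI)
    fix b assume b: "b \<in> D"
    interpret b: bounded_linear b by (rule dual_linear[OF b])
    have e: "indicator S t *\<^sub>R b (k t *\<^sub>R (\<psi> t a - a)) = of_real (h t) * (b (\<psi> t a) - b a)" for t
      by (simp add: h(2) b.scaleR b.diff scaleR_conv_of_real)
    show "set_integrable lborel S (\<lambda>t. b (k t *\<^sub>R (\<psi> t a - a)))"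
      unfolding set_integrable_def e by (rule i[OF b])
    show "b y = (LINT t:S|lborel. b (k t *\<^sub>R (\<psi> t a - a)))"
      unfolding set_lebesgue_integral_def e by (rule y[OF b])
  qed
  from weak_integral_eqI[OF this] show ?thesis using y[OF a'] by simp
qed

section \<open>Hypersingular integrals and Bessel potentials in the algebra\<close>

abbreviation "full_integral r \<epsilon> a \<equiv> weak_integral \<psi> {t. \<epsilon> \<le> norm t}
   (\<lambda>t. (norm t powr (- r) / norm t ^ CARD('d)) *\<^sub>R (\<psi> t a - a))"

abbreviation "local_integral r \<epsilon> a \<equiv> weak_integral \<psi> {t. \<epsilon> \<le> norm t \<and> norm t \<le> 1}
   (\<lambda>t. (1 / (norm t powr r * norm t ^ CARD('d))) *\<^sub>R (\<psi> t a - a))"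

lemma dual_full_integral:
  assumes r: "r > 0" and eps: "\<epsilon> > 0" and a': "a' \<in> D"
  shows "a' (full_integral r \<epsilon> a) = (LBINT t. of_real (riesz_kernel r \<epsilon> t) * (a' (\<psi> t a) - a' a))"
proof (rule dual_weak_integral_difference[OF riesz_kernel_integral(1)[OF r eps] _ a'])
  fix t :: "real^'d"
  show "riesz_kernel r \<epsilon> t = indicator {t. \<epsilon> \<le> norm t} t * (norm t powr (- r) / norm t ^ CARD('d))"
    using eps by (cases "t = 0") (simp_all add: riesz_kernel_def powr_diff powr_realpow)
qed

lemma dual_local_integral:
  assumes r: "r > 0" and eps: "\<epsilon> > 0" and a': "a' \<in> D"
  shows "a' (local_integral r \<epsilon> a) = (LBINT t. of_real (riesz_kernel r \<epsilon> t * indicator (cball 0 1) t) * (a' (\<psi> t a) - a' a))"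
proof (rule dual_weak_integral_difference[OF _ _ a'])
  show "integrable lborel (\<lambda>t::real^'d. riesz_kernel r \<epsilon> t * indicator (cball 0 1) t)"
    by (intro integrable_real_mult_indicator riesz_kernel_integral(1) r eps) auto
  fix t :: "real^'d"
  show "riesz_kernel r \<epsilon> t * indicator (cball 0 1) t = indicator {t. \<epsilon> \<le> norm t \<and> norm t \<le> 1} t * (1 / (norm t powr r * norm t ^ CARD('d)))"
    using eps by (cases "t = 0") (simp_all add: riesz_kernel_def indicator_def powr_diff powr_minus_divide powr_realpow)
qed

text \<open>Only |t| > 1 survives, where \<open>riesz_kernel r \<epsilon>\<close> is at most
  \<open>riesz_kernel r 1\<close> for every \<epsilon>, including \<epsilon> > 1. The difference
  thus costs a fixed multiple of \<open>norm a\<close>.\<close>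

lemma full_local_difference:
  assumes r: "r > 0" and eps: "\<epsilon> > 0"
  shows "norm (full_integral r \<epsilon> a - local_integral r \<epsilon> a) \<le> (LBINT t. riesz_kernel r 1 (t::real^'d)) * ((M + 1) * norm a)"
proof (rule norm_le_dual)
  fix a' assume a': "a' \<in> D" "onorm a' \<le> 1"
  interpret a': bounded_linear a' by (rule dual_linear[OF a'(1)])
  let ?d = "\<lambda>t. a' (\<psi> t a) - a' a"
  have bd: "cmod (?d t) \<le> (M + 1) * norm a" for t
  proof -
    have "cmod (?d t) = cmod (a' (\<psi> t a - a))" by (simp add: a'.diff)
    also have "\<dots> \<le> norm (\<psi> t a - a)" by (rule dual_le_norm[OF a'])
    also have "\<dots> \<le> norm (\<psi> t a) + norm a" by (rule norm_triangle_ineq4)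
    also have "\<dots> \<le> (M + 1) * norm a" using norm_psi_le[of t a] by (simp add: distrib_right)
    finally show ?thesis .
  qed
  have i1: "integrable lborel (\<lambda>t::real^'d. riesz_kernel r \<epsilon> t)" by (rule riesz_kernel_integral(1)[OF r eps])
  have i2: "integrable lborel (\<lambda>t::real^'d. riesz_kernel r \<epsilon> t * indicator (cball 0 1) t)"
    by (intro integrable_real_mult_indicator i1) auto
  have m: "?d \<in> borel_measurable borel" using orbit_measurable[OF a'(1), of a] by measurable
  have i: "integrable lborel (\<lambda>t. of_real (h t) * ?d t)" if "integrable lborel h" for h :: "real^'d \<Rightarrow> real"
    by (rule integrable_mult_bounded(1)[OF integrable_of_real[OF that] m bd])
  have "a' (full_integral r \<epsilon> a - local_integral r \<epsilon> a) =
     (LBINT t. of_real (riesz_kernel r \<epsilon> t) * ?d t - of_real (riesz_kernel r \<epsilon> t * indicator (cball 0 1) t) * ?d t)"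
    unfolding a'.diff dual_full_integral[OF r eps a'(1)] dual_local_integral[OF r eps a'(1)]
    by (rule lint_diff[OF i[OF i1] i[OF i2], symmetric])
  also have "cmod \<dots> \<le> (LBINT t. riesz_kernel r 1 (t::real^'d) * ((M + 1) * norm a))"
  proof (rule cmod_integral_le)
    show "integrable lborel (\<lambda>t::real^'d. riesz_kernel r 1 t * ((M + 1) * norm a))"
      using riesz_kernel_integral(1)[OF r, of 1, where 'e = "real^'d"] by simp
    fix t
    have "of_real (riesz_kernel r \<epsilon> t) * ?d t - of_real (riesz_kernel r \<epsilon> t * indicator (cball 0 1) t) * ?d t
       = of_real (riesz_kernel r \<epsilon> t * (1 - indicator (cball 0 1) t)) * ?d t"
      by (simp add: algebra_simps)
    also have "cmod \<dots> = riesz_kernel r \<epsilon> t * (1 - indicator (cball 0 1) t) * cmod (?d t)"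
      unfolding norm_mult norm_of_real by (simp add: indicator_def)
    also have "\<dots> \<le> riesz_kernel r 1 t * ((M + 1) * norm a)"
      by (intro mult_mono bd) (auto simp: riesz_kernel_def indicator_def)
    finally show "cmod (of_real (riesz_kernel r \<epsilon> t) * ?d t - of_real (riesz_kernel r \<epsilon> t * indicator (cball 0 1) t) * ?d t)
       \<le> riesz_kernel r 1 t * ((M + 1) * norm a)" .
  qed
  finally show "cmod (a' (full_integral r \<epsilon> a - local_integral r \<epsilon> a)) \<le> (LBINT t. riesz_kernel r 1 (t::real^'d)) * ((M + 1) * norm a)"
    by simp
qed

lemma bessel_kernel_integrable:
  assumes "r > 0"
  shows "integrable lborel (bessel_kernel r :: real^'d \<Rightarrow> complex)"
proof -
  have "is_bessel_kernel r (bessel_kernel r :: real^'d \<Rightarrow> complex)"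
    unfolding bessel_kernel_def by (rule someI[of "is_bessel_kernel r", OF is_bessel_kernel_density[OF assms]])
  thus ?thesis by (simp add: is_bessel_kernel_def)
qed

lemma bounded_continuous_orbit:
  assumes "a' \<in> D" "onorm a' \<le> 1"
  shows "bounded_continuous (\<lambda>t. a' (\<psi> t a)) (M * norm a)"
proof
  show "continuous_on UNIV (\<lambda>t. a' (\<psi> t a))" using assms by (simp add: dual_Psi_def)
  show "cmod (a' (\<psi> t a)) \<le> M * norm a" for t
    using dual_le_norm[OF assms, of "\<psi> t a"] norm_psi_le[of t a] by linarith
qed

abbreviation "J r \<equiv> conv \<psi> (bessel_kernel r)"

text \<open>Composing a' with \<open>\<psi> x\<close> gives again an admissible functional, so the
  convolution formula holds at each x. The bounds are common to all a' of norm at most 1.\<close>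

lemma bessel_potential_orbit:
  assumes r: "0 < r" "r < 2" and a': "a' \<in> D" "onorm a' \<le> 1" and a: "a = J r y"
  shows "bessel_potential (\<lambda>t. a' (\<psi> t y)) (\<lambda>t. a' (\<psi> t a)) (M * norm y) (M * norm a) (r / 2) (r / 2 + DIM(real^'d) / 2)"
proof -
  interpret U: bounded_continuous "\<lambda>t. a' (\<psi> t y)" "M * norm y" by (rule bounded_continuous_orbit[OF a'])
  interpret V: bounded_continuous "\<lambda>t. a' (\<psi> t a)" "M * norm a" by (rule bounded_continuous_orbit[OF a'])
  show ?thesis
  proof
    fix x
    have "a' (\<psi> x a) = (LBINT t. bessel_kernel r t * a' (\<psi> x (\<psi> (- t) y)))"
      unfolding a by (rule dual_conv[OF bessel_kernel_integrable[OF r(1)] dual_compose[OF a'(1)]])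
    also have "\<dots> = (LBINT t. bessel_kernel r t * a' (\<psi> (x - t) y))" by (simp add: group_add)
    also have "\<dots> = (LBINT s. of_real (gamma_density (r / 2) s) * heat_mean (\<lambda>t. a' (\<psi> t y)) s x)"
      by (rule bessel_kernel_integral[OF r(1) U.bounded_continuous_axioms])
    finally show "a' (\<psi> x a) = \<dots>" .
  qed (use r in auto)
qed

text \<open>a' a is a Gamma mean of heat means of the orbit of y. Both are probability averages,
  which gives the constant \<open>M\<close>.\<close>

lemma norm_conv_le:
  assumes r: "0 < r" "r < 2" and a: "a = J r y"
  shows "norm a \<le> M * norm y"
proof (rule norm_le_dual)
  fix a' assume a': "a' \<in> D" "onorm a' \<le> 1"
  interpret bessel_potential "\<lambda>t. a' (\<psi> t y)" "\<lambda>t. a' (\<psi> t a)" "M * norm y" "M * norm a" "r / 2" "r / 2 + DIM(real^'d) / 2"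
    by (rule bessel_potential_orbit[OF r a' a])
  have "cmod (frac_mean (r / 2) profile 0) \<le> M * norm y"
    by (rule frac_mean_integrable(3)[OF alpha U.heat_mean_measurable profile_bound]) auto
  thus "cmod (a' a) \<le> M * norm y" using v_0 by simp
qed

theorem full_integral_equivalence:
  assumes r: "0 < r" "r < 2"
  shows "\<exists>K>0. \<forall>y.
    (\<forall>\<epsilon>>0. norm (full_integral r \<epsilon> (J r y)) \<le> K * norm y) \<and>
    (\<forall>X. (\<forall>\<epsilon>>0. norm (full_integral r \<epsilon> (J r y)) \<le> X) \<longrightarrow>
      norm y \<le> K * (X + norm (J r y)))"
proof -
  have r2: "0 < r / 2" "r / 2 < 1" using r by auto
  have e: "2 * (r / 2) = r" by simp
  obtain K where K1: "K > 0" and K: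
    "\<forall>(u :: real^'d \<Rightarrow> complex) v B C. bessel_potential u v B C (r / 2) (r / 2 + DIM(real^'d) / 2) \<longrightarrow>
     (\<forall>\<epsilon>>0. cmod (LBINT t. of_real (riesz_kernel r \<epsilon> t) * (v t - v 0)) \<le> K * B) \<and>
     (\<forall>X. (\<forall>\<epsilon>>0. cmod (LBINT t. of_real (riesz_kernel r \<epsilon> t) * (v t - v 0)) \<le> X) \<longrightarrow>
       cmod (u 0) \<le> K * (X + C))"
    using hypersingular_equivalence[OF r2, where 'e = "real^'d"] unfolding e by blast
  have T: "(LBINT t. of_real (riesz_kernel r \<epsilon> t) * (a' (\<psi> t a) - a' (\<psi> 0 a))) = a' (full_integral r \<epsilon> a)"
    if "\<epsilon> > 0" "a' \<in> D" for \<epsilon> a' a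
    using dual_full_integral[OF r(1) that, of a] by simp
  have up: "cmod (a' (full_integral r \<epsilon> a)) \<le> K * (M * norm y)"
    if a': "a' \<in> D" "onorm a' \<le> 1" and a: "a = J r y" and eps: "\<epsilon> > 0" for a' \<epsilon> a y
    using K[rule_format, OF bessel_potential_orbit[OF r a' a], THEN conjunct1, rule_format, OF eps] T[OF eps a'(1), of a] by simp
  have low: "cmod (a' y) \<le> K * (X + M * norm a)"
    if a': "a' \<in> D" "onorm a' \<le> 1" and a: "a = J r y"
      and X: "\<And>\<epsilon>. \<epsilon> > 0 \<Longrightarrow> cmod (a' (full_integral r \<epsilon> a)) \<le> X" for a' X a y
  proof -
    have "\<forall>\<epsilon>>0. cmod (LBINT t. of_real (riesz_kernel r \<epsilon> t) * (a' (\<psi> t a) - a' (\<psi> 0 a))) \<le> X"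
      using X T[OF _ a'(1), of _ a] by simp
    from K[rule_format, OF bessel_potential_orbit[OF r a' a], THEN conjunct2, THEN spec, THEN mp, OF this]
    show ?thesis by simp
  qed
  \<comment> \<open>The factor \<open>M + 1\<close> absorbs the orbit bound
    \<open>M * norm y\<close> of the upper estimate and both X and \<open>M * norm a\<close> of the
    lower one.\<close>
  show ?thesis
  proof (intro exI[of _ "K * (M + 1)"] conjI allI impI)
    show "K * (M + 1) > 0" using K1 M_nonneg by (intro mult_pos_pos) auto
  next
    fix y and \<epsilon> :: real assume eps: "0 < \<epsilon>"
    have "norm (full_integral r \<epsilon> (J r y)) \<le> K * (M * norm y)"
      by (intro norm_le_dual up[OF _ _ refl eps])
    also have "\<dots> \<le> K * (M + 1) * norm y" using K1 by (simp add: distrib_left distrib_right)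
    finally show "norm (full_integral r \<epsilon> (J r y)) \<le> K * (M + 1) * norm y" .
  next
    fix y and X :: real
    define a where "a = J r y"
    assume "\<forall>\<epsilon>>0. norm (full_integral r \<epsilon> (J r y)) \<le> X"
    hence X: "norm (full_integral r \<epsilon> a) \<le> X" if "\<epsilon> > 0" for \<epsilon> using that by (simp only: a_def)
    have X0: "0 \<le> X" using X[of 1] norm_ge_zero order_trans zero_less_one by blast
    have "norm y \<le> K * (X + M * norm a)"
    proof (rule norm_le_dual)
      fix a' assume a': "a' \<in> D" "onorm a' \<le> 1"
      show "cmod (a' y) \<le> K * (X + M * norm a)"
        by (rule low[OF a' a_def order_trans[OF dual_le_norm[OF a'] X]])
    qed
    also have "\<dots> \<le> K * ((M + 1) * (X + norm a))"
      using K1 X0 M_nonneg by (intro mult_left_mono) (auto simp: distrib_left distrib_right)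
    finally show "norm y \<le> K * (M + 1) * (X + norm (J r y))"
      by (simp only: a_def mult.assoc)
  qed
qed

text \<open>If z = x - y has potential 0, all its hypersingular integrals vanish, and the lower
  estimate with X = 0 forces z = 0. This justifies the \<open>THE\<close> in
  \<open>bessel_norm\<close>.\<close>

lemma conv_bessel_kernel_inj:
  assumes r: "0 < r" "r < 2" and eq: "J r x = J r y"
  shows "x = y"
proof -
  have z: "J r (x - y) = 0"
  proof (rule dual_separates)
    fix a' assume a': "a' \<in> D"
    interpret a': bounded_linear a' by (rule dual_linear[OF a'])
    note G = bessel_kernel_integrable[OF r(1)]
    have i: "integrable lborel (\<lambda>t. bessel_kernel r t * a' (\<psi> (- t) z))" for z
      using integrable_mult_bounded(1)[OF G, of "\<lambda>t. a' (\<psi> (- t) z)" "onorm a' * (M * norm z)"]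
        bounded_continuous.bound[OF orbit_bounded_continuous[OF a']]
        bounded_continuous.measurable_u[OF bounded_continuous.reflect[OF orbit_bounded_continuous[OF a']], of 0 z] by simp
    have "a' (\<psi> (- t) (x - y)) = a' (\<psi> (- t) x) - a' (\<psi> (- t) y)" for t
      by (simp add: a'.diff linear_diff[OF bounded_linear.linear[OF psi_linear]])
    hence "a' (J r (x - y)) = a' (J r x) - a' (J r y)"
      unfolding dual_conv[OF G a'] using i by (simp add: right_diff_distrib)
    thus "a' (J r (x - y)) = a' 0" using eq by (simp add: a'.zero)
  qed
  obtain K where K: "K > 0"
    "\<forall>y X. (\<forall>\<epsilon>>0. norm (full_integral r \<epsilon> (J r y)) \<le> X) \<longrightarrow> norm y \<le> K * (X + norm (J r y))"
    using full_integral_equivalence[OF r] by blast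
  have "norm (full_integral r \<epsilon> (J r (x - y))) \<le> 0" if "\<epsilon> > 0" for \<epsilon>
    unfolding z
  proof (rule norm_le_dual)
    fix a' assume a': "a' \<in> D"
    interpret a': bounded_linear a' by (rule dual_linear[OF a'])
    show "cmod (a' (full_integral r \<epsilon> 0)) \<le> 0"
      unfolding dual_full_integral[OF r(1) that a'] by (simp add: a'.zero linear_0[OF bounded_linear.linear[OF psi_linear]])
  qed
  hence "norm (x - y) \<le> K * (0 + norm (J r (x - y)))" using K(2) by blast
  thus "x = y" by (simp add: z)
qed

lemma bessel_norm_conv:
  assumes "0 < r" "r < 2"
  shows "bessel_norm \<psi> r (J r y) = norm y"
  unfolding bessel_norm_def using conv_bessel_kernel_inj[OF assms] by (intro arg_cong[of _ _ norm] the_equality) auto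

end

section \<open>From estimates of all truncations to suprema\<close>

text \<open>The second upper bound makes the supremum finite, and only then can its real value be
  inserted for X in the lower bound.\<close>

lemma equivalent_norms_on_SUP:
  fixes V :: "'b::real_normed_vector set" and T :: "real \<Rightarrow> 'b \<Rightarrow> 'b"
  assumes K: "0 < K" and L: "0 < L"
    and le: "\<And>a. a \<in> V \<Longrightarrow> norm a \<le> L * n a" "\<And>a \<epsilon>. a \<in> V \<Longrightarrow> \<epsilon> > 0 \<Longrightarrow> norm (T \<epsilon> a) \<le> L * n a"
    and ge: "\<And>a X. a \<in> V \<Longrightarrow> (\<And>\<epsilon>. \<epsilon> > 0 \<Longrightarrow> norm (T \<epsilon> a) \<le> X) \<Longrightarrow> n a \<le> K * (X + norm a)"
  shows "equivalent_norms_on V (\<lambda>a. ennreal (n a)) (\<lambda>a. ennreal (norm a) + (SUP \<epsilon>\<in>{0<..}. ennreal (norm (T \<epsilon> a))))"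
  unfolding equivalent_norms_on_def
proof (intro exI conjI ballI)
  show "0 < 1 / K" "0 < 2 * L" using K L by auto
  fix a assume a: "a \<in> V"
  define S where "S = (SUP \<epsilon>\<in>{0<..}. ennreal (norm (T \<epsilon> a)))"
  have n: "0 \<le> n a" using le(1)[OF a] L norm_ge_zero[of a] by (metis order_trans zero_le_mult_iff not_less)
  have SL: "S \<le> ennreal (L * n a)" unfolding S_def using le(2)[OF a] by (intro SUP_least ennreal_leI) auto
  have S: "S = ennreal (enn2real S)" using SL by (metis ennreal_enn2real ennreal_less_top le_less_trans)
  have "norm (T \<epsilon> a) \<le> enn2real S" if "\<epsilon> > 0" for \<epsilon>
  proof -
    have "ennreal (norm (T \<epsilon> a)) \<le> S" unfolding S_def using that by (intro SUP_upper) auto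
    thus ?thesis by (subst (asm) S) (simp add: enn2real_nonneg)
  qed
  hence "n a \<le> K * (enn2real S + norm a)" by (rule ge[OF a])
  hence "1 / K * n a \<le> norm a + enn2real S" using K by (simp add: field_simps)
  hence "ennreal (1 / K * n a) \<le> ennreal (norm a + enn2real S)" by (rule ennreal_leI)
  also have "\<dots> = ennreal (norm a) + S" by (subst S) (simp add: ennreal_plus enn2real_nonneg)
  finally show "ennreal (1 / K) * ennreal (n a) \<le> ennreal (norm a) + (SUP \<epsilon>\<in>{0<..}. ennreal (norm (T \<epsilon> a)))"
    using K n by (simp add: S_def ennreal_mult[symmetric])
  have "ennreal (norm a) + S \<le> ennreal (L * n a) + ennreal (L * n a)"
    by (intro add_mono SL ennreal_leI le a)
  also have "\<dots> = ennreal (2 * L) * ennreal (n a)"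
    using L n by (simp add: ennreal_mult[symmetric] ennreal_plus[symmetric] del: ennreal_plus)
  finally show "ennreal (norm a) + (SUP \<epsilon>\<in>{0<..}. ennreal (norm (T \<epsilon> a))) \<le> ennreal (2 * L) * ennreal (n a)"
    by (simp only: S_def)
qed

theorem theorem3p26:
  fixes \<psi> :: "real^'d \<Rightarrow> 'a::complex_banach_algebra \<Rightarrow> 'a" and r :: real
  assumes "Cw_group \<psi>" and "0 < r" and "r < 2"
  shows
    "equivalent_norms_on (bessel_space \<psi> r) (\<lambda>a. ennreal (bessel_norm \<psi> r a))
       (\<lambda>a. ennreal (norm a) +
          (SUP \<epsilon>\<in>{0<..}. ennreal (norm (weak_integral \<psi> {t. \<epsilon> \<le> norm t}
             (\<lambda>t. (norm t powr (- r) / norm t ^ CARD('d)) *\<^sub>R (\<psi> t a - a)))))) \<and>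
     equivalent_norms_on (bessel_space \<psi> r) (\<lambda>a. ennreal (bessel_norm \<psi> r a))
       (\<lambda>a. ennreal (norm a) +
          (SUP \<epsilon>\<in>{0<..}. ennreal (norm (weak_integral \<psi> {t. \<epsilon> \<le> norm t \<and> norm t \<le> 1}
             (\<lambda>t. (1 / (norm t powr r * norm t ^ CARD('d))) *\<^sub>R (\<psi> t a - a))))))"
proof -
  interpret Cw_automorphism_group \<psi> by unfold_locales (rule assms(1))
  note r = assms(2,3)
  let ?c = "conv \<psi> (bessel_kernel r)"
  obtain K where K: "K > 0" and K': "\<forall>y. (\<forall>\<epsilon>>0. norm (full_integral r \<epsilon> (?c y)) \<le> K * norm y) \<and>
    (\<forall>X. (\<forall>\<epsilon>>0. norm (full_integral r \<epsilon> (?c y)) \<le> X) \<longrightarrow> norm y \<le> K * (X + norm (?c y)))"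
    using full_integral_equivalence[OF r] by blast
  have K2: "norm (full_integral r \<epsilon> (?c y)) \<le> K * norm y" if "\<epsilon> > 0" for \<epsilon> y
    using K' that by blast
  have K3: "norm y \<le> K * (X + norm (?c y))" if "\<And>\<epsilon>. \<epsilon> > 0 \<Longrightarrow> norm (full_integral r \<epsilon> (?c y)) \<le> X" for y X
    using K' that by blast
  define Z where "Z = (LBINT t. riesz_kernel r 1 (t::real^'d)) * (M + 1)"
  have Z: "Z \<ge> 0" unfolding Z_def using M_nonneg by (intro mult_nonneg_nonneg integral_nonneg_AE) auto
  have dif: "norm (full_integral r \<epsilon> a - local_integral r \<epsilon> a) \<le> Z * norm a" if "\<epsilon> > 0" for \<epsilon> a
    using full_local_difference[OF r(1) that, of a] by (simp add: Z_def mult.assoc)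
  have cle: "norm (?c y) \<le> M * norm y" for y by (rule norm_conv_le[OF r refl])
  \<comment> \<open>\<open>M\<close> bounds \<open>norm a\<close>, \<open>K\<close> the full
    integrals, and \<open>Z * M\<close> the passage from full to local ones.\<close>
  define L where "L = M + K + Z * M"
  have L: "0 < L" "M \<le> L" "K \<le> L" using K M_nonneg Z by (auto simp: L_def intro: add_nonneg_pos add_pos_nonneg)
  have V: "\<exists>y. a = ?c y" if "a \<in> bessel_space \<psi> r" for a using that by (auto simp: bessel_space_def)
  have n: "bessel_norm \<psi> r (?c y) = norm y" for y by (rule bessel_norm_conv[OF r])
  have nle: "norm a \<le> L * bessel_norm \<psi> r a" if aV: "a \<in> bessel_space \<psi> r" for a
  proof -
    obtain y where y: "a = ?c y" using V[OF aV] by blast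
    show ?thesis unfolding y n using cle[of y] mult_right_mono[OF L(2) norm_ge_zero[of y]] by linarith
  qed
  show ?thesis
  proof (rule conjI)
    show "equivalent_norms_on (bessel_space \<psi> r) (\<lambda>a. ennreal (bessel_norm \<psi> r a))
       (\<lambda>a. ennreal (norm a) + (SUP \<epsilon>\<in>{0<..}. ennreal (norm (full_integral r \<epsilon> a))))"
    proof (rule equivalent_norms_on_SUP[where T = "full_integral r", OF K L(1) nle])
      fix a and \<epsilon> :: real assume "a \<in> bessel_space \<psi> r" and eps: "\<epsilon> > 0"
      then obtain y where y: "a = ?c y" using V by blast
      show "norm (full_integral r \<epsilon> a) \<le> L * bessel_norm \<psi> r a"
        unfolding y n using K2[OF eps, of y] mult_right_mono[OF L(3) norm_ge_zero[of y]] by linarith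
    next
      fix a and X :: real assume "a \<in> bessel_space \<psi> r" and X: "\<And>\<epsilon>. \<epsilon> > 0 \<Longrightarrow> norm (full_integral r \<epsilon> a) \<le> X"
      then obtain y where y: "a = ?c y" using V by blast
      show "bessel_norm \<psi> r a \<le> K * (X + norm a)"
        unfolding n y by (rule K3) (use X y in simp)
    qed
    \<comment> \<open>Comes from X + Z norm a + norm a \<le> (1 + Z) (X + norm a), once local
      integrals bounded by X bound the full ones by X + Z norm a.\<close>
    have KZ: "0 < K * (1 + Z)" using K Z by (intro mult_pos_pos) auto
    show "equivalent_norms_on (bessel_space \<psi> r) (\<lambda>a. ennreal (bessel_norm \<psi> r a))
       (\<lambda>a. ennreal (norm a) + (SUP \<epsilon>\<in>{0<..}. ennreal (norm (local_integral r \<epsilon> a))))"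
    proof (rule equivalent_norms_on_SUP[where T = "local_integral r", OF KZ L(1) nle])
      fix a and \<epsilon> :: real assume "a \<in> bessel_space \<psi> r" and eps: "\<epsilon> > 0"
      then obtain y where y: "a = ?c y" using V by blast
      have "norm (local_integral r \<epsilon> a) \<le> norm (full_integral r \<epsilon> a) + norm (full_integral r \<epsilon> a - local_integral r \<epsilon> a)"
        using norm_triangle_ineq4[of "full_integral r \<epsilon> a" "full_integral r \<epsilon> a - local_integral r \<epsilon> a"] by simp
      also have "\<dots> \<le> K * norm y + Z * (M * norm y)"
        using K2[OF eps, of y] dif[OF eps, of a] mult_left_mono[OF cle[of y] Z] unfolding y by linarith
      also have "\<dots> \<le> L * norm y" using M_nonneg by (simp add: L_def algebra_simps)
      finally show "norm (local_integral r \<epsilon> a) \<le> L * bessel_norm \<psi> r a" unfolding y n .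
    next
      fix a and X :: real assume "a \<in> bessel_space \<psi> r" and X: "\<And>\<epsilon>. \<epsilon> > 0 \<Longrightarrow> norm (local_integral r \<epsilon> a) \<le> X"
      then obtain y where y: "a = ?c y" using V by blast
      have X0: "0 \<le> X" using X[of 1] norm_ge_zero order_trans zero_less_one by blast
      have "norm (full_integral r \<epsilon> (?c y)) \<le> X + Z * norm a" if eps: "\<epsilon> > 0" for \<epsilon>
        using norm_triangle_ineq[of "local_integral r \<epsilon> a" "full_integral r \<epsilon> a - local_integral r \<epsilon> a"] X[OF eps] dif[OF eps, of a]
        by (simp add: y)
      hence "norm y \<le> K * (X + Z * norm a + norm (?c y))" by (rule K3)
      also have "\<dots> \<le> K * ((1 + Z) * (X + norm a))"
        using K X0 Z by (intro mult_left_mono) (auto simp: y algebra_simps)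
      finally show "bessel_norm \<psi> r a \<le> K * (1 + Z) * (X + norm a)" unfolding y n by (simp only: mult.assoc)
    qed
  qed
qed

end
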